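(* Let $n>1$, let $\theta_1,\ldots,\theta_n\in H^\infty(\mathbb{D})$ be nonconstant inner functions, and let $\mathcal{Q}_\Theta=\mathcal{Q}_{\theta_1}\otimes\cdots\otimes\mathcal{Q}_{\theta_n}$. A submodule $\mathcal{M}$ of $\mathcal{Q}_\Theta$ is doubly commuting if and only if \[ \mathcal{M}=\eta_1\mathcal{Q}_{\varphi_1}\otimes\cdots\otimes\eta_n\mathcal{Q}_{\varphi_n}, \] where $\eta_j,\varphi_j\in H^\infty(\mathbb{D})$ are inner functions satisfying $\eta_j\varphi_j=\theta_j$ for all $j=1,\ldots,n$.
   Context: $H^2(\mathbb{D})$ is the Hardy space of the open unit disc $\mathbb{D}$, and $T_z$ is multiplication by $z$ on it. An inner function is a $\varphi\in H^\infty(\mathbb{D})$ with $|\varphi|=1$ a.e. on the unit circle (unimodular constants are allowed unless "nonconstant" is specified). For an inner function $\varphi$, $\mathcal{Q}_\varphi:=H^2(\mathbb{D})\ominus\varphi H^2(\mathbb{D})$ (so $\mathcal{Q}_\varphi=\{0\}$ if $\varphi$ is constant), and $\eta\mathcal{Q}_\varphi=\{\eta f: f\in\mathcal{Q}_\varphi\}$. For a nonconstant inner function $\theta$, $S_\theta:=P_{\mathcal{Q}_\theta}T_z|_{\mathcal{Q}_\theta}\in\mathcal{B}(\mathcal{Q}_\theta)$, where $P_{\mathcal{Q}_\theta}$ is the orthogonal projection onto $\mathcal{Q}_\theta$. Tensor products are Hilbert space tensor products. On $\mathcal{Q}_\Theta$ let $S_{\Theta_j}$ be the tensor product operator having $S_{\theta_j}$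 in the $j$-th factor and the identity in all other factors. A submodule of $\mathcal{Q}_\Theta$ is a closed subspace $\mathcal{M}\subseteq\mathcal{Q}_\Theta$ with $S_{\Theta_j}\mathcal{M}\subseteq\mathcal{M}$ for all $j=1,\ldots,n$. A tuple $(R_1,\ldots,R_n)$ of bounded operators on a Hilbert space is doubly commuting if $R_iR_j=R_jR_i$ and $R_i^*R_j=R_jR_i^*$ for all $i<j$. A submodule $\mathcal{M}$ is doubly commuting if the tuple $(S_{\Theta_1}|_{\mathcal{M}},\ldots,S_{\Theta_n}|_{\mathcal{M}})$ of operators on $\mathcal{M}$ is doubly commuting (adjoints taken in $\mathcal{B}(\mathcal{M})$). *)

theory Defs
  imports "HOL-Complex_Analysis.Complex_Analysis" "HOL-Library.Function_Algebras"
begin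

section \<open>Hilbert spaces of complex-valued functions\<close>

text \<open>
  All Hilbert spaces below are sets of functions \<open>'a \<Rightarrow> complex\<close> with the pointwise vector space
  structure, together with an inner product \<open>ip\<close> that is linear in its first argument. As \<open>ip\<close> is
  only meaningful on the relevant carrier, the carrier is passed explicitly where it matters.
\<close>

definition cscale :: "complex \<Rightarrow> ('a \<Rightarrow> complex) \<Rightarrow> 'a \<Rightarrow> complex"
  where "cscale c f = (\<lambda>x. c * f x)"

global_interpretation cfun: vector_space "cscale :: complex \<Rightarrow> ('a \<Rightarrow> complex) \<Rightarrow> 'a \<Rightarrow> complex"
  by unfold_locales (auto simp: cscale_def fun_eq_iff algebra_simps)

type_synonym 'a cinner = "('a \<Rightarrow> complex) \<Rightarrow> ('a \<Rightarrow> complex) \<Rightarrow> complex"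

definition hnorm :: "'a cinner \<Rightarrow> ('a \<Rightarrow> complex) \<Rightarrow> real"
  where "hnorm ip f = sqrt (Re (ip f f))"

definition hconverges :: "'a cinner \<Rightarrow> (nat \<Rightarrow> 'a \<Rightarrow> complex) \<Rightarrow> ('a \<Rightarrow> complex) \<Rightarrow> bool"
  where "hconverges ip X f \<longleftrightarrow> (\<lambda>k. hnorm ip (X k - f)) \<longlonglongrightarrow> 0"

definition closed_subspace ::
    "'a cinner \<Rightarrow> ('a \<Rightarrow> complex) set \<Rightarrow> ('a \<Rightarrow> complex) set \<Rightarrow> bool"
  where "closed_subspace ip H M \<longleftrightarrow>
    M \<subseteq> H \<and> cfun.subspace M \<and>
    (\<forall>X. \<forall>f\<in>H. (\<forall>k. X k \<in> M) \<longrightarrow> hconverges ip X f \<longrightarrow> f \<in> M)"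

definition closed_span ::
    "'a cinner \<Rightarrow> ('a \<Rightarrow> complex) set \<Rightarrow> ('a \<Rightarrow> complex) set \<Rightarrow> ('a \<Rightarrow> complex) set"
  where "closed_span ip H A =
    {f \<in> H. \<exists>X. (\<forall>k. X k \<in> cfun.span A) \<and> hconverges ip X f}"

definition orth_proj :: "'a cinner \<Rightarrow> ('a \<Rightarrow> complex) set \<Rightarrow> ('a \<Rightarrow> complex) \<Rightarrow> 'a \<Rightarrow> complex"
  where "orth_proj ip M f = (THE g. g \<in> M \<and> (\<forall>h\<in>M. ip (f - g) h = 0))"

definition bounded_operator_on ::
    "'a cinner \<Rightarrow> ('a \<Rightarrow> complex) set \<Rightarrow> (('a \<Rightarrow> complex) \<Rightarrow> 'a \<Rightarrow> complex) \<Rightarrow> bool"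
  where "bounded_operator_on ip H T \<longleftrightarrow>
    (\<forall>f\<in>H. T f \<in> H) \<and>
    (\<forall>f\<in>H. \<forall>g\<in>H. T (f + g) = T f + T g) \<and>
    (\<forall>c. \<forall>f\<in>H. T (cscale c f) = cscale c (T f)) \<and>
    (\<exists>C. \<forall>f\<in>H. hnorm ip (T f) \<le> C * hnorm ip f)"

text \<open>
  The adjoint in \<open>\<B>(M)\<close>: for a bounded operator \<open>R\<close> on a Hilbert space \<open>M\<close> and \<open>g \<in> M\<close>, the
  vector \<open>R\<^sup>* g\<close> is the unique \<open>h \<in> M\<close> representing the functional \<open>f \<mapsto> \<langle>R f, g\<rangle>\<close> on \<open>M\<close>.
\<close>

definition adjoint_on ::
    "'a cinner \<Rightarrow> ('a \<Rightarrow> complex) set \<Rightarrow> (('a \<Rightarrow> complex) \<Rightarrow> 'a \<Rightarrow> complex)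
      \<Rightarrow> ('a \<Rightarrow> complex) \<Rightarrow> 'a \<Rightarrow> complex"
  where "adjoint_on ip M R g = (THE h. h \<in> M \<and> (\<forall>f\<in>M. ip (R f) g = ip f h))"

text \<open>
  For bounded operators \<open>R i\<close> mapping the Hilbert space \<open>M\<close> to itself; only the values of \<open>R i\<close>
  on \<open>M\<close> matter, so restrictions to \<open>M\<close> need not be written.
\<close>

definition doubly_commuting_on ::
    "'a cinner \<Rightarrow> ('a \<Rightarrow> complex) set \<Rightarrow> ('n::linorder \<Rightarrow> ('a \<Rightarrow> complex) \<Rightarrow> 'a \<Rightarrow> complex) \<Rightarrow> bool"
  where "doubly_commuting_on ip M R \<longleftrightarrow>
    (\<forall>i j. i < j \<longrightarrow> (\<forall>f\<in>M.
        R i (R j f) = R j (R i f) \<and>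
        adjoint_on ip M (R i) (R j f) = R j (adjoint_on ip M (R i) f)))"


section \<open>Hardy space, inner functions, model spaces\<close>

definition taylor :: "(complex \<Rightarrow> complex) \<Rightarrow> nat \<Rightarrow> complex"
  where "taylor f k = (deriv ^^ k) f 0 / fact k"

text \<open>
  Elements of \<open>H\<^sup>2(\<D>)\<close> are functions on the disc; as total functions they are normalised to vanish
  off the disc, so that equality of functions is equality in \<open>H\<^sup>2(\<D>)\<close>. Inner functions carry no
  such normalisation: they are only ever evaluated on the disc or multiplied with elements
  of \<open>H\<^sup>2(\<D>)\<close>.
\<close>

definition hardy2 :: "(complex \<Rightarrow> complex) set"
  where "hardy2 = {f. f holomorphic_on ball 0 1 \<and>
    summable (\<lambda>k. (cmod (taylor f k))\<^sup>2) \<and> (\<forall>z. z \<notin> ball 0 1 \<longrightarrow> f z = 0)}"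

definition hardy2_inner :: "complex cinner"
  where "hardy2_inner f g = (\<Sum>k. taylor f k * cnj (taylor g k))"

definition Hinf :: "(complex \<Rightarrow> complex) set"
  where "Hinf = {f. f holomorphic_on ball 0 1 \<and> bounded (f ` ball 0 1)}"

text \<open>Boundary values on the circle are radial limits, which exist a.e. by Fatou's theorem.\<close>

definition inner_function :: "(complex \<Rightarrow> complex) \<Rightarrow> bool"
  where "inner_function \<phi> \<longleftrightarrow> \<phi> \<in> Hinf \<and>
    (AE t in lebesgue_on {0..2 * pi}.
       \<exists>w. cmod w = 1 \<and> ((\<lambda>r. \<phi> (complex_of_real r * cis t)) \<longlongrightarrow> w) (at_left 1))"

definition model_space :: "(complex \<Rightarrow> complex) \<Rightarrow> (complex \<Rightarrow> complex) set"
  where "model_space \<phi> = {f \<in> hardy2. \<forall>g\<in>hardy2. hardy2_inner f (\<phi> * g) = 0}"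

definition shift :: "(complex \<Rightarrow> complex) \<Rightarrow> complex \<Rightarrow> complex"
  where "shift f = (\<lambda>z. z * f z)"

definition compressed_shift ::
    "(complex \<Rightarrow> complex) \<Rightarrow> (complex \<Rightarrow> complex) \<Rightarrow> complex \<Rightarrow> complex"
  where "compressed_shift \<theta> f = orth_proj hardy2_inner (model_space \<theta>) (shift f)"


section \<open>Hilbert space tensor products\<close>

text \<open>
  The map \<open>taylor\<close> is a unitary from \<open>H\<^sup>2(\<D>)\<close> onto \<open>\<ell>\<^sup>2(\<nat>)\<close>, so the \<open>n\<close>-fold Hilbert space tensor
  product of \<open>H\<^sup>2(\<D>)\<close> is realised as \<open>\<ell>\<^sup>2(\<nat>\<^sup>n)\<close>, with \<open>f\<^sub>1 \<otimes> \<dots> \<otimes> f\<^sub>n\<close> the family of products of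
  Taylor coefficients (equivalently, the Taylor coefficients of \<open>f\<^sub>1(z\<^sub>1)\<dots>f\<^sub>n(z\<^sub>n) \<in> H\<^sup>2(\<D>\<^sup>n)\<close>).
  The factors are indexed by a finite linearly ordered type \<open>'n\<close> with \<open>n\<close> elements. The tensor
  product of closed subspaces of \<open>H\<^sup>2(\<D>)\<close> is the closed linear span of the elementary tensors;
  that this carries the inner product of the Hilbert space tensor product is
  \<open>ell2_inner_etensor\<close> below.
\<close>

definition ell2 :: "(('n::finite \<Rightarrow> nat) \<Rightarrow> complex) set"
  where "ell2 = {c. (\<lambda>\<alpha>. (cmod (c \<alpha>))\<^sup>2) summable_on UNIV}"

definition ell2_inner :: "('n::finite \<Rightarrow> nat) cinner"
  where "ell2_inner c d = (\<Sum>\<^sub>\<infinity>\<alpha>. c \<alpha> * cnj (d \<alpha>))"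

definition etensor :: "('n::finite \<Rightarrow> complex \<Rightarrow> complex) \<Rightarrow> ('n \<Rightarrow> nat) \<Rightarrow> complex"
  where "etensor f = (\<lambda>\<alpha>. \<Prod>j\<in>UNIV. taylor (f j) (\<alpha> j))"

definition tensor_space ::
    "('n::finite \<Rightarrow> (complex \<Rightarrow> complex) set) \<Rightarrow> (('n \<Rightarrow> nat) \<Rightarrow> complex) set"
  where "tensor_space E = closed_span ell2_inner ell2 {etensor f | f. \<forall>j. f j \<in> E j}"

text \<open>
  The tensor product \<open>A\<^sub>1 \<otimes> \<dots> \<otimes> A\<^sub>n\<close> of bounded operators \<open>A\<^sub>j\<close> on \<open>E\<^sub>j\<close>: the unique bounded
  operator acting factorwise on elementary tensors. Membership in \<open>extensional\<close> fixes the
  irrelevant values off the carrier, which makes the operator unique as a total function.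
\<close>

definition tensor_operator ::
    "('n::finite \<Rightarrow> (complex \<Rightarrow> complex) set)
      \<Rightarrow> ('n \<Rightarrow> (complex \<Rightarrow> complex) \<Rightarrow> complex \<Rightarrow> complex)
      \<Rightarrow> (('n \<Rightarrow> nat) \<Rightarrow> complex) \<Rightarrow> ('n \<Rightarrow> nat) \<Rightarrow> complex"
  where "tensor_operator E A = (THE T.
    T \<in> extensional (tensor_space E) \<and>
    bounded_operator_on ell2_inner (tensor_space E) T \<and>
    (\<forall>f. (\<forall>j. f j \<in> E j) \<longrightarrow> T (etensor f) = etensor (\<lambda>j. A j (f j))))"

lemma hardy2_square_summable:
  assumes "f \<in> hardy2"
  shows "(\<lambda>k. (cmod (taylor f k))\<^sup>2) summable_on UNIV"
proof -
  have "summable (\<lambda>k. norm ((cmod (taylor f k))\<^sup>2))"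
    using assms by (simp add: hardy2_def)
  then show ?thesis
    by (rule norm_summable_imp_summable_on)
qed

lemma etensor_in_ell2:
  fixes f :: "'n::finite \<Rightarrow> complex \<Rightarrow> complex"
  assumes "\<And>j. f j \<in> hardy2"
  shows "etensor f \<in> ell2"
proof -
  have "Infinite_Set_Sum.abs_summable_on
      (\<lambda>\<alpha>. \<Prod>j\<in>(UNIV::'n set). (cmod (taylor (f j) (\<alpha> j)))\<^sup>2) (PiE UNIV (\<lambda>_. UNIV))"
    by (rule abs_summable_on_prod_PiE)
      (use hardy2_square_summable[OF assms] in \<open>auto simp flip: abs_summable_equivalent\<close>)
  then show ?thesis
    by (simp add: ell2_def etensor_def PiE_UNIV_domain prod_power_distrib abs_prod
        flip: abs_summable_equivalent prod_norm)
qed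

lemma hardy2_inner_abs_summable:
  assumes "f \<in> hardy2" "g \<in> hardy2"
  shows "(\<lambda>k. norm (taylor f k * cnj (taylor g k))) summable_on UNIV"
  by (rule abs_summable_product)
    (use assms[THEN hardy2_square_summable] in \<open>simp_all add: norm_mult power2_eq_square\<close>)

lemma ell2_inner_etensor:
  fixes f g :: "'n::finite \<Rightarrow> complex \<Rightarrow> complex"
  assumes "\<And>j. f j \<in> hardy2" "\<And>j. g j \<in> hardy2"
  shows "ell2_inner (etensor f) (etensor g) = (\<Prod>j\<in>UNIV. hardy2_inner (f j) (g j))"
proof -
  have "ell2_inner (etensor f) (etensor g) =
      (\<Sum>\<^sub>\<infinity>\<alpha>\<in>PiE UNIV (\<lambda>_. UNIV). \<Prod>j\<in>(UNIV::'n set). taylor (f j) (\<alpha> j) * cnj (taylor (g j) (\<alpha> j)))"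
    by (simp add: ell2_inner_def etensor_def PiE_UNIV_domain prod.distrib)
  also have "\<dots> = (\<Prod>j\<in>UNIV. \<Sum>\<^sub>\<infinity>k. taylor (f j) k * cnj (taylor (g j) k))"
    by (rule infsum_prod_PiE_abs) (use hardy2_inner_abs_summable assms in auto)
  also have "\<dots> = (\<Prod>j\<in>UNIV. hardy2_inner (f j) (g j))"
  proof (rule prod.cong[OF refl])
    fix j
    have "(\<lambda>k. taylor (f j) k * cnj (taylor (g j) k)) summable_on UNIV"
      by (rule abs_summable_summable) (rule hardy2_inner_abs_summable[OF assms])
    then have "(\<lambda>k. taylor (f j) k * cnj (taylor (g j) k)) sums
        (\<Sum>\<^sub>\<infinity>k. taylor (f j) k * cnj (taylor (g j) k))"
      by (intro has_sum_imp_sums has_sum_infsum)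
    then show "(\<Sum>\<^sub>\<infinity>k. taylor (f j) k * cnj (taylor (g j) k)) = hardy2_inner (f j) (g j)"
      by (simp add: hardy2_inner_def sums_iff)
  qed
  finally show ?thesis .
qed


section \<open>Submodules of the tensor product of model spaces\<close>

definition tensor_model_space ::
    "('n::finite \<Rightarrow> complex \<Rightarrow> complex) \<Rightarrow> (('n \<Rightarrow> nat) \<Rightarrow> complex) set"
  where "tensor_model_space \<theta> = tensor_space (\<lambda>j. model_space (\<theta> j))"

definition tensor_shift ::
    "('n::finite \<Rightarrow> complex \<Rightarrow> complex) \<Rightarrow> 'n
      \<Rightarrow> (('n \<Rightarrow> nat) \<Rightarrow> complex) \<Rightarrow> ('n \<Rightarrow> nat) \<Rightarrow> complex"
  where "tensor_shift \<theta> j = tensor_operator (\<lambda>i. model_space (\<theta> i))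
    (\<lambda>i. if i = j then compressed_shift (\<theta> i) else id)"

definition is_submodule ::
    "('n::finite \<Rightarrow> complex \<Rightarrow> complex) \<Rightarrow> (('n \<Rightarrow> nat) \<Rightarrow> complex) set \<Rightarrow> bool"
  where "is_submodule \<theta> M \<longleftrightarrow>
    closed_subspace ell2_inner (tensor_model_space \<theta>) M \<and>
    (\<forall>j. tensor_shift \<theta> j ` M \<subseteq> M)"

definition doubly_commuting_submodule ::
    "('n::{finite,linorder} \<Rightarrow> complex \<Rightarrow> complex) \<Rightarrow> (('n \<Rightarrow> nat) \<Rightarrow> complex) set \<Rightarrow> bool"
  where "doubly_commuting_submodule \<theta> M \<longleftrightarrow>
    is_submodule \<theta> M \<and> doubly_commuting_on ell2_inner M (tensor_shift \<theta>)"

end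

theory Submission
  imports Defs
begin

text \<open>
  Taylor coefficients identify \<open>H\<^sup>2(\<D>)\<close> with \<open>l\<^sup>2(\<nat>)\<close>; inner functions become the square-summable
  sequences \<open>x\<close> whose translates are orthonormal. One half of this is dominated convergence along
  the radii; the other half needs Fatou's theorem on radial limits, which follows from an \<open>L\<^sup>2\<close>
  maximal inequality for the Poisson kernel.

  Let \<open>R\<^sub>j\<close> be the restriction of the \<open>j\<close>-th coordinate operator to a doubly commuting submodule \<open>M\<close>.
  On \<open>\<Q>\<^sub>\<theta>\<close> the defect \<open>1 - S\<^sup>* S\<close> is the rank one operator given by the backward shift of \<open>\<theta>\<close>, so on
  \<open>M\<close> the product of the commuting operators \<open>1 - R\<^sub>j\<^sup>* R\<^sub>j\<close> is \<open>\<langle>\<cdot>, u\<rangle> u\<close> with \<open>u\<close> the projection to \<open>M\<close> of an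
  elementary tensor. Since operators built from different coordinates commute, the Gram matrix of
  the vectors \<open>R\<^sup>*\<^sup>\<alpha> u\<close> factorises over the coordinates. These vectors span \<open>M\<close> and are projections of
  elementary tensors, hence they are elementary tensors themselves and \<open>M\<close> is a tensor product of
  \<open>S\<close>-invariant subspaces. Each factor \<open>N \<subseteq> \<Q>\<^sub>\<theta>\<close> makes \<open>N \<oplus> \<theta> H\<^sup>2\<close> shift invariant, and Beurling's
  theorem yields \<open>N = \<eta> \<Q>\<^sub>\<phi>\<close> with \<open>\<eta> \<phi> = \<theta>\<close>. Conversely, on \<open>\<eta> \<Q>\<^sub>\<phi>\<close> the adjoint of \<open>S\<close> is
  \<open>\<eta> f \<mapsto> \<eta> f'\<close> with \<open>f'\<close> the backward shift of \<open>f\<close>, so operators in different factors doubly commute.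
\<close>

section \<open>The Hilbert space of square-summable families\<close>

text \<open>Square-summable families form a type, so that limits, closures and series come from the
  class of complete real inner product spaces; the last section returns to the sets of functions in
  the statement. Adjoints depend on the space in which they are formed, so the rank one formula for
  the defect on the tensor model does not restrict to \<open>M\<close> as an operator identity.
  Forms do restrict: the form of the defect is \<langle>f, h\<rangle> - \<langle>S f, S h\<rangle>,
  which involves no adjoint, and \<open>M\<close> is invariant under \<open>S\<close>. Hence product
  identities are proved for forms on elementary tensors and only then read in \<open>M\<close>. The
  position of \<open>M\<close> relative to the tensor structure is unknown, so its factors are
  recovered from scalars. Let \<open>D\<close> be the defect of coordinate \<open>j\<close> and
  \<open>E\<close> the product of the others, so that \<open>D E\<close> is
  \<open>\<langle>\<cdot>, u\<rangle> u\<close>. Then \<open>u\<close> is an eigenvector of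
  \<open>E\<close>, and for any word \<open>X\<close> in the \<open>j\<close>-th operator and its
  adjoint \<open>D X u\<close> is a multiple of \<open>u\<close>. This is what makes the Gram matrix
  a product. For radial limits, the bound by \<open>T + T\<^sup>*\<close> replaces covering
  arguments.\<close>

typedef 'a l2 = "{f :: 'a \<Rightarrow> complex. (\<lambda>x. (cmod (f x))\<^sup>2) summable_on UNIV}"
  morphisms coord Abs_l2
  by (rule exI[of _ "\<lambda>_. 0"]) simp

setup_lifting type_definition_l2

lemma coord_summable: "(\<lambda>x. (cmod (coord f x))\<^sup>2) summable_on UNIV"
  using coord[of f] by simp

lemma square_summable_add:
  fixes f g :: "'a \<Rightarrow> complex"
  assumes "(\<lambda>x. (cmod (f x))\<^sup>2) summable_on UNIV" "(\<lambda>x. (cmod (g x))\<^sup>2) summable_on UNIV"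
  shows "(\<lambda>x. (cmod (f x + g x))\<^sup>2) summable_on UNIV"
proof (rule summable_on_comparison_test)
  show "(\<lambda>x. 2 * (cmod (f x))\<^sup>2 + 2 * (cmod (g x))\<^sup>2) summable_on UNIV"
    by (intro summable_on_add summable_on_cmult_right assms)
  fix x
  have "(cmod (f x + g x))\<^sup>2 \<le> (cmod (f x) + cmod (g x))\<^sup>2"
    by (intro power_mono norm_triangle_ineq) auto
  also have "\<dots> \<le> 2 * (cmod (f x))\<^sup>2 + 2 * (cmod (g x))\<^sup>2"
    using sum_squares_bound[of "cmod (f x)" "cmod (g x)"] by (simp add: power2_sum)
  finally show "(cmod (f x + g x))\<^sup>2 \<le> 2 * (cmod (f x))\<^sup>2 + 2 * (cmod (g x))\<^sup>2" .
qed auto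

lemma square_summable_scale:
  fixes f :: "'a \<Rightarrow> complex"
  assumes "(\<lambda>x. (cmod (f x))\<^sup>2) summable_on UNIV"
  shows "(\<lambda>x. (cmod (c * f x))\<^sup>2) summable_on UNIV"
  using summable_on_cmult_right[OF assms, of "(cmod c)\<^sup>2"] by (simp add: norm_mult power_mult_distrib)

lemma square_summable_product:
  fixes f g :: "'a \<Rightarrow> complex"
  assumes "(\<lambda>x. (cmod (f x))\<^sup>2) summable_on UNIV" "(\<lambda>x. (cmod (g x))\<^sup>2) summable_on UNIV"
  shows "(\<lambda>x. f x * cnj (g x)) summable_on UNIV"
  by (rule abs_summable_summable, rule abs_summable_product)
    (use assms in \<open>simp_all add: norm_mult power2_eq_square\<close>)

lift_definition scaleC :: "complex \<Rightarrow> 'a l2 \<Rightarrow> 'a l2" (infixr "*\<^sub>C" 75)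
  is "\<lambda>c f x. c * f x" by (rule square_summable_scale)

lift_definition cip :: "'a l2 \<Rightarrow> 'a l2 \<Rightarrow> complex"
  is "\<lambda>f g. \<Sum>\<^sub>\<infinity>x. f x * cnj (g x)" .

instantiation l2 :: (type) real_vector
begin

lift_definition zero_l2 :: "'a l2" is "\<lambda>_. 0" by simp
lift_definition plus_l2 :: "'a l2 \<Rightarrow> 'a l2 \<Rightarrow> 'a l2" is "\<lambda>f g x. f x + g x"
  by (rule square_summable_add)
lift_definition uminus_l2 :: "'a l2 \<Rightarrow> 'a l2" is "\<lambda>f x. - f x" by simp
lift_definition minus_l2 :: "'a l2 \<Rightarrow> 'a l2 \<Rightarrow> 'a l2" is "\<lambda>f g x. f x - g x"
  subgoal for f g using square_summable_add[of f "\<lambda>x. - g x"] by simp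
  done
lift_definition scaleR_l2 :: "real \<Rightarrow> 'a l2 \<Rightarrow> 'a l2" is "\<lambda>c f x. of_real c * f x"
  by (rule square_summable_scale)

instance
  by standard (transfer; auto simp: algebra_simps)+

end

lemma scaleR_scaleC: "r *\<^sub>R f = of_real r *\<^sub>C f"
  by transfer simp

lemma coord_simps [simp]:
  "coord 0 x = 0" "coord (f + g) x = coord f x + coord g x" "coord (f - g) x = coord f x - coord g x"
  "coord (- f) x = - coord f x" "coord (c *\<^sub>C f) x = c * coord f x" "coord (r *\<^sub>R f) x = r *\<^sub>R coord f x"
  by (transfer; simp add: scaleR_conv_of_real)+

lemma l2_eqI: "(\<And>x. coord f x = coord g x) \<Longrightarrow> f = g"
  by transfer auto

global_interpretation cl2: vector_space "scaleC :: complex \<Rightarrow> 'a l2 \<Rightarrow> 'a l2"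
  by unfold_locales (auto intro!: l2_eqI simp: algebra_simps)

lemma cip_add_left: "cip (f + g) h = cip f h + cip g h"
  by transfer (simp add: distrib_right infsum_add square_summable_product)

lemma cip_scaleC_left [simp]: "cip (c *\<^sub>C f) h = c * cip f h"
  by transfer (simp add: mult.assoc infsum_cmult_right square_summable_product)

lemma cip_commute: "cip f g = cnj (cip g f)"
  by transfer (simp flip: infsum_cnj add: mult.commute)

lemma cip_add_right: "cip f (g + h) = cip f g + cip f h"
  by (metis cip_commute cip_add_left complex_cnj_add)

lemma cip_scaleC_right [simp]: "cip f (c *\<^sub>C g) = cnj c * cip f g"
  by (metis cip_commute cip_scaleC_left complex_cnj_mult)

lemma cip_zero [simp]: "cip 0 f = 0" "cip f 0 = 0"
  by (transfer; simp)+

lemma cip_minus_left [simp]: "cip (- f) g = - cip f g"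
  by transfer (simp add: infsum_uminus)

lemma cip_minus_right [simp]: "cip f (- g) = - cip f g"
  by transfer (simp add: infsum_uminus)

lemma cip_diff_left: "cip (f - g) h = cip f h - cip g h"
  using cip_add_left[of f "- g" h] by simp

lemma cip_diff_right: "cip f (g - h) = cip f g - cip f h"
  using cip_add_right[of f g "- h"] by simp

lemma cip_self: "cip f f = of_real (\<Sum>\<^sub>\<infinity>x. (cmod (coord f x))\<^sup>2)"
  using infsumI[OF has_sum_of_real[OF has_sum_infsum[OF coord_summable[of f]]], where 'a1 = complex]
  by (simp add: cip.rep_eq complex_norm_square flip: of_real_power)

lemma cip_self_nonneg: "Re (cip f f) \<ge> 0"
  by (simp add: cip_self infsum_nonneg)

lemma cip_self_eq_0_iff [simp]: "cip f f = 0 \<longleftrightarrow> f = 0"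
proof
  assume "cip f f = 0"
  then have "(\<Sum>\<^sub>\<infinity>x. (cmod (coord f x))\<^sup>2) = 0"
    by (simp add: cip_self)
  then have "(cmod (coord f x))\<^sup>2 = 0" for x
    by (intro nonneg_infsum_le_0D[where A = UNIV]) (auto intro: coord_summable)
  then show "f = 0"
    by (intro l2_eqI) simp
qed simp

text \<open>The class knows real scalars only, so it receives the real part of \<open>cip\<close>;
  the complex structure stays in \<open>cip\<close> and \<open>scaleC\<close>. Norm and topology are
  the same for both.\<close>

instantiation l2 :: (type) real_inner
begin

definition inner_l2 :: "'a l2 \<Rightarrow> 'a l2 \<Rightarrow> real" where "inner_l2 f g = Re (cip f g)"
definition norm_l2 :: "'a l2 \<Rightarrow> real" where "norm_l2 f = sqrt (inner f f)"
definition dist_l2 :: "'a l2 \<Rightarrow> 'a l2 \<Rightarrow> real" where "dist_l2 f g = norm (f - g)"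
definition sgn_l2 :: "'a l2 \<Rightarrow> 'a l2" where "sgn_l2 f = f /\<^sub>R norm f"
definition uniformity_l2 :: "('a l2 \<times> 'a l2) filter"
  where "uniformity_l2 = (INF e\<in>{0 <..}. principal {(x, y). dist x y < e})"
definition open_l2 :: "'a l2 set \<Rightarrow> bool"
  where "open_l2 U \<longleftrightarrow> (\<forall>x\<in>U. \<forall>\<^sub>F (x', y) in uniformity. x' = x \<longrightarrow> y \<in> U)"

instance
proof
  fix f g h :: "'a l2" and r :: real
  show "inner f g = inner g f"
    unfolding inner_l2_def by (subst cip_commute) simp
  show "inner (f + g) h = inner f h + inner g h"
    by (simp add: inner_l2_def cip_add_left)
  show "inner (r *\<^sub>R f) g = r * inner f g"
    by (simp add: inner_l2_def scaleR_scaleC)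
  show "0 \<le> inner f f"
    by (simp add: inner_l2_def cip_self_nonneg)
  have "inner f f = 0 \<longleftrightarrow> cip f f = 0"
    by (auto simp: inner_l2_def cip_self)
  then show "inner f f = 0 \<longleftrightarrow> f = 0"
    by simp
qed (auto simp: norm_l2_def dist_l2_def sgn_l2_def uniformity_l2_def open_l2_def)

end

section \<open>Norm, Cauchy-Schwarz inequality and completeness\<close>

lemma norm_square_infsum: "(norm f)\<^sup>2 = (\<Sum>\<^sub>\<infinity>x. (cmod (coord f x))\<^sup>2)"
  unfolding norm_l2_def inner_l2_def cip_self by (simp add: infsum_nonneg)

lemma cip_self_norm: "cip f f = of_real ((norm f)\<^sup>2)"
  by (simp add: cip_self norm_square_infsum)

lemma norm_scaleC [simp]: "norm (c *\<^sub>C f) = cmod c * norm f"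
proof -
  have "(norm (c *\<^sub>C f))\<^sup>2 = (cmod c * norm f)\<^sup>2"
    by (simp add: norm_square_infsum norm_mult power_mult_distrib infsum_cmult_right coord_summable)
  then show ?thesis
    by (simp add: power2_eq_iff_nonneg)
qed

lemma norm_cip_le: "cmod (cip f g) \<le> norm f * norm g"
proof (cases "cip f g = 0")
  case False
  \<comment> \<open>A unimodular factor rotates \<open>cip f g\<close> to its modulus, which reduces
    the claim to the real Cauchy-Schwarz inequality of the class.\<close>
  define c where "c = cnj (cip f g) / cmod (cip f g)"
  have "cmod c = 1"
    using False by (simp add: c_def norm_divide)
  have "cnj (cip f g) * cip f g = complex_of_real (cmod (cip f g)) * complex_of_real (cmod (cip f g))"
    using complex_norm_square[of "cip f g"] by (simp add: power2_eq_square mult.commute)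
  then have "cmod (cip f g) = Re (cip (c *\<^sub>C f) g)"
    using False by (simp add: c_def)
  also have "\<dots> \<le> norm (c *\<^sub>C f) * norm g"
    using norm_cauchy_schwarz[of "c *\<^sub>C f" g] by (simp add: inner_l2_def)
  finally show ?thesis
    using \<open>cmod c = 1\<close> by simp
qed simp

lemma square_norm_sum_le: "finite F \<Longrightarrow> (\<Sum>x\<in>F. (cmod (coord f x))\<^sup>2) \<le> (norm f)\<^sup>2"
  unfolding norm_square_infsum by (rule finite_sum_le_infsum[OF coord_summable]) auto

lemma norm_coord_le: "cmod (coord f x) \<le> norm f"
  using square_norm_sum_le[of "{x}" f] by (simp add: power_mono_iff)

lemma bounded_linear_coord: "bounded_linear (\<lambda>f. coord f x)"
  by (rule bounded_linear_intro[where K = 1]) (auto simp: norm_coord_le)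

lemma bounded_linear_cip_left: "bounded_linear (\<lambda>f. cip f g)"
  by (rule bounded_linear_intro[where K = "norm g"])
    (auto simp: cip_add_left scaleR_scaleC norm_cip_le scaleR_conv_of_real)

lemma bounded_linear_scaleC: "bounded_linear (scaleC c)"
  by (rule bounded_linear_intro[where K = "cmod c"])
    (auto simp: cl2.scale_right_distrib scaleR_scaleC mult.commute)

lemmas continuous_on_cip_left [continuous_intros] =
  bounded_linear.continuous_on[OF bounded_linear_cip_left]

lemma cip_sum_left: "cip (sum f A) g = (\<Sum>a\<in>A. cip (f a) g)"
  by (induction A rule: infinite_finite_induct) (auto simp: cip_add_left)

lemma cip_sum_right: "cip g (sum f A) = (\<Sum>a\<in>A. cip g (f a))"
  by (induction A rule: infinite_finite_induct) (auto simp: cip_add_right)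

instance l2 :: (type) complete_space
proof
  fix X :: "nat \<Rightarrow> 'a l2"
  assume X: "Cauchy X"
  have "Cauchy (\<lambda>n. coord (X n) x)" for x
    by (rule bounded_linear.Cauchy[OF bounded_linear_coord X])
  then have "\<forall>x. \<exists>l. (\<lambda>n. coord (X n) x) \<longlonglongrightarrow> l"
    by (simp add: Cauchy_convergent_iff convergent_def)
  from choice[OF this] obtain g where "\<forall>x. (\<lambda>n. coord (X n) x) \<longlonglongrightarrow> g x" ..
  then have g: "(\<lambda>n. coord (X n) x) \<longlonglongrightarrow> g x" for x ..
  \<comment> \<open>Finite sums pass to the coordinatewise limit. As the bound is the same for every
    finite \<open>F\<close>, it later yields both summability of the difference and its norm
    estimate.\<close>
  have tail: "\<exists>N. \<forall>n\<ge>N. \<forall>F. finite F \<longrightarrow> (\<Sum>x\<in>F. (cmod (coord (X n) x - g x))\<^sup>2) \<le> e\<^sup>2"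
    if "e > 0" for e
  proof -
    obtain N where N: "\<And>m n. m \<ge> N \<Longrightarrow> n \<ge> N \<Longrightarrow> norm (X m - X n) < e"
      using CauchyD[OF X \<open>e > 0\<close>] by blast
    have "(\<Sum>x\<in>F. (cmod (coord (X n) x - g x))\<^sup>2) \<le> e\<^sup>2" if "n \<ge> N" "finite F" for n F
    proof (rule tendsto_upperbound)
      show "(\<lambda>m. \<Sum>x\<in>F. (cmod (coord (X n) x - coord (X m) x))\<^sup>2)
          \<longlonglongrightarrow> (\<Sum>x\<in>F. (cmod (coord (X n) x - g x))\<^sup>2)"
        by (intro tendsto_intros g)
      have "(\<Sum>x\<in>F. (cmod (coord (X n) x - coord (X m) x))\<^sup>2) \<le> e\<^sup>2" if "m \<ge> N" for m
      proof -
        have "(\<Sum>x\<in>F. (cmod (coord (X n) x - coord (X m) x))\<^sup>2) \<le> (norm (X n - X m))\<^sup>2"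
          using square_norm_sum_le[OF \<open>finite F\<close>, of "X n - X m"] by simp
        also have "\<dots> \<le> e\<^sup>2"
          using N[OF \<open>n \<ge> N\<close> that] by (intro power_mono) auto
        finally show ?thesis .
      qed
      then show "\<forall>\<^sub>F m in sequentially. (\<Sum>x\<in>F. (cmod (coord (X n) x - coord (X m) x))\<^sup>2) \<le> e\<^sup>2"
        by (auto simp: eventually_sequentially)
    qed auto
    then show ?thesis
      by blast
  qed
  have diff: "(\<lambda>x. (cmod (coord (X n) x - g x))\<^sup>2) summable_on UNIV \<and>
      (\<Sum>\<^sub>\<infinity>x. (cmod (coord (X n) x - g x))\<^sup>2) \<le> e\<^sup>2"
    if "\<forall>F. finite F \<longrightarrow> (\<Sum>x\<in>F. (cmod (coord (X n) x - g x))\<^sup>2) \<le> e\<^sup>2" for n e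
  proof
    show *: "(\<lambda>x. (cmod (coord (X n) x - g x))\<^sup>2) summable_on UNIV"
      by (rule nonneg_bdd_above_summable_on) (use that in \<open>auto intro!: bdd_aboveI[of _ "e\<^sup>2"]\<close>)
    show "(\<Sum>\<^sub>\<infinity>x. (cmod (coord (X n) x - g x))\<^sup>2) \<le> e\<^sup>2"
      by (rule infsum_le_finite_sums[OF *]) (use that in auto)
  qed
  obtain N where N: "\<forall>n\<ge>N. \<forall>F. finite F \<longrightarrow> (\<Sum>x\<in>F. (cmod (coord (X n) x - g x))\<^sup>2) \<le> 1\<^sup>2"
    using tail[of 1] by auto
  \<comment> \<open>The limit is square-summable as the sum of one member of the sequence and a
    difference already known to be square-summable.\<close>
  have "(\<lambda>x. (cmod (g x - coord (X N) x + coord (X N) x))\<^sup>2) summable_on UNIV"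
    by (rule square_summable_add[OF _ coord_summable])
      (use diff[of N 1] N in \<open>simp add: norm_minus_commute\<close>)
  then have g_in: "coord (Abs_l2 g) = g"
    by (simp add: Abs_l2_inverse)
  have "X \<longlonglongrightarrow> Abs_l2 g"
  proof (rule LIMSEQ_I)
    fix r :: real assume "r > 0"
    then obtain N where N: "\<forall>n\<ge>N. \<forall>F. finite F \<longrightarrow> (\<Sum>x\<in>F. (cmod (coord (X n) x - g x))\<^sup>2) \<le> (r/2)\<^sup>2"
      using tail[of "r/2"] by auto
    have "norm (X n - Abs_l2 g) < r" if "n \<ge> N" for n
    proof -
      have "(norm (X n - Abs_l2 g))\<^sup>2 \<le> (r/2)\<^sup>2"
        using diff[of n "r/2"] N that by (simp add: norm_square_infsum g_in)
      then show ?thesis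
        using \<open>r > 0\<close> by (auto simp: power2_le_iff_abs_le)
    qed
    then show "\<exists>N. \<forall>n\<ge>N. norm (X n - Abs_l2 g) < r"
      by blast
  qed
  then show "convergent X"
    by (auto simp: convergent_def)
qed

instance l2 :: (type) banach ..

subsection \<open>Orthogonal projection and duality\<close>

definition closed_csubspace :: "'a l2 set \<Rightarrow> bool"
  where "closed_csubspace S \<longleftrightarrow> cl2.subspace S \<and> closed S"

definition ortho :: "'a l2 set \<Rightarrow> 'a l2 set"
  where "ortho S = {f. \<forall>g\<in>S. cip f g = 0}"

definition bounded_clinear :: "('a l2 \<Rightarrow> 'b l2) \<Rightarrow> bool"
  where "bounded_clinear T \<longleftrightarrow> bounded_linear T \<and> (\<forall>c f. T (c *\<^sub>C f) = c *\<^sub>C T f)"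

lemma closed_csubspaceD:
  assumes "closed_csubspace S"
  shows "closed S" "0 \<in> S" "f \<in> S \<Longrightarrow> g \<in> S \<Longrightarrow> f + g \<in> S" "f \<in> S \<Longrightarrow> g \<in> S \<Longrightarrow> f - g \<in> S"
    "f \<in> S \<Longrightarrow> c *\<^sub>C f \<in> S"
  using assms
  by (auto simp: closed_csubspace_def intro: cl2.subspace_0 cl2.subspace_add cl2.subspace_diff cl2.subspace_scale)

lemma closed_csubspace_UNIV [simp]: "closed_csubspace UNIV"
  by (auto simp: closed_csubspace_def cl2.subspace_def)

lemma closed_cip_eq: "closed {f. cip f g = 0}"
  by (rule closed_Collect_eq) (intro continuous_intros)+

lemma closed_csubspace_ortho [simp]: "closed_csubspace (ortho S)"
proof -
  have "ortho S = (\<Inter>g\<in>S. {f. cip f g = 0})"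
    by (auto simp: ortho_def)
  then have "closed (ortho S)"
    by (auto intro: closed_cip_eq)
  then show ?thesis
    by (auto simp: closed_csubspace_def ortho_def cl2.subspace_def cip_add_left)
qed

lemma closed_csubspace_Int:
  "closed_csubspace S \<Longrightarrow> closed_csubspace T \<Longrightarrow> closed_csubspace (S \<inter> T)"
  by (auto simp: closed_csubspace_def cl2.subspace_inter)

lemma bounded_clinearD:
  assumes "bounded_clinear T"
  shows "bounded_linear T" "T (f + g) = T f + T g" "T (f - g) = T f - T g" "T (c *\<^sub>C f) = c *\<^sub>C T f" "T 0 = 0"
  using assms
  by (auto simp: bounded_clinear_def bounded_linear.linear linear_add linear_diff linear_0)

lemma closure_csubspace:
  assumes "cl2.subspace S"
  shows "closed_csubspace (closure S)"
  unfolding closed_csubspace_def cl2.subspace_def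
proof (intro conjI allI ballI)
  show "0 \<in> closure S"
    using assms cl2.subspace_0 closure_subset by blast
next
  fix f g assume "f \<in> closure S" "g \<in> closure S"
  then obtain X Y where "\<And>n. X n \<in> S" "X \<longlonglongrightarrow> f" "\<And>n. Y n \<in> S" "Y \<longlonglongrightarrow> g"
    unfolding closure_sequential by blast
  then show "f + g \<in> closure S"
    unfolding closure_sequential
    by (intro exI[of _ "\<lambda>n. X n + Y n"]) (auto intro: tendsto_add cl2.subspace_add[OF assms])
next
  fix c f assume "f \<in> closure S"
  then obtain X where "\<And>n. X n \<in> S" "X \<longlonglongrightarrow> f"
    unfolding closure_sequential by blast
  then show "c *\<^sub>C f \<in> closure S"
    unfolding closure_sequential
    by (intro exI[of _ "\<lambda>n. c *\<^sub>C X n"])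
      (auto intro: bounded_linear.tendsto[OF bounded_linear_scaleC] cl2.subspace_scale[OF assms])
qed auto

lemma parallelogram:
  fixes f g :: "'a::real_inner"
  shows "(norm (f + g))\<^sup>2 + (norm (f - g))\<^sup>2 = 2 * (norm f)\<^sup>2 + 2 * (norm g)\<^sup>2"
  by (simp add: power2_norm_eq_inner inner_add_left inner_add_right inner_diff_left inner_diff_right)

text \<open>A minimising sequence is Cauchy: the midpoint of two terms lies in \<open>S\<close>, so
  the parallelogram law bounds their distance by how far both exceed the infimum.\<close>

lemma closest_point_in_closed_csubspace:
  assumes "closed_csubspace S"
  obtains m where "m \<in> S" "\<And>s. s \<in> S \<Longrightarrow> norm (f - m) \<le> norm (f - s)"
proof -
  note S = closed_csubspaceD[OF assms]
  define D where "D = (\<lambda>s. (norm (f - s))\<^sup>2) ` S"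
  define d where "d = Inf D"
  have bdd: "bdd_below D"
    by (auto simp: D_def intro: bdd_belowI[of _ 0])
  have le: "d \<le> (norm (f - s))\<^sup>2" if "s \<in> S" for s
    unfolding d_def by (rule cInf_lower[OF _ bdd]) (use that in \<open>auto simp: D_def\<close>)
  have "\<exists>s\<in>S. (norm (f - s))\<^sup>2 < d + 1 / (real n + 1)" for n
  proof -
    have "D \<noteq> {}"
      using S(2) by (auto simp: D_def)
    then have "\<exists>x\<in>D. x < d + 1 / (real n + 1)"
      by (intro cInf_lessD) (auto simp: d_def)
    then show ?thesis
      by (auto simp: D_def)
  qed
  then obtain X where X: "\<And>n. X n \<in> S" "\<And>n. (norm (f - X n))\<^sup>2 < d + 1 / (real n + 1)"
    by metis
  have dist: "(norm (X m - X n))\<^sup>2 \<le> 2 / (real m + 1) + 2 / (real n + 1)" for m n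
  proof -
    have "(1/2) *\<^sub>C (X m + X n) \<in> S"
      by (intro S X)
    from le[OF this] have "4 * d \<le> (norm (2 *\<^sub>C (f - (1/2) *\<^sub>C (X m + X n))))\<^sup>2"
      by (simp add: power_mult_distrib del: cl2.scale_left_diff_distrib)
    also have "2 *\<^sub>C (f - (1/2) *\<^sub>C (X m + X n)) = (f - X m) + (f - X n)"
      by (rule l2_eqI) (simp add: field_simps)
    finally have "4 * d \<le> (norm ((f - X m) + (f - X n)))\<^sup>2" .
    moreover have "(f - X m) - (f - X n) = - (X m - X n)"
      by simp
    ultimately show ?thesis
      using parallelogram[of "f - X m" "f - X n"] X(2)[of m] X(2)[of n]
      by (simp add: norm_minus_commute)
  qed
  have "Cauchy X"
  proof (rule CauchyI)
    fix e :: real assume "e > 0"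
    then obtain N :: nat where N: "4 / e\<^sup>2 < real N"
      using reals_Archimedean2 by blast
    have "norm (X m - X n) < e" if "m \<ge> N" "n \<ge> N" for m n
    proof -
      have *: "2 / (real k + 1) < e\<^sup>2 / 2" if "k \<ge> N" for k
      proof -
        have "4 / e\<^sup>2 < real k + 1"
          using N that by linarith
        then show ?thesis
          using \<open>e > 0\<close> by (simp add: field_simps)
      qed
      have "(norm (X m - X n))\<^sup>2 < e\<^sup>2"
        using dist[of m n] *[OF that(1)] *[OF that(2)] by linarith
      then show ?thesis
        using \<open>e > 0\<close> by (simp add: power2_less_imp_less)
    qed
    then show "\<exists>M. \<forall>m\<ge>M. \<forall>n\<ge>M. norm (X m - X n) < e"
      by blast
  qed
  then obtain m where m: "X \<longlonglongrightarrow> m"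
    by (auto simp: Cauchy_convergent_iff convergent_def)
  have "m \<in> S"
    using closed_sequentially[OF S(1)] X(1) m by blast
  moreover have "norm (f - m) \<le> norm (f - s)" if "s \<in> S" for s
  proof -
    have "(\<lambda>n. d + 1 / (real n + 1)) \<longlonglongrightarrow> d + 0"
      by (intro tendsto_intros) real_asymp
    moreover have "(\<lambda>n. (norm (f - X n))\<^sup>2) \<longlonglongrightarrow> (norm (f - m))\<^sup>2"
      by (intro tendsto_intros m)
    ultimately have "(norm (f - m))\<^sup>2 \<le> d + 0"
      using X(2) by (intro LIMSEQ_le) (auto intro: less_imp_le)
    then have "(norm (f - m))\<^sup>2 \<le> (norm (f - s))\<^sup>2"
      using le[OF that] by linarith
    then show ?thesis
      by (rule power2_le_imp_le) auto
  qed
  ultimately show ?thesis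
    using that by blast
qed

lemma cip_diff_scaleC_self:
  "cip (f - c *\<^sub>C g) (f - c *\<^sub>C g) = cip f f - cnj c * cip f g - c * cnj (cip f g) + c * cnj c * cip g g"
  by (simp add: cip_diff_left cip_diff_right cip_commute[of g f] algebra_simps)

lemma projection_exists:
  assumes "closed_csubspace S"
  obtains m where "m \<in> S" "f - m \<in> ortho S"
proof -
  note S = closed_csubspaceD[OF assms]
  obtain m where m: "m \<in> S" "\<And>s. s \<in> S \<Longrightarrow> norm (f - m) \<le> norm (f - s)"
    using closest_point_in_closed_csubspace[OF assms, of f] by blast
  have "cip (f - m) s = 0" if "s \<in> S" for s
  proof (rule ccontr)
    assume nz: "cip (f - m) s \<noteq> 0"
    then have "s \<noteq> 0"
      by auto
    \<comment> \<open>\<open>m + c s\<close> is the best approximation to \<open>f\<close> on the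
      line through \<open>m\<close> in direction \<open>s\<close>. It would lower the squared
      distance by \<open>\<bar>\<langle>f - m, s\<rangle>\<bar>\<^sup>2 /
      \<parallel>s\<parallel>\<^sup>2\<close>, against the minimality of \<open>m\<close>.\<close>
    define c where "c = cip (f - m) s / of_real ((norm s)\<^sup>2)"
    have "norm (f - m) \<le> norm (f - (m + c *\<^sub>C s))"
      by (intro m S that)
    then have "(norm (f - m))\<^sup>2 \<le> (norm ((f - m) - c *\<^sub>C s))\<^sup>2"
      by (simp add: algebra_simps power_mono)
    moreover have "complex_of_real ((norm ((f - m) - c *\<^sub>C s))\<^sup>2)
        = of_real ((norm (f - m))\<^sup>2 - (cmod (cip (f - m) s))\<^sup>2 / (norm s)\<^sup>2)"
    proof -
      have "complex_of_real ((norm ((f - m) - c *\<^sub>C s))\<^sup>2) = cip (f - m) (f - m) - cnj c * cip (f - m) s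
          - c * cnj (cip (f - m) s) + c * cnj c * cip s s"
        unfolding cip_self_norm[symmetric] by (rule cip_diff_scaleC_self)
      also have "\<dots> = cip (f - m) (f - m) - cip (f - m) s * cnj (cip (f - m) s) / of_real ((norm s)\<^sup>2)"
        using \<open>s \<noteq> 0\<close> by (simp add: c_def cip_self_norm field_simps power2_eq_square)
      finally show ?thesis
        using complex_norm_square[of "cip (f - m) s"] by (simp add: cip_self_norm)
    qed
    ultimately have "(cmod (cip (f - m) s))\<^sup>2 / (norm s)\<^sup>2 \<le> 0"
      unfolding of_real_eq_iff by linarith
    then show False
      using nz \<open>s \<noteq> 0\<close> by (simp add: divide_le_0_iff)
  qed
  then have "f - m \<in> ortho S"
    by (simp add: ortho_def)
  then show ?thesis
    using m(1) that by blast
qed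

lemma ortho_sym: "f \<in> ortho S \<Longrightarrow> g \<in> S \<Longrightarrow> cip g f = 0"
  by (subst cip_commute) (simp add: ortho_def)

lemma orthoD: "f \<in> ortho S \<Longrightarrow> g \<in> S \<Longrightarrow> cip f g = 0"
  by (simp add: ortho_def)

lemma orthoI: "(\<And>g. g \<in> S \<Longrightarrow> cip g f = 0) \<Longrightarrow> f \<in> ortho S"
  unfolding ortho_def by (subst cip_commute) simp

lemma ortho_ortho:
  assumes "closed_csubspace S"
  shows "ortho (ortho S) = S"
proof
  show "S \<subseteq> ortho (ortho S)"
    by (auto simp: ortho_def[of "ortho S"] intro: ortho_sym)
  show "ortho (ortho S) \<subseteq> S"
  proof
    fix f assume f: "f \<in> ortho (ortho S)"
    obtain m where m: "m \<in> S" "f - m \<in> ortho S"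
      using projection_exists[OF assms] by blast
    have "cip (f - m) (f - m) = cip f (f - m) - cip m (f - m)"
      by (rule cip_diff_left)
    also have "\<dots> = 0"
      using orthoD[OF f m(2)] ortho_sym[OF m(2) m(1)] by simp
    finally show "f \<in> S"
      using m(1) by simp
  qed
qed

lemma ortho_mono: "S \<subseteq> T \<Longrightarrow> ortho T \<subseteq> ortho S"
  by (auto simp: ortho_def)

lemma span_subset_ortho_ortho: "cl2.span A \<subseteq> ortho (ortho A)"
  by (rule cl2.span_minimal)
    (use closed_csubspace_ortho[of "ortho A"] in \<open>auto simp: closed_csubspace_def intro: ortho_sym
      simp: ortho_def[of "ortho A"]\<close>)

lemma closed_csubspace_closure_span: "closed_csubspace (closure (cl2.span A))"
  by (rule closure_csubspace) (rule cl2.subspace_span)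

text \<open>With this description of the closed span, later density arguments run on orthogonality
  alone, without approximating sequences.\<close>

lemma closure_span_eq: "closure (cl2.span A) = ortho (ortho A)"
proof
  show "closure (cl2.span A) \<subseteq> ortho (ortho A)"
    using closed_csubspace_ortho span_subset_ortho_ortho
    by (intro closure_minimal) (auto simp: closed_csubspace_def)
  have "A \<subseteq> closure (cl2.span A)"
    using cl2.span_superset closure_subset by blast
  then have "ortho (ortho A) \<subseteq> ortho (ortho (closure (cl2.span A)))"
    by (intro ortho_mono)
  then show "ortho (ortho A) \<subseteq> closure (cl2.span A)"
    by (simp add: ortho_ortho closed_csubspace_closure_span)
qed

lemma closed_csubspace_eqI:
  assumes "closed_csubspace S" "closed_csubspace T" "T \<subseteq> S"
    and "\<And>f. f \<in> S \<Longrightarrow> f \<in> ortho T \<Longrightarrow> f = 0"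
  shows "S = T"
proof
  show "S \<subseteq> T"
  proof
    fix f assume "f \<in> S"
    obtain m where m: "m \<in> T" "f - m \<in> ortho T"
      using projection_exists[OF assms(2)] by blast
    then have "f - m \<in> S"
      using \<open>f \<in> S\<close> assms(3) closed_csubspaceD[OF assms(1)] by blast
    then show "f \<in> T"
      using assms(4) m by force
  qed
qed (fact assms)

definition proj :: "'a l2 set \<Rightarrow> 'a l2 \<Rightarrow> 'a l2"
  where "proj S f = (THE m. m \<in> S \<and> f - m \<in> ortho S)"

lemma projection_unique:
  assumes "closed_csubspace S" "m \<in> S" "f - m \<in> ortho S" "m' \<in> S" "f - m' \<in> ortho S"
  shows "m = m'"
proof -
  have 1: "m - m' \<in> S"
    using assms closed_csubspaceD by blast
  have "(f - m') - (f - m) \<in> ortho S"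
    using assms closed_csubspaceD[OF closed_csubspace_ortho] by blast
  then have "m - m' \<in> ortho S"
    by simp
  then show ?thesis
    using orthoD[OF _ 1] by fastforce
qed

lemma proj_props:
  assumes "closed_csubspace S"
  shows "proj S f \<in> S" "f - proj S f \<in> ortho S"
proof -
  have "\<exists>!m. m \<in> S \<and> f - m \<in> ortho S"
    using projection_exists[OF assms, of f] projection_unique[OF assms] by metis
  from theI'[OF this] show "proj S f \<in> S" "f - proj S f \<in> ortho S"
    by (auto simp: proj_def)
qed

lemma proj_eqI:
  assumes "closed_csubspace S" "m \<in> S" "f - m \<in> ortho S"
  shows "proj S f = m"
  using projection_unique[OF assms(1) proj_props[OF assms(1)]] assms by blast

lemma cip_proj_left:
  assumes "closed_csubspace S" "g \<in> S"
  shows "cip (proj S f) g = cip f g"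
  using orthoD[OF proj_props(2)[OF assms(1)] assms(2), of f] by (simp add: cip_diff_left)

lemma cip_proj_right:
  assumes "closed_csubspace S" "g \<in> S"
  shows "cip g (proj S f) = cip g f"
  using cip_proj_left[OF assms] cip_commute by metis

lemma norm_proj_le:
  assumes "closed_csubspace S"
  shows "norm (proj S f) \<le> norm f"
proof (cases "proj S f = 0")
  case False
  have "(norm (proj S f))\<^sup>2 = cmod (cip (proj S f) (proj S f))"
    unfolding cip_self_norm norm_of_real by simp
  also have "\<dots> = cmod (cip f (proj S f))"
    by (simp add: cip_proj_left assms proj_props)
  also have "\<dots> \<le> norm f * norm (proj S f)"
    by (rule norm_cip_le)
  finally show ?thesis
    using False by (simp add: power2_eq_square)
qed simp

lemma bounded_clinear_proj:
  assumes "closed_csubspace S"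
  shows "bounded_clinear (proj S)"
proof -
  note O = closed_csubspaceD[OF closed_csubspace_ortho[of S]]
  have add: "proj S (f + g) = proj S f + proj S g" for f g
  proof (rule proj_eqI[OF assms])
    have "(f - proj S f) + (g - proj S g) \<in> ortho S"
      by (intro O proj_props assms)
    then show "f + g - (proj S f + proj S g) \<in> ortho S"
      by (simp add: algebra_simps)
  qed (intro closed_csubspaceD[OF assms] proj_props assms)
  have scale: "proj S (c *\<^sub>C f) = c *\<^sub>C proj S f" for c f
  proof (rule proj_eqI[OF assms])
    have "c *\<^sub>C (f - proj S f) \<in> ortho S"
      by (intro O proj_props assms)
    then show "c *\<^sub>C f - c *\<^sub>C proj S f \<in> ortho S"
      by (simp add: cl2.scale_right_diff_distrib)
  qed (intro closed_csubspaceD[OF assms] proj_props assms)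
  have "bounded_linear (proj S)"
    by (rule bounded_linear_intro[where K = 1])
      (use norm_proj_le[OF assms] in \<open>auto simp: add scale scaleR_scaleC\<close>)
  then show ?thesis
    by (auto simp: bounded_clinear_def scale)
qed

section \<open>Riesz representation and adjoints\<close>

lemma l2_eq_on_closed_csubspaceI:
  assumes "closed_csubspace S" "f \<in> S" "g \<in> S" "\<And>h. h \<in> S \<Longrightarrow> cip h f = cip h g"
  shows "f = g"
proof -
  have "f - g \<in> S"
    using assms closed_csubspaceD by blast
  from assms(4)[OF this] have "cip (f - g) (f - g) = 0"
    by (simp add: cip_diff_right)
  then show ?thesis
    by simp
qed

text \<open>Stated for a closed subspace because adjoints are formed in \<open>M\<close>, not in the
  whole space. The representing vector is a multiple of a vector of \<open>S\<close> orthogonal to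
  the kernel of \<open>F\<close>.\<close>

theorem riesz_representation:
  assumes S: "closed_csubspace S"
    and add: "\<And>f g. f \<in> S \<Longrightarrow> g \<in> S \<Longrightarrow> F (f + g) = F f + F g"
    and scale: "\<And>c f. f \<in> S \<Longrightarrow> F (c *\<^sub>C f) = c * F f"
    and bound: "\<And>f. f \<in> S \<Longrightarrow> cmod (F f) \<le> C * norm f"
  obtains h where "h \<in> S" "\<And>f. f \<in> S \<Longrightarrow> F f = cip f h"
proof (cases "\<forall>f\<in>S. F f = 0")
  case True
  then show ?thesis
    using that[of 0] closed_csubspaceD[OF S] by auto
next
  case False
  note SD = closed_csubspaceD[OF S]
  have diff: "F (f - g) = F f - F g" if "f \<in> S" "g \<in> S" for f g
    using add[of f "(-1) *\<^sub>C g"] scale[of g "-1"] SD(5)[of g "-1"] that by simp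
  define K where "K = {f \<in> S. F f = 0}"
  have "closed K"
    unfolding closed_sequential_limits
  proof (intro allI impI, elim conjE)
    fix X l assume X: "\<forall>n. X n \<in> K" "X \<longlonglongrightarrow> l"
    have "l \<in> S"
      using closed_sequentially[OF SD(1), of X l] X by (auto simp: K_def)
    have "cmod (F l) \<le> \<bar>C\<bar> * norm (l - X n)" for n
    proof -
      have "X n \<in> S" "F (X n) = 0"
        using X by (auto simp: K_def)
      then have "cmod (F l) \<le> C * norm (l - X n)"
        using bound[of "l - X n"] diff[OF \<open>l \<in> S\<close>, of "X n"] SD(4)[OF \<open>l \<in> S\<close>, of "X n"] by simp
      also have "\<dots> \<le> \<bar>C\<bar> * norm (l - X n)"
        by (intro mult_right_mono) auto
      finally show ?thesis .
    qed
    moreover have "(\<lambda>n. \<bar>C\<bar> * norm (l - X n)) \<longlonglongrightarrow> \<bar>C\<bar> * norm (l - l)"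
      by (intro tendsto_intros X)
    ultimately have "cmod (F l) \<le> \<bar>C\<bar> * norm (l - l)"
      by (intro tendsto_lowerbound[of "\<lambda>n. \<bar>C\<bar> * norm (l - X n)"]) auto
    then show "l \<in> K"
      using \<open>l \<in> S\<close> by (simp add: K_def)
  qed
  then have K: "closed_csubspace K"
    using SD scale[of 0 0] by (auto simp: closed_csubspace_def cl2.subspace_def K_def add scale)
  obtain y where y: "y \<in> S" "F y \<noteq> 0"
    using False by blast
  define z where "z = y - proj K y"
  have pK: "proj K y \<in> S" "F (proj K y) = 0"
    using proj_props(1)[OF K, of y] by (auto simp: K_def)
  have zS: "z \<in> S" and Fz: "F z \<noteq> 0"
    using y pK SD by (auto simp: z_def diff)
  have zK: "z \<in> ortho K"
    using proj_props(2)[OF K] by (simp add: z_def)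
  have nz: "norm z \<noteq> 0"
    using Fz scale[of 0 0] SD(2) by auto
  define h where "h = (cnj (F z) / of_real ((norm z)\<^sup>2)) *\<^sub>C z"
  have "F f = cip f h" if "f \<in> S" for f
  proof -
    have "f - (F f / F z) *\<^sub>C z \<in> K"
      using that zS Fz by (auto simp: K_def diff scale SD)
    then have "cip (f - (F f / F z) *\<^sub>C z) z = 0"
      by (rule ortho_sym[OF zK])
    then have "cip f z = F f / F z * of_real ((norm z)\<^sup>2)"
      by (simp add: cip_diff_left cip_self_norm)
    then show ?thesis
      using Fz nz by (simp add: h_def)
  qed
  moreover have "h \<in> S"
    by (simp add: h_def SD zS)
  ultimately show ?thesis
    using that by blast
qed

text \<open>For bounded \<open>T\<close> this is the ordinary adjoint followed by the projection to
  \<open>S\<close>. So \<open>adj UNIV T\<close> is the ordinary adjoint, and for invariant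
  \<open>S\<close> one gets the adjoint of the restriction.\<close>

definition adj :: "'a l2 set \<Rightarrow> ('a l2 \<Rightarrow> 'a l2) \<Rightarrow> 'a l2 \<Rightarrow> 'a l2"
  where "adj S T g = (THE h. h \<in> S \<and> (\<forall>f\<in>S. cip (T f) g = cip f h))"

lemma adj_props:
  assumes S: "closed_csubspace S" and T: "bounded_clinear T"
  shows "adj S T g \<in> S" "f \<in> S \<Longrightarrow> cip f (adj S T g) = cip (T f) g"
proof -
  obtain C where C: "\<And>f. norm (T f) \<le> norm f * C"
    using bounded_linear.bounded[OF bounded_clinearD(1)[OF T]] by blast
  have "cmod (cip (T f) g) \<le> (C * norm g) * norm f" for f
  proof -
    have "cmod (cip (T f) g) \<le> norm (T f) * norm g"
      by (rule norm_cip_le)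
    also have "\<dots> \<le> (norm f * C) * norm g"
      by (intro mult_right_mono C) auto
    finally show ?thesis
      by (simp add: algebra_simps)
  qed
  then obtain h where h: "h \<in> S" "\<And>f. f \<in> S \<Longrightarrow> cip (T f) g = cip f h"
    using riesz_representation[OF S, of "\<lambda>f. cip (T f) g" "C * norm g"]
    by (auto simp: bounded_clinearD[OF T] cip_add_left)
  have "\<exists>!h. h \<in> S \<and> (\<forall>f\<in>S. cip (T f) g = cip f h)"
    using h l2_eq_on_closed_csubspaceI[OF S] by (intro ex1I[of _ h]) auto
  from theI'[OF this] show "adj S T g \<in> S" "f \<in> S \<Longrightarrow> cip f (adj S T g) = cip (T f) g"
    by (auto simp: adj_def)
qed

lemma adj_eqI:
  assumes "closed_csubspace S" "bounded_clinear T" "h \<in> S" "\<And>f. f \<in> S \<Longrightarrow> cip (T f) g = cip f h"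
  shows "adj S T g = h"
  by (rule l2_eq_on_closed_csubspaceI[OF assms(1)])
    (use assms adj_props[OF assms(1,2)] in auto)

section \<open>Inner sequences and Beurling's theorem\<close>

subsection \<open>Isometries induced by injections of the index set\<close>

text \<open>Extension by zero along an injection; \<open>push Suc\<close> is the unilateral shift
  and \<open>push (raise j)\<close> multiplication by the \<open>j\<close>-th variable. The value 0
  for maps that are not injective keeps \<open>push\<close> and \<open>pull\<close> total, and
  \<open>pull\<close> is the adjoint.\<close>

lift_definition push :: "('a \<Rightarrow> 'b) \<Rightarrow> 'a l2 \<Rightarrow> 'b l2"
  is "\<lambda>h f x. if inj h \<and> x \<in> range h then f (inv h x) else 0"
proof -
  fix h :: "'a \<Rightarrow> 'b" and f :: "'a \<Rightarrow> complex"
  assume f: "(\<lambda>x. (cmod (f x))\<^sup>2) summable_on UNIV"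
  show "(\<lambda>x. (cmod (if inj h \<and> x \<in> range h then f (inv h x) else 0))\<^sup>2) summable_on UNIV"
  proof (cases "inj h")
    case True
    have "(\<lambda>x. (cmod (f (inv h x)))\<^sup>2) summable_on range h"
      using f True by (subst summable_on_reindex) (auto simp: o_def)
    then show ?thesis
      by (rule summable_on_cong_neutral[THEN iffD1, rotated -1]) (use True in auto)
  qed auto
qed

lift_definition pull :: "('a \<Rightarrow> 'b) \<Rightarrow> 'b l2 \<Rightarrow> 'a l2"
  is "\<lambda>h f x. if inj h then f (h x) else 0"
proof -
  fix h :: "'a \<Rightarrow> 'b" and f :: "'b \<Rightarrow> complex"
  assume f: "(\<lambda>x. (cmod (f x))\<^sup>2) summable_on UNIV"
  show "(\<lambda>x. (cmod (if inj h then f (h x) else 0))\<^sup>2) summable_on UNIV"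
  proof (cases "inj h")
    case True
    have "(\<lambda>x. (cmod (f x))\<^sup>2) summable_on range h"
      by (rule summable_on_subset_banach[OF f]) auto
    then have "((\<lambda>x. (cmod (f x))\<^sup>2) \<circ> h) summable_on UNIV"
      by (subst summable_on_reindex[symmetric]) (use True in auto)
    then show ?thesis
      using True by (simp add: o_def)
  qed auto
qed

lemma coord_push: "inj h \<Longrightarrow> coord (push h f) x = (if x \<in> range h then coord f (inv h x) else 0)"
  by transfer auto

lemma coord_pull: "inj h \<Longrightarrow> coord (pull h f) x = coord f (h x)"
  by transfer auto

lemma cip_push:
  assumes "inj h"
  shows "cip (push h f) g = cip f (pull h g)"
proof -
  have "cip (push h f) g = (\<Sum>\<^sub>\<infinity>x\<in>range h. coord f (inv h x) * cnj (coord g x))"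
    unfolding cip.rep_eq by (rule infsum_cong_neutral) (use assms in \<open>auto simp: coord_push\<close>)
  also have "\<dots> = cip f (pull h g)"
    unfolding cip.rep_eq using assms by (subst infsum_reindex) (auto simp: coord_pull o_def)
  finally show ?thesis .
qed

lemma pull_push [simp]: "inj h \<Longrightarrow> pull h (push h f) = f"
  by (rule l2_eqI) (simp add: coord_pull coord_push)

lemma cip_push_push [simp]: "inj h \<Longrightarrow> cip (push h f) (push h g) = cip f g"
  by (simp add: cip_push)

lemma norm_push [simp]: "inj h \<Longrightarrow> norm (push h f) = norm f"
  by (simp add: norm_l2_def inner_l2_def)

lemma push_add: "inj h \<Longrightarrow> push h (f + g) = push h f + push h g"
  by (rule l2_eqI) (simp add: coord_push)

lemma push_scaleC: "inj h \<Longrightarrow> push h (c *\<^sub>C f) = c *\<^sub>C push h f"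
  by (rule l2_eqI) (simp add: coord_push)

lemma bounded_clinear_push: "inj h \<Longrightarrow> bounded_clinear (push h)"
  unfolding bounded_clinear_def
  by (intro conjI allI bounded_linear_intro[where K = 1])
    (auto simp: push_add push_scaleC scaleR_scaleC)

lift_definition l2_unit :: "'a \<Rightarrow> 'a l2" is "\<lambda>a x. if x = a then 1 else 0"
proof -
  fix a :: 'a
  have "(\<lambda>x. (cmod (if x = a then 1 else 0))\<^sup>2) summable_on {a}"
    by simp
  then show "(\<lambda>x. (cmod (if x = a then 1 else 0))\<^sup>2) summable_on UNIV"
    by (rule summable_on_cong_neutral[THEN iffD1, rotated -1]) auto
qed

lemma coord_l2_unit: "coord (l2_unit a) x = (if x = a then 1 else 0)"
  by transfer simp

lemma cip_l2_unit [simp]: "cip f (l2_unit a) = coord f a"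
proof -
  have "cip f (l2_unit a) = (\<Sum>\<^sub>\<infinity>x\<in>{a}. coord f x * cnj (coord (l2_unit a) x))"
    unfolding cip.rep_eq by (rule infsum_cong_neutral) (auto simp: coord_l2_unit)
  then show ?thesis
    by (simp add: coord_l2_unit)
qed

subsection \<open>Orthonormal series\<close>

definition orthonormal :: "(nat \<Rightarrow> 'a l2) \<Rightarrow> bool"
  where "orthonormal e \<longleftrightarrow> (\<forall>i j. cip (e i) (e j) = (if i = j then 1 else 0))"

definition onsum :: "(nat \<Rightarrow> 'a l2) \<Rightarrow> nat l2 \<Rightarrow> 'a l2"
  where "onsum e f = (\<Sum>k. coord f k *\<^sub>C e k)"

lemma cip_orthonormal_sum:
  assumes "orthonormal e" "finite F"
  shows "cip (\<Sum>k\<in>F. c k *\<^sub>C e k) (\<Sum>k\<in>F. d k *\<^sub>C e k) = (\<Sum>k\<in>F. c k * cnj (d k))"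
proof -
  have "cip (e i) (\<Sum>k\<in>F. d k *\<^sub>C e k) = cnj (d i)" if "i \<in> F" for i
  proof -
    have "cip (e i) (\<Sum>k\<in>F. d k *\<^sub>C e k) = (\<Sum>k\<in>F. if i = k then cnj (d k) else 0)"
      unfolding cip_sum_right using assms(1) by (intro sum.cong) (auto simp: orthonormal_def)
    then show ?thesis
      using assms(2) that by simp
  qed
  then show ?thesis
    by (simp add: cip_sum_left)
qed

lemma norm_orthonormal_sum:
  assumes "orthonormal e" "finite F"
  shows "(norm (\<Sum>k\<in>F. c k *\<^sub>C e k))\<^sup>2 = (\<Sum>k\<in>F. (cmod (c k))\<^sup>2)"
proof -
  have "complex_of_real ((norm (\<Sum>k\<in>F. c k *\<^sub>C e k))\<^sup>2) = of_real (\<Sum>k\<in>F. (cmod (c k))\<^sup>2)"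
    by (subst cip_self_norm[symmetric]) (simp add: cip_orthonormal_sum assms complex_norm_square del: of_real_power)
  then show ?thesis
    using of_real_eq_iff by blast
qed

lemma coord_square_sums: "(\<lambda>k. (cmod (coord f k))\<^sup>2) sums (norm (f :: nat l2))\<^sup>2"
  unfolding norm_square_infsum
  by (intro has_sum_imp_sums has_sum_infsum coord_summable)

lemma cip_sums: "(\<lambda>k. coord f k * cnj (coord g k)) sums cip f (g :: nat l2)"
  unfolding cip.rep_eq
  by (intro has_sum_imp_sums has_sum_infsum square_summable_product coord_summable)

lemma summable_onsum:
  assumes "orthonormal e"
  shows "summable (\<lambda>k. coord f k *\<^sub>C e k)"
  unfolding summable_Cauchy
proof (intro allI impI)
  fix r :: real assume "r > 0"
  have "summable (\<lambda>k. (cmod (coord f k))\<^sup>2)"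
    using coord_square_sums sums_summable by blast
  then obtain N where N: "\<forall>m\<ge>N. \<forall>n. norm (\<Sum>k=m..<n. (cmod (coord f k))\<^sup>2) < r\<^sup>2"
    unfolding summable_Cauchy using \<open>r > 0\<close> by (metis zero_less_power)
  have "norm (\<Sum>k=m..<n. coord f k *\<^sub>C e k) < r" if "m \<ge> N" for m n
  proof -
    have "(norm (\<Sum>k=m..<n. coord f k *\<^sub>C e k))\<^sup>2 < r\<^sup>2"
      unfolding norm_orthonormal_sum[OF assms finite_atLeastLessThan]
      using N that by (force intro: le_less_trans[OF abs_ge_self])
    then show ?thesis
      using \<open>r > 0\<close> by (simp add: power2_less_imp_less)
  qed
  then show "\<exists>N. \<forall>m\<ge>N. \<forall>n. norm (\<Sum>k=m..<n. coord f k *\<^sub>C e k) < r"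
    by blast
qed

lemma cip_onsum_basis:
  assumes "orthonormal e"
  shows "cip (onsum e f) (e j) = coord f j"
proof -
  have "cip (onsum e f) (e j) = (\<Sum>k. cip (coord f k *\<^sub>C e k) (e j))"
    unfolding onsum_def by (rule bounded_linear.suminf[OF bounded_linear_cip_left summable_onsum[OF assms]])
  also have "\<dots> = (\<Sum>k. if k = j then coord f k else 0)"
    using assms by (intro suminf_cong) (auto simp: orthonormal_def)
  also have "\<dots> = coord f j"
    by (rule sums_unique[symmetric], rule sums_single)
  finally show ?thesis .
qed

lemma cip_onsum:
  assumes "orthonormal e"
  shows "cip (onsum e f) (onsum e g) = cip f g"
proof -
  have "cip (onsum e f) (onsum e g) = (\<Sum>k. cip (coord f k *\<^sub>C e k) (onsum e g))"
    unfolding onsum_def[of e f]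
    by (rule bounded_linear.suminf[OF bounded_linear_cip_left summable_onsum[OF assms]])
  also have "\<dots> = (\<Sum>k. coord f k * cnj (coord g k))"
    by (intro suminf_cong) (simp add: cip_commute[of "e _" "onsum e g"] cip_onsum_basis[OF assms])
  also have "\<dots> = cip f g"
    using cip_sums sums_unique by metis
  finally show ?thesis .
qed

lemma onsum_add: "orthonormal e \<Longrightarrow> onsum e (f + g) = onsum e f + onsum e g"
  unfolding onsum_def by (subst suminf_add) (auto intro: summable_onsum simp: cl2.scale_left_distrib)

lemma onsum_scaleC: "orthonormal e \<Longrightarrow> onsum e (c *\<^sub>C f) = c *\<^sub>C onsum e f"
  unfolding onsum_def
  by (subst bounded_linear.suminf[OF bounded_linear_scaleC]) (auto intro: summable_onsum)

lemma norm_onsum: "orthonormal e \<Longrightarrow> norm (onsum e f) = norm f"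
  by (simp add: norm_l2_def inner_l2_def cip_onsum)

lemma bounded_clinear_onsum: "orthonormal e \<Longrightarrow> bounded_clinear (onsum e)"
  unfolding bounded_clinear_def
  by (intro conjI allI bounded_linear_intro[where K = 1])
    (auto simp: onsum_add onsum_scaleC norm_onsum scaleR_scaleC)

subsection \<open>The unilateral shift and multiplication by an inner sequence\<close>

abbreviation fshift :: "nat l2 \<Rightarrow> nat l2" where "fshift \<equiv> push Suc"
abbreviation bshift :: "nat l2 \<Rightarrow> nat l2" where "bshift \<equiv> pull Suc"

lemma coord_fshift: "coord (fshift f) n = (if n = 0 then 0 else coord f (n - 1))"
  by (cases n) (auto simp: coord_push)

lemma coord_fshift_pow: "coord ((fshift ^^ k) f) n = (if n < k then 0 else coord f (n - k))"
  by (induction k arbitrary: n) (auto simp: coord_fshift)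

lemma cip_fshift: "cip (fshift f) g = cip f (bshift g)"
  by (simp add: cip_push)

lemma cip_fshift_pow_pow: "cip ((fshift ^^ k) f) ((fshift ^^ k) g) = cip f g"
  by (induction k) auto

lemma cip_fshift_pow: "cip ((fshift ^^ k) f) g = cip f ((bshift ^^ k) g)"
  by (induction k arbitrary: g) (auto simp: cip_fshift funpow_swap1[of bshift])

lemma norm_fshift_pow: "norm ((fshift ^^ k) f) = norm f"
  by (simp add: norm_l2_def inner_l2_def cip_fshift_pow_pow)

lemma fshift_decomp: "f = coord f 0 *\<^sub>C l2_unit 0 + fshift (bshift f)"
  by (rule l2_eqI) (auto simp: coord_fshift coord_l2_unit coord_pull)

text \<open>In terms of Fourier coefficients: \<open>\<bar>\<phi>\<bar>\<^sup>2 = 1\<close> on the circle.\<close>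

definition inner_seq :: "nat l2 \<Rightarrow> bool"
  where "inner_seq x \<longleftrightarrow> (\<forall>k. cip ((fshift ^^ k) x) x = (if k = 0 then 1 else 0))"

text \<open>For an inner sequence the translates are orthonormal, so the series converges and
  \<open>Mul x\<close> is isometric; \<open>coord_Mul\<close> identifies it as the Cauchy product,
  that is, multiplication of functions.\<close>

definition Mul :: "nat l2 \<Rightarrow> nat l2 \<Rightarrow> nat l2"
  where "Mul x = onsum (\<lambda>k. (fshift ^^ k) x)"

lemma orthonormal_inner_seq:
  assumes "inner_seq x"
  shows "orthonormal (\<lambda>k. (fshift ^^ k) x)"
proof -
  have *: "cip ((fshift ^^ (j + d)) x) ((fshift ^^ j) x) = (if d = 0 then 1 else 0)" for j d
    using assms by (simp add: funpow_add cip_fshift_pow_pow inner_seq_def)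
  have "cip ((fshift ^^ i) x) ((fshift ^^ j) x) = (if i = j then 1 else 0)" for i j
  proof (cases "j \<le> i")
    case True
    then show ?thesis
      using *[of j "i - j"] by simp
  next
    case False
    then show ?thesis
      using *[of i "j - i"] by (subst cip_commute) auto
  qed
  then show ?thesis
    by (simp add: orthonormal_def)
qed

context
  fixes x assumes x: "inner_seq x"
begin

lemmas onsum_x = orthonormal_inner_seq[OF x]

lemma cip_Mul: "cip (Mul x f) (Mul x g) = cip f g"
  by (simp add: Mul_def cip_onsum onsum_x)

lemma bounded_clinear_Mul: "bounded_clinear (Mul x)"
  by (simp add: Mul_def bounded_clinear_onsum onsum_x)

lemma norm_Mul: "norm (Mul x f) = norm f"
  by (simp add: Mul_def norm_onsum onsum_x)

lemma coord_Mul: "coord (Mul x f) n = (\<Sum>k\<le>n. coord x k * coord f (n - k))"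
proof -
  have "coord (Mul x f) n = (\<Sum>k. coord (coord f k *\<^sub>C (fshift ^^ k) x) n)"
    unfolding Mul_def onsum_def
    by (rule bounded_linear.suminf[OF bounded_linear_coord summable_onsum[OF onsum_x]])
  also have "\<dots> = (\<Sum>k\<le>n. coord (coord f k *\<^sub>C (fshift ^^ k) x) n)"
    by (rule suminf_finite) (auto simp: coord_fshift_pow)
  also have "\<dots> = (\<Sum>k\<le>n. coord f k * coord x (n - k))"
    by (intro sum.cong) (auto simp: coord_fshift_pow)
  also have "\<dots> = (\<Sum>k\<le>n. coord x k * coord f (n - k))"
    by (rule sum.reindex_bij_witness[of _ "\<lambda>k. n - k" "\<lambda>k. n - k"]) auto
  finally show ?thesis .
qed

lemma Mul_unit: "Mul x (l2_unit k) = (fshift ^^ k) x"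
proof -
  have "Mul x (l2_unit k) = (\<Sum>j. if j = k then (fshift ^^ j) x else 0)"
    unfolding Mul_def onsum_def by (intro suminf_cong) (auto simp: coord_l2_unit)
  then show ?thesis
    using sums_single[of k "\<lambda>j. (fshift ^^ j) x"] by (simp add: sums_iff)
qed

lemma fshift_Mul: "fshift (Mul x f) = Mul x (fshift f)"
proof (rule l2_eqI)
  fix n
  show "coord (fshift (Mul x f)) n = coord (Mul x (fshift f)) n"
  proof (cases n)
    case (Suc m)
    have "(\<Sum>k\<le>m. coord x k * coord (fshift f) (Suc m - k)) = (\<Sum>k\<le>m. coord x k * coord f (m - k))"
      by (intro sum.cong) (auto simp: coord_fshift)
    then show ?thesis
      using Suc by (simp add: coord_fshift coord_Mul)
  qed (simp add: coord_fshift coord_Mul)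
qed

lemma fshift_pow_Mul: "(fshift ^^ k) (Mul x f) = Mul x ((fshift ^^ k) f)"
  by (induction k) (auto simp: fshift_Mul)

text \<open>The projection \<open>p\<close> of \<open>l2_unit N\<close> to the span of the first \<open>N + 1\<close> translates of \<open>x\<close> satisfies
  \<open>\<parallel>p\<parallel>\<^sup>2 = \<Sum>\<^sub>i\<^sub>\<le>\<^sub>N \<bar>x\<^sub>i\<bar>\<^sup>2 \<rightarrow> 1\<close>, so \<open>l2_unit N - p\<close> is small.\<close>

lemma inner_seq_eq_0_if_uncorrelated:
  assumes fx: "\<And>k. cip f ((fshift ^^ k) x) = 0" "\<And>k. cip ((fshift ^^ k) f) x = 0"
  shows "f = 0"
proof (rule l2_eqI)
  fix m
  \<comment> \<open>The shift is isometric, so only the difference of the two exponents matters. On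
    the circle this says that every Fourier coefficient of \<open>f\<close> times the conjugate of
    \<open>x\<close> vanishes, while \<open>x\<close> has modulus 1.\<close>
  have uncor: "cip ((fshift ^^ k) f) ((fshift ^^ j) x) = 0" for k j
  proof (cases "j \<le> k")
    case True
    then have "(fshift ^^ k) f = (fshift ^^ j) ((fshift ^^ (k - j)) f)"
      by (metis comp_apply funpow_add le_add_diff_inverse)
    then show ?thesis
      by (simp add: cip_fshift_pow_pow fx)
  next
    case False
    then have "(fshift ^^ j) x = (fshift ^^ k) ((fshift ^^ (j - k)) x)"
      by (metis comp_apply funpow_add le_add_diff_inverse nat_le_linear)
    then show ?thesis
      by (simp add: cip_fshift_pow_pow fx)
  qed
  define s where "s N = (\<Sum>i\<le>N. (cmod (coord x i))\<^sup>2)" for N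
  have "norm x = 1"
    using x by (auto simp: inner_seq_def norm_l2_def inner_l2_def)
      (metis One_nat_def funpow_0 one_complex.sel(1) real_sqrt_one)
  then have "s \<longlonglongrightarrow> 1"
    using coord_square_sums[of x] by (simp add: sums_def_le s_def[abs_def])
  have bound: "(cmod (coord f m))\<^sup>2 \<le> (norm f)\<^sup>2 * (1 - s (m + k))" for k
  proof -
    define N where "N = m + k"
    define c where "c j = cnj (coord x (N - j))" for j
    define p where "p = (\<Sum>j\<le>N. c j *\<^sub>C (fshift ^^ j) x)"
    have sum_c: "(\<Sum>j\<le>N. c j * cnj (c j)) = of_real (s N)"
    proof -
      have "(\<Sum>j\<le>N. c j * cnj (c j)) = (\<Sum>j\<le>N. of_real ((cmod (coord x (N - j)))\<^sup>2))"
        unfolding complex_norm_square by (intro sum.cong) (auto simp: c_def)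
      also have "\<dots> = (\<Sum>i\<le>N. of_real ((cmod (coord x i))\<^sup>2))"
        by (rule sum.reindex_bij_witness[of _ "\<lambda>k. N - k" "\<lambda>k. N - k"]) auto
      finally show ?thesis
        by (simp add: s_def)
    qed
    have 1: "cip p p = of_real (s N)"
      unfolding p_def by (subst cip_orthonormal_sum[OF onsum_x]) (auto simp: sum_c)
    have 2: "cip p (l2_unit N) = of_real (s N)"
    proof -
      have "cip p (l2_unit N) = (\<Sum>j\<le>N. c j * cnj (c j))"
        unfolding p_def cip_sum_left by (intro sum.cong) (auto simp: coord_fshift_pow c_def)
      then show ?thesis
        by (simp add: sum_c)
    qed
    have "complex_of_real ((norm (l2_unit N - p))\<^sup>2) = of_real (1 - s N)"
      unfolding cip_self_norm[symmetric]
      by (simp add: cip_diff_left cip_diff_right 1 2[unfolded cip_l2_unit] cip_commute[of "l2_unit N" p] coord_l2_unit)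
    then have r: "(norm (l2_unit N - p))\<^sup>2 = 1 - s N"
      using of_real_eq_iff by blast
    \<comment> \<open>The \<open>m\<close>-th coefficient of \<open>f\<close> is the
      \<open>N\<close>-th coefficient of its \<open>k\<close>-th translate, and that translate is
      orthogonal to \<open>p\<close>; only the small remainder \<open>l2_unit N - p\<close>
      contributes.\<close>
    have "coord f m = cip ((fshift ^^ k) f) (l2_unit N - p)"
    proof -
      have "cip ((fshift ^^ k) f) p = 0"
        by (simp add: p_def cip_sum_right uncor)
      then show ?thesis
        by (simp add: cip_diff_right coord_fshift_pow N_def)
    qed
    then have "cmod (coord f m) \<le> norm f * norm (l2_unit N - p)"
      using norm_cip_le[of "(fshift ^^ k) f" "l2_unit N - p"] by (simp add: norm_fshift_pow)
    then have "(cmod (coord f m))\<^sup>2 \<le> (norm f * norm (l2_unit N - p))\<^sup>2"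
      by (rule power_mono) auto
    then show ?thesis
      by (simp add: power_mult_distrib r flip: N_def)
  qed
  have "(\<lambda>k. s (k + m)) \<longlonglongrightarrow> 1"
    using \<open>s \<longlonglongrightarrow> 1\<close> by (rule LIMSEQ_ignore_initial_segment)
  then have "(\<lambda>k. (norm f)\<^sup>2 * (1 - s (m + k))) \<longlonglongrightarrow> (norm f)\<^sup>2 * (1 - 1)"
    by (intro tendsto_intros) (simp add: add.commute)
  then have "(cmod (coord f m))\<^sup>2 \<le> (norm f)\<^sup>2 * (1 - 1)"
    by (rule LIMSEQ_le_const) (use bound in auto)
  then show "coord f m = coord 0 m"
    by simp
qed

end

lemma Mul_assoc:
  assumes "inner_seq x" "inner_seq y"
  shows "Mul x (Mul y f) = Mul (Mul x y) f"
proof -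
  have "Mul x (Mul y f) = (\<Sum>k. Mul x (coord f k *\<^sub>C (fshift ^^ k) y))"
    unfolding Mul_def[of y] onsum_def
    by (rule bounded_linear.suminf[OF bounded_clinearD(1)[OF bounded_clinear_Mul[OF assms(1)]]
          summable_onsum[OF orthonormal_inner_seq[OF assms(2)]]])
  also have "\<dots> = Mul (Mul x y) f"
    unfolding Mul_def[of "Mul x y"] onsum_def
    by (simp add: bounded_clinearD[OF bounded_clinear_Mul[OF assms(1)]] fshift_pow_Mul[OF assms(1)])
  finally show ?thesis .
qed

lemma inner_seq_Mul_iff:
  assumes "inner_seq x"
  shows "inner_seq (Mul x y) \<longleftrightarrow> inner_seq y"
  using assms by (simp add: inner_seq_def fshift_pow_Mul cip_Mul)

subsection \<open>Model spaces and Beurling's theorem\<close>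

definition model :: "nat l2 \<Rightarrow> nat l2 set"
  where "model x = ortho (range (Mul x))"

text \<open>For \<open>f\<close> in \<open>model x\<close>, \<open>fshift f\<close> is already
  orthogonal to all shifts of \<open>x H\<^sup>2\<close>, so compressing it to
  \<open>model x\<close> only removes its component along \<open>x\<close>
  (\<open>cshift_eq_proj\<close>).\<close>

definition cshift :: "nat l2 \<Rightarrow> nat l2 \<Rightarrow> nat l2"
  where "cshift x f = fshift f - cip (fshift f) x *\<^sub>C x"

lemma closed_csubspace_model [simp]: "closed_csubspace (model x)"
  by (simp add: model_def)

lemma model_iff: "f \<in> model x \<longleftrightarrow> (\<forall>g. cip f (Mul x g) = 0)"
  by (auto simp: model_def ortho_def)

context
  fixes x assumes x: "inner_seq x"
begin

lemma Mul_unit_0: "Mul x (l2_unit 0) = x"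
  by (simp add: Mul_unit x)

lemma cip_inner_seq_self: "cip x x = 1"
  using x by (metis funpow_0 inner_seq_def)

lemma cip_model_inner_seq: "f \<in> model x \<Longrightarrow> cip f x = 0"
  by (metis Mul_unit_0 model_iff)

lemma inner_seq_in_ortho_model: "x \<in> ortho (model x)"
  by (auto simp: ortho_def cip_commute[of x] cip_model_inner_seq)

lemma bshift_model: "f \<in> model x \<Longrightarrow> bshift f \<in> model x"
  unfolding model_iff by (metis fshift_Mul[OF x] cip_fshift cip_commute)

lemma bshift_inner_seq_in_model: "bshift x \<in> model x"
proof -
  have "cip (bshift x) (Mul x g) = 0" for g
  proof -
    have "cip (Mul x g) (bshift x) = cip (Mul x (fshift g)) (Mul x (l2_unit 0))"
      by (simp add: cip_fshift[symmetric] fshift_Mul[OF x] Mul_unit_0)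
    also have "\<dots> = 0"
      unfolding cip_Mul[OF x] by (simp add: coord_fshift)
    finally show ?thesis
      by (subst cip_commute) simp
  qed
  then show ?thesis
    by (simp add: model_iff)
qed

lemma cshift_model:
  assumes "f \<in> model x"
  shows "cshift x f \<in> model x"
proof -
  have "cip (cshift x f) (Mul x g) = 0" for g
  proof -
    have g: "Mul x g = coord g 0 *\<^sub>C x + fshift (Mul x (bshift g))"
      by (subst fshift_decomp[of g]) (simp add: bounded_clinearD[OF bounded_clinear_Mul[OF x]] Mul_unit_0 fshift_Mul[OF x])
    have 1: "cip (fshift f) (Mul x g) = cnj (coord g 0) * cip (fshift f) x"
      using assms by (subst g) (simp add: cip_add_right model_iff)
    have 2: "cip x (Mul x g) = cnj (coord g 0)"
      using cip_Mul[OF x, of "l2_unit 0" g] by (simp add: Mul_unit_0 cip_commute[of "l2_unit 0"])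
    show ?thesis
      by (simp add: cshift_def cip_diff_left 1 2)
  qed
  then show ?thesis
    by (simp add: model_iff)
qed

lemma cshift_eq_proj:
  assumes "f \<in> model x"
  shows "proj (model x) (fshift f) = cshift x f"
proof (rule proj_eqI)
  have "cip (fshift f) x *\<^sub>C x \<in> ortho (model x)"
    by (intro closed_csubspaceD[OF closed_csubspace_ortho] inner_seq_in_ortho_model)
  then show "fshift f - cshift x f \<in> ortho (model x)"
    by (simp add: cshift_def)
qed (auto simp: cshift_model assms)

text \<open>The defect of the compressed shift has rank one, spanned by \<open>bshift x\<close>. In
  this form version no adjoint occurs, so it can be used inside invariant subspaces.\<close>

lemma cip_cshift_cshift:
  "cip (cshift x f) (cshift x g) = cip f g - cip f (bshift x) * cnj (cip g (bshift x))"
proof -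
  have "cip x (fshift g) = cnj (cip g (bshift x))"
    by (subst cip_commute) (simp add: cip_fshift)
  then show ?thesis
    by (simp add: cip_fshift cshift_def cip_diff_left cip_diff_right cip_inner_seq_self algebra_simps)
qed

text \<open>The correction term along \<open>x\<close> is orthogonal to \<open>model x\<close>, so
  the adjoint of the compressed shift is the backward shift.\<close>

lemma cip_cshift: "h \<in> model x \<Longrightarrow> cip (cshift x f) h = cip f (bshift h)"
  using orthoD[OF inner_seq_in_ortho_model, of h] by (simp add: cshift_def cip_diff_left cip_fshift)

lemma bounded_clinear_cshift: "bounded_clinear (cshift x)"
proof -
  have "norm (cshift x f) \<le> norm f * (1 + norm x * norm x)" for f
  proof -
    have "norm (cshift x f) \<le> norm (fshift f) + cmod (cip (fshift f) x) * norm x"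
      unfolding cshift_def by (rule order_trans[OF norm_triangle_ineq4]) simp
    also have "\<dots> \<le> norm f + (norm (fshift f) * norm x) * norm x"
      by (intro add_mono mult_right_mono norm_cip_le) auto
    finally show ?thesis
      by (simp add: algebra_simps)
  qed
  then show ?thesis
    unfolding bounded_clinear_def
    by (intro conjI allI bounded_linear_intro)
      (auto simp: cshift_def push_add push_scaleC cip_add_left scaleR_scaleC cl2.scale_left_distrib
        cl2.scale_right_diff_distrib)
qed

text \<open>\<open>bshift x\<close> is cyclic for the backward shift on \<open>model x\<close>:
  membership of \<open>f\<close> in \<open>model x\<close> gives orthogonality to the translates of
  \<open>x\<close>, and the second hypothesis gives that of the translates of \<open>f\<close> to
  \<open>x\<close>.\<close>

lemma model_dense:
  assumes "f \<in> model x" "\<And>k. cip f ((bshift ^^ k) (bshift x)) = 0"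
  shows "f = 0"
proof (rule inner_seq_eq_0_if_uncorrelated[OF x])
  show "cip f ((fshift ^^ k) x) = 0" for k
    using assms(1) Mul_unit[OF x] by (metis model_iff)
  show "cip ((fshift ^^ k) f) x = 0" for k
  proof (cases k)
    case (Suc n)
    have "cip ((fshift ^^ Suc n) f) x = cip f ((bshift ^^ Suc n) x)"
      by (rule cip_fshift_pow)
    then show ?thesis
      using assms(2)[of n] by (simp add: Suc funpow_Suc_right del: funpow.simps)
  qed (simp add: cip_model_inner_seq assms)
qed

end

text \<open>The wandering vector is explicit. With \<open>m\<close> the lowest order occurring in
  \<open>W\<close>, the vector \<open>p\<close> of \<open>W\<close> represents the functional
  reading off the \<open>m\<close>-th coefficient. Shifts of elements of \<open>W\<close> have
  higher order, hence are orthogonal to \<open>p\<close>, and so the normalised \<open>p\<close> is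
  an inner sequence.\<close>

lemma beurling:
  assumes W: "closed_csubspace W" and inv: "\<And>f. f \<in> W \<Longrightarrow> fshift f \<in> W" and ne: "w \<in> W" "w \<noteq> 0"
  obtains \<eta> where "inner_seq \<eta>" "W = range (Mul \<eta>)"
proof -
  note WD = closed_csubspaceD[OF W]
  define m where "m = (LEAST m. \<exists>f\<in>W. coord f m \<noteq> 0)"
  have "\<exists>m. coord w m \<noteq> 0"
    using ne(2) l2_eqI[of w 0] by auto
  then have "\<exists>m. \<exists>f\<in>W. coord f m \<noteq> 0"
    using ne(1) by blast
  from LeastI_ex[OF this] obtain f0 where f0: "f0 \<in> W" "coord f0 m \<noteq> 0"
    by (auto simp: m_def)
  have below: "coord f i = 0" if "f \<in> W" "i < m" for f i
    using that not_less_Least[of i "\<lambda>m. \<exists>f\<in>W. coord f m \<noteq> 0"] by (auto simp: m_def)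
  define p where "p = proj W (l2_unit m)"
  have p: "p \<in> W" "\<And>f. f \<in> W \<Longrightarrow> cip f p = coord f m"
    by (auto simp: p_def proj_props W cip_proj_right)
  have "p \<noteq> 0"
    using p(2)[OF f0(1)] f0(2) by auto
  define \<eta> where "\<eta> = (1 / of_real (norm p)) *\<^sub>C p"
  have fshift_pow: "f \<in> W \<Longrightarrow> (fshift ^^ k) f \<in> W" for f k
    by (induction k) (auto intro: inv)
  have \<eta>W: "\<eta> \<in> W"
    by (simp add: \<eta>_def WD p)
  have wander: "cip ((fshift ^^ Suc k) f) \<eta> = 0" if "f \<in> W" for f k
    using p(2)[OF fshift_pow[OF that, of "Suc k"]] below[OF that, of "m - Suc k"]
      below[OF fshift_pow[OF that, of k], of "m - 1"]
    by (auto simp: \<eta>_def coord_fshift)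
  have \<eta>: "inner_seq \<eta>"
    unfolding inner_seq_def
  proof
    fix k
    show "cip ((fshift ^^ k) \<eta>) \<eta> = (if k = 0 then 1 else 0)"
    proof (cases k)
      case 0
      then show ?thesis
        using \<open>p \<noteq> 0\<close> by (simp add: \<eta>_def cip_self_norm power2_eq_square norm_divide)
    qed (use wander[OF \<eta>W] in auto)
  qed
  have in_W: "Mul \<eta> f \<in> W" for f
    unfolding Mul_def onsum_def
  proof (rule closed_sequentially[OF WD(1)])
    show "(\<lambda>n. \<Sum>k<n. coord f k *\<^sub>C (fshift ^^ k) \<eta>) \<longlonglongrightarrow> (\<Sum>k. coord f k *\<^sub>C (fshift ^^ k) \<eta>)"
      by (rule summable_LIMSEQ[OF summable_onsum[OF orthonormal_inner_seq[OF \<eta>]]])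
    fix n
    show "(\<Sum>k<n. coord f k *\<^sub>C (fshift ^^ k) \<eta>) \<in> W"
      by (induction n) (auto intro!: WD fshift_pow \<eta>W)
  qed
  have "closed (range (Mul \<eta>))"
  proof -
    have "bounded_linear (Mul \<eta>)"
      using bounded_clinear_Mul[OF \<eta>] by (rule bounded_clinearD)
    then have "complete (Mul \<eta> ` UNIV)"
      by (intro complete_isometric_image[of 1]) (auto simp: norm_Mul[OF \<eta>] complete_UNIV subspace_UNIV)
    then show ?thesis
      by (simp add: complete_imp_closed)
  qed
  moreover have "cl2.subspace (range (Mul \<eta>))"
  proof -
    note L = bounded_clinearD[OF bounded_clinear_Mul[OF \<eta>]]
    have "0 \<in> range (Mul \<eta>)"
      by (rule range_eqI[of _ _ 0]) (simp add: L)
    moreover have "Mul \<eta> f + Mul \<eta> g \<in> range (Mul \<eta>)" for f g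
      by (rule range_eqI[of _ _ "f + g"]) (simp add: L)
    moreover have "c *\<^sub>C Mul \<eta> f \<in> range (Mul \<eta>)" for f c
      by (rule range_eqI[of _ _ "c *\<^sub>C f"]) (simp add: L)
    ultimately show ?thesis
      by (auto simp: cl2.subspace_def)
  qed
  ultimately have R: "closed_csubspace (range (Mul \<eta>))"
    by (simp add: closed_csubspace_def)
  have "W = range (Mul \<eta>)"
  proof (rule closed_csubspace_eqI[OF W R])
    show "range (Mul \<eta>) \<subseteq> W"
      using in_W by blast
    fix f assume f: "f \<in> W" "f \<in> ortho (range (Mul \<eta>))"
    show "f = 0"
    \<comment> \<open>Orthogonality to the range gives one half of the hypotheses. The other half
      concerns translates of \<open>f\<close> and is the wandering property, since \<open>f\<close>
      lies in \<open>W\<close>.\<close>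
    proof (rule inner_seq_eq_0_if_uncorrelated[OF \<eta>])
      show f\<eta>: "cip f ((fshift ^^ k) \<eta>) = 0" for k
        using f(2) Mul_unit[OF \<eta>] by (metis orthoD rangeI)
      show "cip ((fshift ^^ k) f) \<eta> = 0" for k
        using f\<eta>[of 0] wander[OF f(1), of "k - 1"] by (cases k) auto
    qed
  qed
  with \<eta> show ?thesis
    using that by blast
qed

text \<open>The orthogonal complement of \<open>model x \<ominus> N\<close> is \<open>N \<oplus> x H\<^sup>2\<close>; it is shift invariant, so Beurling's
  theorem applies.\<close>

theorem cshift_invariant_subspace:
  assumes x: "inner_seq x" and N: "closed_csubspace N" "N \<subseteq> model x"
    and inv: "\<And>f. f \<in> N \<Longrightarrow> cshift x f \<in> N"
  obtains \<eta> \<phi> where "inner_seq \<eta>" "inner_seq \<phi>" "Mul \<eta> \<phi> = x" "N = Mul \<eta> ` model \<phi>"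
proof -
  define W where "W = ortho (model x \<inter> ortho N)"
  \<comment> \<open>Invariance is checked on the complement: \<open>bshift\<close> preserves
    \<open>model x \<inter> ortho N\<close>, because on \<open>model x\<close> it is the adjoint of
    \<open>cshift\<close>, which preserves \<open>N\<close>.\<close>
  have VW: "fshift f \<in> W" if "f \<in> W" for f
    unfolding W_def
  proof (unfold ortho_def[of "model x \<inter> ortho N"], safe)
    fix v assume v: "v \<in> model x" "v \<in> ortho N"
    have "cip (bshift v) m = 0" if "m \<in> N" for m
    proof -
      have "cip m (bshift v) = cip (cshift x m) v"
        using cip_cshift[OF x v(1)] by simp
      also have "\<dots> = 0"
        using inv[OF that] ortho_sym[OF v(2)] by blast
      finally show ?thesis
        by (subst cip_commute) simp
    qed
    then have "bshift v \<in> model x \<inter> ortho N"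
      using bshift_model[OF x v(1)] by (auto simp: ortho_def)
    then show "cip (fshift f) v = 0"
      using that by (auto simp: cip_fshift W_def ortho_def)
  qed
  have xW: "x \<in> W"
    using ortho_mono[of "model x \<inter> ortho N" "model x"] inner_seq_in_ortho_model[OF x] by (auto simp: W_def)
  have "x \<noteq> 0"
    using cip_inner_seq_self[OF x] by auto
  then obtain \<eta> where \<eta>: "inner_seq \<eta>" "W = range (Mul \<eta>)"
    using beurling[of W x] VW xW by (auto simp: W_def)
  then obtain \<phi> where \<phi>: "Mul \<eta> \<phi> = x"
    using xW by auto
  have \<phi>i: "inner_seq \<phi>"
    using inner_seq_Mul_iff[OF \<eta>(1)] \<phi> x by metis
  have Qiff: "Mul \<eta> h \<in> model x \<longleftrightarrow> h \<in> model \<phi>" for h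
    unfolding model_iff \<phi>[symmetric] Mul_assoc[OF \<eta>(1) \<phi>i, symmetric] cip_Mul[OF \<eta>(1)] ..
  \<comment> \<open>A vector of \<open>W\<close> that lies in \<open>model x\<close> and is
    orthogonal to \<open>N\<close> belongs to the space to which all of \<open>W\<close> is
    orthogonal, so it is orthogonal to itself.\<close>
  have "N = W \<inter> model x"
  proof (rule sym, rule closed_csubspace_eqI)
    show "N \<subseteq> W \<inter> model x"
      using N(2) by (auto simp: W_def ortho_def intro: ortho_sym)
    fix f assume f: "f \<in> W \<inter> model x" "f \<in> ortho N"
    then have "cip f f = 0"
      by (auto simp: W_def ortho_def)
    then show "f = 0"
      by simp
  qed (auto simp: W_def N closed_csubspace_Int)
  also have "\<dots> = Mul \<eta> ` model \<phi>"
    using Qiff by (auto simp: \<eta>(2))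
  finally show ?thesis
    using that \<eta>(1) \<phi>i \<phi> by blast
qed

section \<open>Radial limits: Fatou's theorem for the Hardy space\<close>

subsection \<open>The circle and the Poisson kernel\<close>

text \<open>Borel rather than Lebesgue measurable sets, which suit product measures and Fubini; by
  \<open>AE_lebesgue_circle\<close> the statements valid almost everywhere are the same.\<close>

definition circle :: "real measure"
  where "circle = restrict_space lborel {0..2 * pi}"

lemma space_circle [simp]: "space circle = {0..2 * pi}"
  by (simp add: circle_def)

lemma measurable_circle [measurable (raw)]: "f \<in> borel_measurable borel \<Longrightarrow> f \<in> borel_measurable circle"
  unfolding circle_def by (rule measurable_restrict_space1) simp

lemma measurable_ident_circle [measurable]: "(\<lambda>t. t) \<in> borel_measurable circle"
  by (rule measurable_circle) simp

lemma emeasure_circle [simp]: "emeasure circle {0..2 * pi} = ennreal (2 * pi)"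
  by (simp add: circle_def emeasure_restrict_space)

interpretation circle: finite_measure circle
  by standard simp

interpretation circle_pair: pair_sigma_finite circle circle ..

interpretation circle2: finite_measure "circle \<Otimes>\<^sub>M circle"
  by (intro finite_measure_pair_measure circle.finite_measure_axioms)

lemma measure_circle [simp]: "measure circle {0..2 * pi} = 2 * pi"
  by (simp add: measure_def)

lemma measurable_cis [measurable]: "cis \<in> borel_measurable borel"
  by (intro borel_measurable_continuous_onI continuous_intros)

lemma measurable_cnj [measurable]: "cnj \<in> borel_measurable borel"
  by (intro borel_measurable_continuous_onI continuous_intros)

lemma integrable_circle:
  fixes f :: "real \<Rightarrow> 'a::{banach, second_countable_topology}"
  assumes "f \<in> borel_measurable circle" "\<And>t. norm (f t) \<le> B"
  shows "integrable circle f"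
  by (rule circle.integrable_const_bound[of _ B]) (use assms in auto)

lemma integrable_circle_pair:
  fixes f :: "real \<Rightarrow> real \<Rightarrow> real"
  assumes "case_prod f \<in> borel_measurable (circle \<Otimes>\<^sub>M circle)" "\<And>s t. norm (f s t) \<le> B"
  shows "integrable (circle \<Otimes>\<^sub>M circle) (case_prod f)"
  by (rule circle2.integrable_const_bound[of _ B]) (use assms in auto)

lemma circle_integral_suminf:
  fixes f :: "nat \<Rightarrow> real \<Rightarrow> complex"
  assumes [measurable]: "\<And>n. f n \<in> borel_measurable circle"
    and bound: "\<And>n t. norm (f n t) \<le> b n" and b: "summable b"
  shows "(LINT t|circle. (\<Sum>n. f n t)) = (\<Sum>n. LINT t|circle. f n t)"
proof (rule integral_suminf)
  show int: "integrable circle (f n)" for n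
    by (rule integrable_circle[of _ "b n"]) (use bound in auto)
  show "AE t in circle. summable (\<lambda>n. norm (f n t))"
    using bound by (intro AE_I2 summable_comparison_test'[OF b]) auto
  have "(LINT t|circle. norm (f n t)) \<le> 2 * pi * b n" for n
  proof -
    have "(LINT t|circle. norm (f n t)) \<le> (LINT t|circle. b n)"
      by (intro integral_mono integrable_norm int) (use bound in auto)
    then show ?thesis
      by simp
  qed
  then show "summable (\<lambda>n. LINT t|circle. norm (f n t))"
    by (intro summable_comparison_test'[OF summable_mult[OF b, of "2 * pi"]]) simp
qed

lemma integral_circle_cis:
  "(LINT t|circle. cis (of_int m * t)) = (if m = 0 then 2 * of_real pi else 0)"
proof -
  have eq: "(LINT t|circle. f t) = (LINT t|lborel. indicator {0..2 * pi} t *\<^sub>R f t)" for f :: "real \<Rightarrow> complex"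
    unfolding circle_def by (rule integral_restrict_space) simp
  show ?thesis
  proof (cases "m = 0")
    case True
    then show ?thesis
      by (simp add: scaleR_conv_of_real)
  next
    case False
    define c where "c = \<i> * of_int m"
    have c: "c \<noteq> 0"
      using False by (simp add: c_def)
    have "(LINT t|lborel. indicator {0..2 * pi} t *\<^sub>R exp (c * of_real t))
        = exp (c * of_real (2 * pi)) / c - exp (c * of_real 0) / c"
    proof (rule integral_FTC_atLeastAtMost)
      fix x :: real
      have "((\<lambda>z. exp (c * z) / c) has_field_derivative exp (c * of_real x)) (at (of_real x))"
        using c by (auto intro!: derivative_eq_intros)
      then show "((\<lambda>t. exp (c * of_real t) / c) has_vector_derivative exp (c * of_real x)) (at x within {0..2 * pi})"
        by (rule has_vector_derivative_real_field)
    qed (auto intro!: continuous_intros)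
    also have "exp (c * of_real (2 * pi)) = 1"
      unfolding exp_eq_1 by (auto simp: c_def intro!: exI[of _ m])
    finally show ?thesis
      using False by (simp add: eq cis_conv_exp c_def mult_ac)
  qed
qed

section \<open>The Poisson kernel: comparison of radii, Fourier expansion, semigroup law\<close>

definition poisson :: "real \<Rightarrow> real \<Rightarrow> real"
  where "poisson r x = (1 - r\<^sup>2) / (1 - 2 * r * cos x + r\<^sup>2)"

lemma poisson_uminus: "poisson r (- x) = poisson r x"
  by (simp add: poisson_def)

lemma poisson_commute: "poisson r (x - y) = poisson r (y - x)"
  using poisson_uminus[of r "x - y"] by simp

lemma poisson_denominator_nonneg: "0 \<le> (1::real) - 2 * r * cos x + r\<^sup>2"
proof -
  have "1 - 2 * r * cos x + r\<^sup>2 = (r - cos x)\<^sup>2 + (sin x)\<^sup>2"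
    by (simp add: sin_squared_eq power2_eq_square algebra_simps)
  then show ?thesis
    by simp
qed

lemma poisson_denominator_ge: "0 \<le> r \<Longrightarrow> (1 - r)\<^sup>2 \<le> (1::real) - 2 * r * cos x + r\<^sup>2"
  using mult_left_le[of "cos x" r] by (simp add: power2_eq_square algebra_simps)

lemma poisson_nonneg: "0 \<le> r \<Longrightarrow> r \<le> 1 \<Longrightarrow> 0 \<le> poisson r x"
  unfolding poisson_def by (intro divide_nonneg_nonneg poisson_denominator_nonneg) (simp add: power_le_one)

lemma poisson_le:
  assumes "0 \<le> r" "r \<le> R" "R < 1"
  shows "poisson r x \<le> 1 / (1 - R)\<^sup>2"
  unfolding poisson_def
proof (rule frac_le)
  have "(1 - R)\<^sup>2 \<le> (1 - r)\<^sup>2"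
    using assms by (intro power_mono) auto
  then show "(1 - R)\<^sup>2 \<le> 1 - 2 * r * cos x + r\<^sup>2"
    using poisson_denominator_ge[of r x] assms by linarith
qed (use assms in auto)

text \<open>Lowering the radius from \<open>r\<close> to some value not below
  \<open>r\<^sup>2\<close> costs a bounded factor: at most 4 from the denominators and at most 2
  from the numerators.\<close>

lemma poisson_compare:
  assumes r: "0 \<le> r" "r < 1" and \<rho>: "r\<^sup>2 \<le> \<rho>" "\<rho> \<le> r"
  shows "poisson \<rho> x \<le> 8 * poisson r x"
proof -
  define D where "D r = 1 - 2 * r * cos x + r\<^sup>2" for r
  have \<rho>0: "0 \<le> \<rho>" "\<rho> < 1"
    using r \<rho> zero_le_power2[of r] by linarith+
  have "(1 - \<rho>)\<^sup>2 > 0" "(1 - r)\<^sup>2 > 0"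
    using \<rho>0 r by auto
  then have pos: "D \<rho> > 0" "D r > 0"
    using poisson_denominator_ge[of \<rho> x] poisson_denominator_ge[of r x] \<rho>0(1) r(1) unfolding D_def by linarith+
  \<comment> \<open>Parallelogram law in the plane: \<open>D r\<close> is the squared distance from
    \<open>cis x\<close> to the real point \<open>r\<close>, and \<rho> is the midpoint of
    \<open>r\<close> and \<open>2 * \<rho> - r\<close>.\<close>
  have "D r = 2 * D \<rho> + 2 * (r - \<rho>)\<^sup>2 - D (2 * \<rho> - r)"
    by (simp add: D_def power2_eq_square algebra_simps)
  moreover have "D (2 * \<rho> - r) \<ge> 0"
    using poisson_denominator_nonneg[of "2 * \<rho> - r" x] by (simp add: D_def)
  moreover have "(r - \<rho>)\<^sup>2 \<le> (1 - \<rho>)\<^sup>2"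
    using r \<rho> by (intro power_mono) auto
  moreover have "(1 - \<rho>)\<^sup>2 \<le> D \<rho>"
    using poisson_denominator_ge[of \<rho> x] \<rho>0 by (simp add: D_def)
  ultimately have D: "D r \<le> 4 * D \<rho>"
    by linarith
  have "(r\<^sup>2)\<^sup>2 \<le> \<rho>\<^sup>2"
    using \<rho> by (intro power_mono) auto
  moreover have "1 - (r\<^sup>2)\<^sup>2 = (1 - r\<^sup>2) * (1 + r\<^sup>2)"
    by (simp add: algebra_simps power2_eq_square)
  moreover have "(1 - r\<^sup>2) * (1 + r\<^sup>2) \<le> (1 - r\<^sup>2) * 2"
    using r by (intro mult_left_mono) (auto simp: power_le_one)
  ultimately have N: "1 - \<rho>\<^sup>2 \<le> 2 * (1 - r\<^sup>2)"
    by linarith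
  have "r\<^sup>2 \<le> 1"
    using r by (simp add: power_le_one)
  have "poisson \<rho> x = (1 - \<rho>\<^sup>2) / D \<rho>"
    by (simp add: poisson_def D_def)
  also have "\<dots> \<le> (2 * (1 - r\<^sup>2)) / (D r / 4)"
    using N D pos \<open>r\<^sup>2 \<le> 1\<close> by (intro frac_le) auto
  also have "\<dots> = 8 * poisson r x"
    by (simp add: poisson_def D_def)
  finally show ?thesis .
qed

text \<open>If \<open>r\<close> is the smaller radius, \<open>r * r'\<close> lies between
  \<open>r\<^sup>2\<close> and \<open>r\<close>, so the comparison applies with the smaller one. The
  sum on the right avoids deciding which radius that is.\<close>

lemma poisson_mult_le:
  assumes "0 \<le> r" "r < 1" "0 \<le> r'" "r' < 1"
  shows "poisson (r * r') x \<le> 8 * (poisson r x + poisson r' x)"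
proof -
  have *: "poisson (r * r') x \<le> 8 * poisson r x" if "0 \<le> r" "r \<le> r'" "r' < 1" for r r'
    using that by (intro poisson_compare) (auto simp: power2_eq_square mult_left_mono mult_left_le)
  show ?thesis
  proof (cases "r \<le> r'")
    case True
    then show ?thesis
      using *[of r r'] poisson_nonneg[of r' x] assms by simp
  next
    case False
    then show ?thesis
      using *[of r' r] poisson_nonneg[of r x] assms by (simp add: mult.commute)
  qed
qed

lemma measurable_poisson [measurable]:
  assumes [measurable]: "f \<in> borel_measurable M" "g \<in> borel_measurable M"
  shows "(\<lambda>x. poisson (f x) (g x)) \<in> borel_measurable M"
  unfolding poisson_def by measurable

lemma poisson_sums:
  assumes "0 \<le> r" "r < 1"
  shows "(\<lambda>n. if n = 0 then 1 else of_real (r ^ n) * (cis (of_nat n * x) + cis (- of_nat n * x)))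
    sums complex_of_real (poisson r x)"
proof -
  define z where "z = of_real r * cis x"
  have nz: "cmod z < 1" "cmod (cnj z) < 1"
    using assms by (auto simp: z_def norm_mult)
  then have ne: "1 - z \<noteq> 0" "1 - cnj z \<noteq> 0"
    by (metis less_irrefl norm_one right_minus_eq)+
  have "(\<lambda>n. z ^ n + cnj z ^ n - (if n = 0 then 1 else 0)) sums (1 / (1 - z) + 1 / (1 - cnj z) - 1)"
    using sums_single[of 0 "\<lambda>_. 1 :: complex"] by (intro sums_diff sums_add geometric_sums nz) simp
  also have "(\<lambda>n. z ^ n + cnj z ^ n - (if n = 0 then 1 else 0))
      = (\<lambda>n. if n = 0 then 1 else of_real (r ^ n) * (cis (of_nat n * x) + cis (- of_nat n * x)))"
    by (auto simp: z_def fun_eq_iff power_mult_distrib Complex.DeMoivre distrib_left cis_cnj)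
  also have "1 / (1 - z) + 1 / (1 - cnj z) - 1 = (1 - z * cnj z) / ((1 - z) * (1 - cnj z))"
  proof -
    have "1 / u + 1 / v - 1 = (u + v - u * v) / (u * v)" if "u \<noteq> 0" "v \<noteq> 0" for u v :: complex
      using that by (simp add: field_simps)
    from this[OF ne] show ?thesis
      by (simp add: algebra_simps)
  qed
  also have "\<dots> = of_real (poisson r x)"
  proof -
    have 1: "z * cnj z = of_real (r\<^sup>2)"
      using complex_norm_square[of z] assms by (simp add: z_def norm_mult)
    have "(1 - z) * (1 - cnj z) = 1 - (z + cnj z) + z * cnj z"
      by (simp add: algebra_simps)
    also have "\<dots> = of_real (1 - 2 * r * cos x + r\<^sup>2)"
      unfolding complex_add_cnj 1 by (simp add: z_def)
    finally show ?thesis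
      by (simp add: 1 poisson_def)
  qed
  finally show ?thesis .
qed

lemma integral_poisson_cis:
  assumes r: "0 \<le> r" "r < 1"
  shows "(LINT s|circle. of_real (poisson r (t - s)) * cis (of_nat k * s)) = 2 * of_real pi * (of_real r * cis t) ^ k"
proof -
  define u where "u n s = (if n = 0 then 1 else of_real (r ^ n) *
    (cis (of_nat n * (t - s)) + cis (- of_nat n * (t - s)))) * cis (of_nat k * s)" for n s
  have [measurable]: "u n \<in> borel_measurable circle" for n
    unfolding u_def by measurable
  have int_u: "(LINT s|circle. u n s) = (if n = k then 2 * of_real pi * (of_real r * cis t) ^ n else 0)" for n
  proof (cases "n = 0")
    case True
    then show ?thesis
      using integral_circle_cis[of "int k"] by (auto simp: u_def)
  next
    case False
    have "u n s = of_real (r ^ n) * cis (of_nat n * t) * cis (of_int (int k - int n) * s)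
        + of_real (r ^ n) * cis (- of_nat n * t) * cis (of_int (int k + int n) * s)" for s
      using False by (simp add: u_def cis_mult algebra_simps)
    then have "(LINT s|circle. u n s) = of_real (r ^ n) * cis (of_nat n * t) * (LINT s|circle. cis (of_int (int k - int n) * s))
        + of_real (r ^ n) * cis (- of_nat n * t) * (LINT s|circle. cis (of_int (int k + int n) * s))"
      by (simp only:) (subst Bochner_Integration.integral_add; (intro integrable_mult_right integrable_circle[of _ 1])?; simp)
    then show ?thesis
      using False unfolding integral_circle_cis by (auto simp: power_mult_distrib Complex.DeMoivre)
  qed
  have "(\<lambda>n. u n s) sums (of_real (poisson r (t - s)) * cis (of_nat k * s))" for s
    unfolding u_def by (intro sums_mult2 poisson_sums r)
  then have "(LINT s|circle. of_real (poisson r (t - s)) * cis (of_nat k * s)) = (LINT s|circle. (\<Sum>n. u n s))"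
    by (simp add: sums_iff)
  also have "\<dots> = (\<Sum>n. LINT s|circle. u n s)"
  proof (rule circle_integral_suminf)
    show "norm (u n s) \<le> 2 * r ^ n" for n s
    proof (cases "n = 0")
      case False
      have "norm (u n s) \<le> r ^ n * (norm (cis (of_nat n * (t - s))) + norm (cis (- of_nat n * (t - s))))"
        unfolding u_def using r False
        by (simp add: norm_mult norm_power) (intro mult_left_mono norm_triangle_le, auto)
      then show ?thesis
        by simp
    qed (simp add: u_def)
    show "summable (\<lambda>n. 2 * r ^ n)"
      using r by (intro summable_mult summable_geometric) auto
  qed measurable
  also have "\<dots> = (\<Sum>n. if n = k then 2 * of_real pi * (of_real r * cis t) ^ n else 0)"
    by (simp add: int_u)
  also have "\<dots> = 2 * of_real pi * (of_real r * cis t) ^ k"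
    using sums_single[of k "\<lambda>n. 2 * of_real pi * (of_real r * cis t) ^ n"] by (simp add: sums_iff)
  finally show ?thesis .
qed

lemma poisson_series:
  assumes a: "summable (\<lambda>k. cmod (a k))" and r: "0 \<le> r" "r < 1"
  shows "(LINT s|circle. of_real (poisson r (t - s)) * (\<Sum>k. a k * cis (of_nat k * s)))
    = 2 * of_real pi * (\<Sum>k. a k * (of_real r * cis t) ^ k)"
proof -
  have "summable (\<lambda>k. a k * cis (of_nat k * s))" for s
    by (rule summable_norm_cancel) (simp add: norm_mult a)
  then have "(LINT s|circle. of_real (poisson r (t - s)) * (\<Sum>k. a k * cis (of_nat k * s)))
      = (LINT s|circle. (\<Sum>k. a k * (of_real (poisson r (t - s)) * cis (of_nat k * s))))"
    by (simp add: suminf_mult[symmetric] mult_ac)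
  also have "\<dots> = (\<Sum>k. LINT s|circle. a k * (of_real (poisson r (t - s)) * cis (of_nat k * s)))"
  proof (rule circle_integral_suminf)
    show "norm (a k * (of_real (poisson r (t - s)) * cis (of_nat k * s))) \<le> cmod (a k) * (1 / (1 - r)\<^sup>2)" for k s
      using poisson_le[OF r(1) order_refl r(2), of "t - s"] poisson_nonneg[of r "t - s"] r
      by (simp add: norm_mult mult_left_mono divide_inverse)
    show "summable (\<lambda>k. cmod (a k) * (1 / (1 - r)\<^sup>2))"
      by (intro summable_mult2 a)
  qed measurable
  also have "\<dots> = (\<Sum>k. 2 * of_real pi * (a k * (of_real r * cis t) ^ k))"
    using integral_poisson_cis[OF r, of t] by (simp add: mult_ac)
  also have "\<dots> = 2 * of_real pi * (\<Sum>k. a k * (of_real r * cis t) ^ k)"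
  proof (rule suminf_mult, rule summable_norm_cancel, rule summable_comparison_test'[OF a])
    show "norm (norm (a k * (of_real r * cis t) ^ k)) \<le> cmod (a k)" for k
      using r by (simp add: norm_mult norm_power mult_left_le power_le_one)
  qed
  finally show ?thesis .
qed

lemma Re_suminf_poisson:
  assumes "0 \<le> r" "r < 1"
  shows "Re (\<Sum>n. (if n = 0 then 1 else 2) * (of_real r * cis x) ^ n) = poisson r x"
proof -
  have *: "Re ((if n = 0 then 1 else 2) * (of_real r * cis x) ^ n)
      = Re (if n = 0 then 1 else of_real (r ^ n) * (cis (of_nat n * x) + cis (- of_nat n * x)))" for n
    by (auto simp: power_mult_distrib Complex.DeMoivre simp flip: of_real_power)
  have "summable (\<lambda>n. (if n = 0 then 1 else 2) * (of_real r * cis x) ^ n)"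
    using assms by (intro summable_comparison_test'[OF summable_mult[OF summable_geometric[of r], of 2]])
      (auto simp: norm_mult norm_power)
  then have "(\<lambda>n. Re ((if n = 0 then 1 else 2) * (of_real r * cis x) ^ n))
      sums Re (\<Sum>n. (if n = 0 then 1 else 2) * (of_real r * cis x) ^ n)"
    by (intro sums_Re summable_sums)
  moreover have "(\<lambda>n. Re ((if n = 0 then 1 else 2) * (of_real r * cis x) ^ n)) sums poisson r x"
    unfolding * using sums_Re[OF poisson_sums[OF assms]] by simp
  ultimately show ?thesis
    by (rule sums_unique2)
qed

text \<open>As a function of \<open>s\<close> the second kernel is the real part of a power series
  in \<open>cis s\<close>; integrating against the first kernel evaluates that series at
  \<open>r cis t\<close>.\<close>

lemma poisson_semigroup:
  assumes r: "0 \<le> r" "r < 1" and r': "0 \<le> r'" "r' < 1"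
  shows "(LINT s|circle. poisson r (t - s) * poisson r' (t' - s)) = 2 * pi * poisson (r * r') (t - t')"
proof -
  \<comment> \<open>The coefficients 1, 2, 2, ... are those of \<open>(1 + v) / (1 - v)\<close>,
    whose real part is the Poisson kernel; the factor \<open>r' cis (- t')\<close> moves it to the
    right radius and angle.\<close>
  define a where "a k = (if k = 0 then 1 else 2) * (of_real r' * cis (- t')) ^ k" for k
  have a: "summable (\<lambda>k. cmod (a k))"
    using r' by (intro summable_comparison_test'[OF summable_mult[OF summable_geometric[of r'], of 2]])
      (auto simp: a_def norm_mult norm_power)
  have H: "a k * (of_real q * cis s) ^ k = (if k = 0 then 1 else 2) * (of_real (r' * q) * cis (s - t')) ^ k" for k q s
  proof -
    have "(of_real r' * cis (- t')) * (of_real q * cis s) = of_real (r' * q) * cis (s - t')"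
      by (simp add: cis_mult algebra_simps)
    then show ?thesis
      by (metis a_def mult.assoc power_mult_distrib)
  qed
  define G where "G s = (\<Sum>k. a k * cis (of_nat k * s))" for s
  have G: "Re (G s) = poisson r' (t' - s)" for s
    using Re_suminf_poisson[OF r', of "s - t'"] H[of _ 1 s] by (simp add: G_def Complex.DeMoivre poisson_commute)
  have normG: "cmod (G s) \<le> (\<Sum>k. cmod (a k))" for s
    unfolding G_def by (rule norm_suminf_le) (auto simp: norm_mult a)
  have [measurable]: "G \<in> borel_measurable circle"
    unfolding G_def by measurable
  have int: "integrable circle (\<lambda>s. of_real (poisson r (t - s)) * G s)"
  proof (rule integrable_circle)
    show "norm (of_real (poisson r (t - s)) * G s) \<le> (1 / (1 - r)\<^sup>2) * (\<Sum>k. cmod (a k))" for s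
      unfolding norm_mult
      using poisson_le[OF r(1) order_refl r(2), of "t - s"] poisson_nonneg[of r "t - s"] r
      by (intro mult_mono normG) auto
  qed measurable
  have "(LINT s|circle. poisson r (t - s) * poisson r' (t' - s)) = (LINT s|circle. Re (of_real (poisson r (t - s)) * G s))"
    by (simp add: G)
  also have "\<dots> = Re (LINT s|circle. of_real (poisson r (t - s)) * G s)"
    by (rule integral_Re[OF int])
  also have "\<dots> = Re (2 * of_real pi * (\<Sum>k. a k * (of_real r * cis t) ^ k))"
    unfolding G_def by (simp only: poisson_series[OF a r])
  also have "\<dots> = 2 * pi * poisson (r * r') (t - t')"
  proof -
    have "r' * r < 1"
      using r r' mult_strict_mono'[of r' 1 r 1] by simp
    then show ?thesis
      unfolding H using Re_suminf_poisson[of "r' * r" "t - t'"] r r' by (simp add: mult.commute)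
  qed
  finally show ?thesis .
qed

subsection \<open>The maximal inequality\<close>

text \<open>Let \<open>T\<close> be the operator with kernel \<open>poisson (r t) (t - s)\<close>. By \<open>poisson_semigroup\<close> and \<open>poisson_mult_le\<close> the
  kernel of \<open>T T\<^sup>*\<close> is at most a constant times that of \<open>T + T\<^sup>*\<close>, hence
  \<open>\<parallel>T\<^sup>* g\<parallel>\<^sup>2 \<le> C \<parallel>T\<^sup>* g\<parallel> \<parallel>g\<parallel>\<close> for \<open>g \<ge> 0\<close>, which bounds \<open>T\<close> independently of the radius function \<open>r\<close>.\<close>

lemma poisson_dual_bound:
  fixes r g :: "real \<Rightarrow> real"
  assumes [measurable]: "r \<in> borel_measurable borel" "g \<in> borel_measurable borel"
    and r: "\<And>t. 0 \<le> r t" "\<And>t. r t \<le> R" "R < 1" and g: "\<And>t. 0 \<le> g t" "\<And>t. g t \<le> B"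
  shows "(LINT s|circle. (LINT t|circle. poisson (r t) (t - s) * g t)\<^sup>2) \<le> 1024 * pi\<^sup>2 * (LINT t|circle. (g t)\<^sup>2)"
proof -
  define K where "K s t = poisson (r t) (t - s) * g t" for s t
  \<comment> \<open>\<open>Z\<close> is \<open>T\<^sup>* g\<close>. The bounds \<open>R\<close> and
    \<open>B\<close> secure integrability throughout, and the final constant is independent of
    them.\<close>
  define Z where "Z s = (LINT t|circle. K s t)" for s
  define C where "C = 1 / (1 - R)\<^sup>2 * B"
  have r1: "r t < 1" for t
    using r(2)[of t] r(3) by linarith
  have "0 \<le> B"
    using g(1)[of 0] g(2)[of 0] by linarith
  have pk0: "0 \<le> poisson (r t) x" for t x
    using r1[of t] r(1)[of t] by (intro poisson_nonneg) auto
  have K0: "0 \<le> K s t" for s t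
    using g pk0 by (simp add: K_def)
  have KC: "K s t \<le> C" for s t
    unfolding K_def C_def using r r1 g pk0 by (intro mult_mono poisson_le) auto
  have C0: "0 \<le> C"
    using K0[of 0 0] KC[of 0 0] by linarith
  have [measurable]: "case_prod K \<in> borel_measurable (circle \<Otimes>\<^sub>M circle)"
    unfolding K_def by measurable
  have [measurable]: "K s \<in> borel_measurable circle" "(\<lambda>s. K s t) \<in> borel_measurable circle" for s t
    unfolding K_def by measurable
  have [measurable]: "Z \<in> borel_measurable circle"
    unfolding Z_def by measurable
  have intK: "integrable circle (K s)" for s
    by (rule integrable_circle[of _ C]) (use K0 KC in auto)
  have Z0: "0 \<le> Z s" for s
    unfolding Z_def by (intro integral_nonneg_AE) (use K0 in auto)
  have ZC: "Z s \<le> 2 * pi * C" for s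
  proof -
    have "Z s \<le> (LINT t|circle. C)"
      unfolding Z_def by (intro integral_mono intK) (use KC in auto)
    then show ?thesis
      by simp
  qed
  have intZ2: "integrable circle (\<lambda>s. (Z s)\<^sup>2)"
    by (rule integrable_circle[of _ "(2 * pi * C)\<^sup>2"]) (use Z0 ZC in \<open>auto intro!: power_mono\<close>)
  have intg2: "integrable circle (\<lambda>s. (g s)\<^sup>2)"
    by (rule integrable_circle[of _ "B\<^sup>2"]) (use g in \<open>auto intro!: power_mono\<close>)
  have bound_gZ: "norm (g s * Z s) \<le> B * (2 * pi * C)" for s
    using g Z0 ZC \<open>0 \<le> B\<close> by (auto simp: abs_mult intro!: mult_mono)
  have intgZ: "integrable circle (\<lambda>s. g s * Z s)"
    by (rule integrable_circle[OF _ bound_gZ]) measurable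
  have bound_gK: "norm (g s * K s' t) \<le> B * C" for s s' t
    using g K0 KC \<open>0 \<le> B\<close> by (auto simp: abs_mult intro!: mult_mono)
  have "(LINT s|circle. (Z s)\<^sup>2) = (LINT s|circle. (LINT t|circle. Z s * K s t))"
    by (simp add: Z_def power2_eq_square)
  also have "\<dots> = (LINT t|circle. (LINT s|circle. Z s * K s t))"
  proof (rule circle_pair.Fubini_integral[symmetric], rule integrable_circle_pair)
    show "norm (Z s * K s t) \<le> (2 * pi * C) * C" for s t
      using K0 KC Z0 ZC C0 by (auto simp: abs_mult intro!: mult_mono)
  qed measurable
  also have "\<dots> = (LINT t|circle. (LINT t'|circle. 2 * pi * (g t * g t' * poisson (r t * r t') (t - t'))))"
  proof (rule Bochner_Integration.integral_cong[OF refl])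
    fix t
    have "(LINT s|circle. Z s * K s t) = (LINT s|circle. (LINT t'|circle. K s t' * K s t))"
      by (simp add: Z_def)
    also have "\<dots> = (LINT t'|circle. (LINT s|circle. K s t' * K s t))"
    proof (rule circle_pair.Fubini_integral[symmetric], rule integrable_circle_pair)
      show "norm (K s t' * K s t) \<le> C * C" for s t'
        using K0 KC C0 by (auto simp: abs_mult intro!: mult_mono)
    qed measurable
    also have "(\<lambda>t'. LINT s|circle. K s t' * K s t) = (\<lambda>t'. 2 * pi * (g t * g t' * poisson (r t * r t') (t - t')))"
    proof
      fix t'
      have "(LINT s|circle. K s t' * K s t) = (LINT s|circle. (g t * g t') * (poisson (r t) (t - s) * poisson (r t') (t' - s)))"
        by (simp add: K_def mult_ac)
      then show "(LINT s|circle. K s t' * K s t) = 2 * pi * (g t * g t' * poisson (r t * r t') (t - t'))"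
        using r r1 by (simp add: poisson_semigroup)
    qed
    finally show "(LINT s|circle. Z s * K s t) = (LINT t'|circle. 2 * pi * (g t * g t' * poisson (r t * r t') (t - t')))" .
  qed
  \<comment> \<open>\<open>poisson_mult_le\<close> replaces the kernel at the product radius by two
    kernels at single radii. After Fubini both terms equal the integral of \<open>g Z\<close>, which
    gives \<open>32 * pi\<close> below.\<close>
  also have "\<dots> \<le> (LINT t|circle. (LINT t'|circle. 16 * pi * (g t' * K t' t + g t * K t t')))"
  proof -
    have le: "2 * pi * (g t * g t' * poisson (r t * r t') (t - t')) \<le> 16 * pi * (g t' * K t' t + g t * K t t')" for t t'
    proof -
      have "g t * g t' * poisson (r t * r t') (t - t') \<le> g t * g t' * (8 * (poisson (r t) (t - t') + poisson (r t') (t - t')))"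
        using r r1 g by (intro mult_left_mono poisson_mult_le) auto
      also have "\<dots> = 8 * (g t' * K t' t + g t * K t t')"
        unfolding K_def poisson_commute[of "r t'" t' t] by (simp add: algebra_simps)
      finally show ?thesis
        by simp
    qed
    have nn: "0 \<le> 2 * pi * (g t * g t' * poisson (r t * r t') (t - t'))" for t t'
      using r r1 g by (intro mult_nonneg_nonneg poisson_nonneg mult_le_one) (auto intro: less_imp_le)
    have ub: "16 * pi * (g t' * K t' t + g t * K t t') \<le> 16 * pi * (B * C + B * C)" for t t'
      using bound_gK[of t' t' t] bound_gK[of t t t'] by (intro mult_left_mono add_mono) auto
    have int1: "integrable circle (\<lambda>t'. 2 * pi * (g t * g t' * poisson (r t * r t') (t - t')))"
      "integrable circle (\<lambda>t'. 16 * pi * (g t' * K t' t + g t * K t t'))" for t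
    proof -
      have b1: "norm (2 * pi * (g t * g t' * poisson (r t * r t') (t - t'))) \<le> 16 * pi * (B * C + B * C)" for t'
        unfolding real_norm_def abs_of_nonneg[OF nn] by (rule order_trans[OF le ub])
      have b2: "norm (16 * pi * (g t' * K t' t + g t * K t t')) \<le> 16 * pi * (B * C + B * C)" for t'
        unfolding real_norm_def abs_of_nonneg[OF order_trans[OF nn le]] by (rule ub)
      show "integrable circle (\<lambda>t'. 2 * pi * (g t * g t' * poisson (r t * r t') (t - t')))"
        by (rule integrable_circle[OF _ b1]) measurable
      show "integrable circle (\<lambda>t'. 16 * pi * (g t' * K t' t + g t * K t t'))"
        by (rule integrable_circle[OF _ b2]) measurable
    qed
    have in1: "(LINT t'|circle. 2 * pi * (g t * g t' * poisson (r t * r t') (t - t')))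
        \<le> (LINT t'|circle. 16 * pi * (g t' * K t' t + g t * K t t'))" for t
      by (intro integral_mono int1 le)
    have in0: "0 \<le> (LINT t'|circle. 2 * pi * (g t * g t' * poisson (r t * r t') (t - t')))" for t
      by (intro integral_nonneg_AE AE_I2 nn)
    have in2: "(LINT t'|circle. 16 * pi * (g t' * K t' t + g t * K t t')) \<le> 2 * pi * (16 * pi * (B * C + B * C))" for t
    proof -
      have "(LINT t'|circle. 16 * pi * (g t' * K t' t + g t * K t t')) \<le> (LINT t'|circle. 16 * pi * (B * C + B * C))"
        by (intro integral_mono int1 ub) simp
      then show ?thesis
        by simp
    qed
    show ?thesis
    proof (rule integral_mono[OF _ _ in1])
      show "integrable circle (\<lambda>t. LINT t'|circle. 2 * pi * (g t * g t' * poisson (r t * r t') (t - t')))"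
        by (rule integrable_circle[of _ "2 * pi * (16 * pi * (B * C + B * C))"])
          (use in0 order_trans[OF in1 in2] in auto)
      show "integrable circle (\<lambda>t. LINT t'|circle. 16 * pi * (g t' * K t' t + g t * K t t'))"
        by (rule integrable_circle[of _ "2 * pi * (16 * pi * (B * C + B * C))"])
          (use order_trans[OF in0 in1] in2 in auto)
    qed
  qed
  also have "\<dots> = 16 * pi * ((LINT t|circle. (LINT t'|circle. g t' * K t' t)) + (LINT t|circle. (LINT t'|circle. g t * K t t')))"
  proof -
    have i: "integrable circle (\<lambda>t'. g t' * K t' t)" "integrable circle (\<lambda>t'. g t * K t t')" for t
      by (rule integrable_circle[OF _ bound_gK]; measurable)+
    have "norm (LINT t'|circle. g t' * K t' t) \<le> 2 * pi * (B * C)" for t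
    proof -
      have "norm (LINT t'|circle. g t' * K t' t) \<le> (LINT t'|circle. norm (g t' * K t' t))"
        by (rule integral_norm_bound)
      also have "\<dots> \<le> (LINT t'|circle. B * C)"
        by (intro integral_mono integrable_norm i bound_gK) simp
      finally show ?thesis
        by simp
    qed
    then have "integrable circle (\<lambda>t. LINT t'|circle. g t' * K t' t)"
      by (intro integrable_circle[of _ "2 * pi * (B * C)"]) measurable
    moreover have "integrable circle (\<lambda>t. LINT t'|circle. g t * K t t')"
      using intgZ by (simp add: Z_def)
    moreover have "(LINT t'|circle. g t' * K t' t + g t * K t t')
        = (LINT t'|circle. g t' * K t' t) + (LINT t'|circle. g t * K t t')" for t
      by (rule Bochner_Integration.integral_add[OF i])
    ultimately show ?thesis
      by (simp only: integral_mult_right_zero[of circle "16 * pi"] Bochner_Integration.integral_add)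
  qed
  also have "(LINT t|circle. (LINT t'|circle. g t' * K t' t)) = (LINT t'|circle. (LINT t|circle. g t' * K t' t))"
    by (rule circle_pair.Fubini_integral, rule integrable_circle_pair[OF _ bound_gK]) measurable
  finally have "(LINT s|circle. (Z s)\<^sup>2) \<le> 32 * pi * (LINT s|circle. g s * Z s)"
    by (simp add: Z_def)
  also have "\<dots> = (LINT s|circle. 32 * pi * (g s * Z s))"
    by simp
  \<comment> \<open>Weights chosen so that half of the integral of \<open>Z\<^sup>2\<close> appears
    on the right; being finite, it is absorbed on the left, and 512 doubles to 1024.\<close>
  also have "\<dots> \<le> (LINT s|circle. 512 * pi\<^sup>2 * (g s)\<^sup>2 + 1 / 2 * (Z s)\<^sup>2)"
  proof (rule integral_mono)
    fix s
    have "0 \<le> (32 * pi * g s - Z s)\<^sup>2"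
      by simp
    then show "32 * pi * (g s * Z s) \<le> 512 * pi\<^sup>2 * (g s)\<^sup>2 + 1 / 2 * (Z s)\<^sup>2"
      by (simp add: power2_eq_square algebra_simps)
  qed (intro Bochner_Integration.integrable_add integrable_mult_right intg2 intZ2 intgZ)+
  also have "\<dots> = 512 * pi\<^sup>2 * (LINT s|circle. (g s)\<^sup>2) + 1 / 2 * (LINT s|circle. (Z s)\<^sup>2)"
    using intg2 intZ2 by (simp add: Bochner_Integration.integral_add)
  finally show ?thesis
    by (simp add: Z_def K_def)
qed

section \<open>Fourier coefficients and Parseval's identity\<close>

lemma fourier_coefficient:
  assumes a: "summable (\<lambda>k. cmod (a k))"
  shows "(LINT t|circle. (\<Sum>k. a k * cis (of_nat k * t)) * cis (- of_nat m * t)) = 2 * of_real pi * a m"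
proof -
  have "summable (\<lambda>k. a k * cis (of_nat k * t))" for t
    by (rule summable_norm_cancel) (simp add: norm_mult a)
  then have "(LINT t|circle. (\<Sum>k. a k * cis (of_nat k * t)) * cis (- of_nat m * t))
      = (LINT t|circle. (\<Sum>k. a k * cis (of_nat k * t) * cis (- of_nat m * t)))"
    by (simp add: suminf_mult2)
  also have "\<dots> = (\<Sum>k. LINT t|circle. a k * cis (of_nat k * t) * cis (- of_nat m * t))"
    by (rule circle_integral_suminf[of _ "\<lambda>k. cmod (a k)"]) (auto simp: norm_mult a)
  also have "\<dots> = (\<Sum>k. if k = m then 2 * of_real pi * a k else 0)"
  proof (rule suminf_cong)
    fix k
    have "a k * cis (of_nat k * t) * cis (- of_nat m * t) = a k * cis (of_int (int k - int m) * t)" for t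
      by (simp add: mult.assoc cis_mult algebra_simps)
    then show "(LINT t|circle. a k * cis (of_nat k * t) * cis (- of_nat m * t)) = (if k = m then 2 * of_real pi * a k else 0)"
      by (simp only: integral_mult_right_zero integral_circle_cis) auto
  qed
  also have "\<dots> = 2 * of_real pi * a m"
    using sums_single[of m "\<lambda>k. 2 * of_real pi * a k"] by (simp add: sums_iff)
  finally show ?thesis .
qed

text \<open>The Fourier coefficients of \<open>\<bar>H\<bar>\<^sup>2\<close> are the
  autocorrelations of the coefficients of \<open>H\<close>: this links unimodular boundary values to
  \<open>inner_seq\<close>.\<close>

lemma parseval_shifted:
  assumes a: "summable (\<lambda>k. cmod (a k))"
  defines "H t \<equiv> (\<Sum>k. a k * cis (of_nat k * t))"
  shows "(LINT t|circle. H t * cnj (H t) * cis (of_nat j * t)) = 2 * of_real pi * (\<Sum>k. a k * cnj (a (k + j)))"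
proof -
  have [measurable]: "H \<in> borel_measurable circle"
    unfolding H_def by measurable
  have normH: "cmod (H t) \<le> (\<Sum>k. cmod (a k))" for t
    unfolding H_def by (rule norm_suminf_le) (auto simp: norm_mult a)
  have "summable (\<lambda>k. a k * cis (of_nat k * t))" for t
    by (rule summable_norm_cancel) (simp add: norm_mult a)
  then have "(LINT t|circle. H t * cnj (H t) * cis (of_nat j * t))
      = (LINT t|circle. (\<Sum>k. a k * cis (of_nat k * t) * (cnj (H t) * cis (of_nat j * t))))"
    unfolding H_def[of t for t] by (subst suminf_mult2[symmetric]) (auto simp: mult_ac)
  also have "\<dots> = (\<Sum>k. LINT t|circle. a k * cis (of_nat k * t) * (cnj (H t) * cis (of_nat j * t)))"
  proof (rule circle_integral_suminf)
    show "norm (a k * cis (of_nat k * t) * (cnj (H t) * cis (of_nat j * t))) \<le> cmod (a k) * (\<Sum>k. cmod (a k))" for k t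
      by (simp add: norm_mult mult_left_mono normH)
    show "summable (\<lambda>k. cmod (a k) * (\<Sum>k. cmod (a k)))"
      by (intro summable_mult2 a)
  qed measurable
  also have "\<dots> = (\<Sum>k. 2 * of_real pi * (a k * cnj (a (k + j))))"
  proof (rule suminf_cong)
    fix k
    have "a k * cis (of_nat k * t) * (cnj (H t) * cis (of_nat j * t)) = a k * cnj (H t * cis (- of_nat (k + j) * t))" for t
      by (simp add: cis_cnj cis_mult mult_ac algebra_simps flip: mult.assoc)
    then have "(LINT t|circle. a k * cis (of_nat k * t) * (cnj (H t) * cis (of_nat j * t)))
        = a k * cnj (LINT t|circle. H t * cis (- of_nat (k + j) * t))"
      by (simp only: integral_mult_right_zero Bochner_Integration.integral_cnj)
    then show "(LINT t|circle. a k * cis (of_nat k * t) * (cnj (H t) * cis (of_nat j * t))) = 2 * of_real pi * (a k * cnj (a (k + j)))"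
      unfolding H_def fourier_coefficient[OF a] by simp
  qed
  also have "\<dots> = 2 * of_real pi * (\<Sum>k. a k * cnj (a (k + j)))"
  proof (rule suminf_mult, rule summable_norm_cancel)
    have "summable (\<lambda>k. cmod (a k) * (\<Sum>k. cmod (a k)))"
      by (intro summable_mult2 a)
    then show "summable (\<lambda>k. norm (a k * cnj (a (k + j))))"
    proof (rule summable_comparison_test')
      fix k
      have "cmod (a (k + j)) \<le> (\<Sum>k. cmod (a k))"
        using sum_le_suminf[OF a, of "{k + j}"] by simp
      then show "norm (norm (a k * cnj (a (k + j)))) \<le> cmod (a k) * (\<Sum>k. cmod (a k))"
        by (simp add: norm_mult mult_left_mono)
    qed
  qed
  finally show ?thesis .
qed

lemma parseval:
  assumes a: "summable (\<lambda>k. cmod (a k))"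
  shows "(LINT t|circle. (cmod (\<Sum>k. a k * cis (of_nat k * t)))\<^sup>2) = 2 * pi * (\<Sum>k. (cmod (a k))\<^sup>2)"
proof -
  have sq: "z * cnj z = of_real ((cmod z)\<^sup>2)" for z
    by (rule complex_norm_square[symmetric])
  have s2: "summable (\<lambda>k. (cmod (a k))\<^sup>2)"
  proof (rule summable_comparison_test'[OF summable_mult2[OF a, of "\<Sum>k. cmod (a k)"]])
    fix k
    have "cmod (a k) \<le> (\<Sum>k. cmod (a k))"
      using sum_le_suminf[OF a, of "{k}"] by simp
    then show "norm ((cmod (a k))\<^sup>2) \<le> cmod (a k) * (\<Sum>k. cmod (a k))"
      by (simp add: power2_eq_square mult_left_mono)
  qed
  have "complex_of_real (LINT t|circle. (cmod (\<Sum>k. a k * cis (of_nat k * t)))\<^sup>2)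
      = 2 * of_real pi * (\<Sum>k. of_real ((cmod (a k))\<^sup>2))"
    using parseval_shifted[OF a, of 0] by (simp add: sq del: of_real_power)
  also have "\<dots> = of_real (2 * pi * (\<Sum>k. (cmod (a k))\<^sup>2))"
    using suminf_of_real[OF s2, where 'a = complex] by simp
  finally show ?thesis
    using of_real_eq_iff by blast
qed

text \<open>The maximal function is linearised by a measurable radius function \<open>r\<close>. A
  polynomial has boundary values, so the Poisson formula bounds \<open>2 * pi * g\<close> by
  \<open>T b\<close>; pairing with \<open>g\<close> moves \<open>T\<close> onto \<open>g\<close>,
  where \<open>poisson_dual_bound\<close> applies. The resulting factor 256 and the
  \<open>2 * pi\<close> of Parseval give the constant.\<close>

lemma maximal_polynomial:
  fixes a :: "nat \<Rightarrow> complex" and N :: nat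
  assumes [measurable]: "r \<in> borel_measurable borel" and r: "\<And>t. 0 \<le> r t" "\<And>t. r t \<le> R" "R < 1"
  shows "(\<integral>\<^sup>+t. ennreal ((cmod (\<Sum>k<N. a k * (of_real (r t) * cis t) ^ k))\<^sup>2) \<partial>circle)
    \<le> ennreal (512 * pi * (\<Sum>k<N. (cmod (a k))\<^sup>2))"
proof -
  define p where "p z = (\<Sum>k<N. a k * z ^ k)" for z
  define g where "g t = cmod (p (of_real (r t) * cis t))" for t
  define b where "b s = cmod (p (cis s))" for s
  define B where "B = (\<Sum>k<N. cmod (a k))"
  define Z where "Z s = (LINT t|circle. poisson (r t) (t - s) * g t)" for s
  define C where "C = 1 / (1 - R)\<^sup>2"
  have [measurable]: "p \<in> borel_measurable borel"
    unfolding p_def by (intro borel_measurable_continuous_onI continuous_intros)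
  have [measurable]: "g \<in> borel_measurable borel" "b \<in> borel_measurable borel"
    unfolding g_def b_def by measurable
  have r1: "r t < 1" for t
    using r(2)[of t] r(3) by linarith
  have pB: "cmod (p z) \<le> B" if "cmod z \<le> 1" for z
    unfolding p_def B_def
    by (rule sum_norm_le) (use that in \<open>auto simp: norm_mult norm_power intro!: mult_left_le power_le_one\<close>)
  have g0: "0 \<le> g t" and gB: "g t \<le> B" for t
    unfolding g_def using r(1)[of t] r1[of t] by (auto intro!: pB simp: norm_mult)
  have b0: "0 \<le> b t" and bB: "b t \<le> B" for t
    unfolding b_def by (auto intro!: pB)
  have B0: "0 \<le> B"
    by (simp add: B_def sum_nonneg)
  have pk0: "0 \<le> poisson (r t) x" and pkC: "poisson (r t) x \<le> C" for t x
    using r1[of t] r(1,2)[of t] r(3) by (auto simp: C_def intro!: poisson_nonneg poisson_le)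
  have C0: "0 \<le> C"
    by (simp add: C_def)
  have kB: "norm (poisson (r t) (t - s) * g t) \<le> C * B" "norm (poisson (r t) (t - s) * b s) \<le> C * B" for s t
    using pk0 pkC g0 gB b0 bB C0 by (auto simp: abs_mult intro!: mult_mono)
  have [measurable]: "Z \<in> borel_measurable circle"
    unfolding Z_def by measurable
  have ZB: "norm (Z s) \<le> 2 * pi * (C * B)" for s
  proof -
    have "norm (Z s) \<le> (LINT t|circle. norm (poisson (r t) (t - s) * g t))"
      unfolding Z_def by (rule integral_norm_bound)
    also have "\<dots> \<le> (LINT t|circle. C * B)"
      by (intro integral_mono integrable_norm integrable_circle[OF _ kB(1)] kB) auto
    finally show ?thesis
      by simp
  qed
  have intg2: "integrable circle (\<lambda>s. (g s)\<^sup>2)"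
    by (rule integrable_circle[of _ "B\<^sup>2"]) (use g0 gB in \<open>auto intro!: power_mono\<close>)
  have intb2: "integrable circle (\<lambda>s. (b s)\<^sup>2)"
    by (rule integrable_circle[of _ "B\<^sup>2"]) (use b0 bB in \<open>auto intro!: power_mono\<close>)
  have intZ2: "integrable circle (\<lambda>s. (Z s)\<^sup>2)"
    by (rule integrable_circle[of _ "(2 * pi * (C * B))\<^sup>2"])
      (use ZB in \<open>auto simp: abs_le_square_iff[symmetric] intro: order_trans[OF _ abs_ge_self]\<close>)
  have intbZ: "integrable circle (\<lambda>s. b s * Z s)"
    by (rule integrable_circle[of _ "B * (2 * pi * (C * B))"])
      (use b0 bB ZB B0 in \<open>auto simp: abs_mult intro!: mult_mono\<close>)
  define a' where "a' k = (if k < N then a k else 0)" for k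
  have pa': "(\<Sum>k. a' k * z ^ k) = p z" for z
    unfolding p_def by (subst suminf_finite[of "{..<N}"]) (auto simp: a'_def)
  have sa': "summable (\<lambda>k. cmod (a' k))"
    by (rule summable_finite[of "{..<N}"]) (auto simp: a'_def)
  have g_le: "2 * pi * g t \<le> (LINT s|circle. poisson (r t) (t - s) * b s)" for t
  proof -
    have "2 * pi * g t = cmod (2 * of_real pi * (\<Sum>k. a' k * (of_real (r t) * cis t) ^ k))"
      by (simp add: pa' g_def norm_mult)
    also have "\<dots> = cmod (LINT s|circle. of_real (poisson (r t) (t - s)) * (\<Sum>k. a' k * cis (of_nat k * s)))"
      using poisson_series[OF sa' r(1)[of t] r1[of t], of t] by simp
    also have "\<dots> \<le> (LINT s|circle. cmod (of_real (poisson (r t) (t - s)) * (\<Sum>k. a' k * cis (of_nat k * s))))"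
      by (rule integral_norm_bound)
    also have "\<dots> = (LINT s|circle. poisson (r t) (t - s) * b s)"
      by (intro Bochner_Integration.integral_cong)
        (auto simp: norm_mult b_def pa' pk0 simp flip: Complex.DeMoivre)
    finally show ?thesis .
  qed
  have kgB: "norm (g t * (poisson (r t) (t - s) * b s)) \<le> B * (C * B)" for s t
    using g0[of t] gB[of t] kB(2)[of t s] B0 C0 by (auto simp: abs_mult intro!: mult_mono)
  have "2 * pi * (LINT t|circle. (g t)\<^sup>2) = (LINT t|circle. 2 * pi * (g t)\<^sup>2)"
    by simp
  also have "\<dots> \<le> (LINT t|circle. (LINT s|circle. g t * (poisson (r t) (t - s) * b s)))"
  proof (rule integral_mono)
    show "integrable circle (\<lambda>t. LINT s|circle. g t * (poisson (r t) (t - s) * b s))"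
    proof (rule integrable_circle)
      fix t
      have "norm (LINT s|circle. g t * (poisson (r t) (t - s) * b s)) \<le> (LINT s|circle. norm (g t * (poisson (r t) (t - s) * b s)))"
        by (rule integral_norm_bound)
      also have "\<dots> \<le> (LINT s|circle. B * (C * B))"
        by (intro integral_mono integrable_norm integrable_circle[OF _ kgB] kgB) auto
      finally show "norm (LINT s|circle. g t * (poisson (r t) (t - s) * b s)) \<le> 2 * pi * (B * (C * B))"
        by simp
    qed measurable
    fix t
    have "2 * pi * (g t)\<^sup>2 = g t * (2 * pi * g t)"
      by (simp add: power2_eq_square)
    also have "\<dots> \<le> g t * (LINT s|circle. poisson (r t) (t - s) * b s)"
      by (rule mult_left_mono[OF g_le g0])
    also have "\<dots> = (LINT s|circle. g t * (poisson (r t) (t - s) * b s))"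
      by (rule integral_mult_right_zero[symmetric])
    finally show "2 * pi * (g t)\<^sup>2 \<le> (LINT s|circle. g t * (poisson (r t) (t - s) * b s))" .
  qed (intro integrable_mult_right intg2)
  also have "\<dots> = (LINT s|circle. (LINT t|circle. g t * (poisson (r t) (t - s) * b s)))"
    by (rule circle_pair.Fubini_integral, rule integrable_circle_pair[OF _ kgB]) measurable
  also have "\<dots> = (LINT s|circle. (LINT t|circle. b s * (poisson (r t) (t - s) * g t)))"
    by (simp add: mult_ac)
  also have "\<dots> = (LINT s|circle. b s * Z s)"
    by (simp add: Z_def)
  \<comment> \<open>The weight of \<open>Z\<^sup>2\<close> is such that the dual bound turns it into
    \<open>pi\<close> times the integral of \<open>g\<^sup>2\<close>, half of what stands on the
    left.\<close>
  also have "\<dots> \<le> (LINT s|circle. 256 * pi * (b s)\<^sup>2 + 1 / (1024 * pi) * (Z s)\<^sup>2)"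
  proof (rule integral_mono)
    fix s
    have "0 \<le> (512 * pi * b s - Z s)\<^sup>2 / (1024 * pi)"
      by simp
    also have "\<dots> = 256 * pi * (b s)\<^sup>2 + 1 / (1024 * pi) * (Z s)\<^sup>2 - b s * Z s"
      by (simp add: power2_eq_square field_simps)
    finally show "b s * Z s \<le> 256 * pi * (b s)\<^sup>2 + 1 / (1024 * pi) * (Z s)\<^sup>2"
      by simp
  qed (intro Bochner_Integration.integrable_add integrable_mult_right intb2 intZ2 intbZ)+
  also have "\<dots> = 256 * pi * (LINT s|circle. (b s)\<^sup>2) + 1 / (1024 * pi) * (LINT s|circle. (Z s)\<^sup>2)"
    using intb2 intZ2 by (simp add: Bochner_Integration.integral_add)
  also have "\<dots> \<le> 256 * pi * (LINT s|circle. (b s)\<^sup>2) + 1 / (1024 * pi) * (1024 * pi\<^sup>2 * (LINT t|circle. (g t)\<^sup>2))"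
    unfolding Z_def using r g0 gB by (intro add_left_mono mult_left_mono poisson_dual_bound) auto
  also have "1 / (1024 * pi) * (1024 * pi\<^sup>2 * (LINT t|circle. (g t)\<^sup>2)) = pi * (LINT t|circle. (g t)\<^sup>2)"
    by (simp add: power2_eq_square)
  finally have "pi * (LINT t|circle. (g t)\<^sup>2) \<le> pi * (256 * (LINT s|circle. (b s)\<^sup>2))"
    by simp
  then have 1: "(LINT t|circle. (g t)\<^sup>2) \<le> 256 * (LINT s|circle. (b s)\<^sup>2)"
    by (simp only: mult_le_cancel_left_pos[OF pi_gt_zero])
  have "(LINT s|circle. (b s)\<^sup>2) = (LINT s|circle. (cmod (\<Sum>k. a' k * cis (of_nat k * s)))\<^sup>2)"
    by (simp add: b_def flip: pa' Complex.DeMoivre)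
  also have "\<dots> = 2 * pi * (\<Sum>k. (cmod (a' k))\<^sup>2)"
    by (rule parseval[OF sa'])
  also have "(\<Sum>k. (cmod (a' k))\<^sup>2) = (\<Sum>k<N. (cmod (a k))\<^sup>2)"
    by (subst suminf_finite[of "{..<N}"]) (auto simp: a'_def)
  finally have "(LINT t|circle. (g t)\<^sup>2) \<le> 512 * pi * (\<Sum>k<N. (cmod (a k))\<^sup>2)"
    using 1 by simp
  moreover have "(\<integral>\<^sup>+t. ennreal ((g t)\<^sup>2) \<partial>circle) = ennreal (LINT t|circle. (g t)\<^sup>2)"
    by (rule nn_integral_eq_integral[OF intg2]) auto
  ultimately show ?thesis
    by (simp add: g_def p_def ennreal_leI)
qed

text \<open>Among finitely many radii a maximising one is chosen by successive comparison, which
  keeps the choice measurable in the angle.\<close>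

lemma radius_selection:
  fixes G :: "complex \<Rightarrow> real" and \<rho> :: "nat \<Rightarrow> real"
  assumes [measurable]: "G \<in> borel_measurable borel"
  shows "\<exists>r\<in>borel_measurable borel. \<forall>t. r t \<in> \<rho> ` {..n} \<and>
    (\<forall>i\<le>n. G (of_real (\<rho> i) * cis t) \<le> G (of_real (r t) * cis t))"
proof (induction n)
  case 0
  show ?case
    by (rule bexI[of _ "\<lambda>_. \<rho> 0"]) auto
next
  case (Suc n)
  then obtain r where [measurable]: "r \<in> borel_measurable borel"
    and r: "\<And>t. r t \<in> \<rho> ` {..n}" "\<And>t i. i \<le> n \<Longrightarrow> G (of_real (\<rho> i) * cis t) \<le> G (of_real (r t) * cis t)"
    by blast
  define r' where "r' t = (if G (of_real (\<rho> (Suc n)) * cis t) \<le> G (of_real (r t) * cis t) then r t else \<rho> (Suc n))" for t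
  have "r' \<in> borel_measurable borel"
    unfolding r'_def by measurable
  moreover have "r' t \<in> \<rho> ` {..Suc n}" for t
    using r(1)[of t] by (auto simp: r'_def)
  moreover have "G (of_real (\<rho> i) * cis t) \<le> G (of_real (r' t) * cis t)" if "i \<le> Suc n" for t i
    using that r(2)[of i t] by (auto simp: r'_def le_Suc_eq)
  ultimately show ?case
    by blast
qed

lemma square_summable_power_series:
  fixes a :: "nat \<Rightarrow> complex"
  assumes a: "summable (\<lambda>k. (cmod (a k))\<^sup>2)" and z: "cmod z < 1"
  shows "summable (\<lambda>k. cmod (a k * z ^ k))"
proof (rule summable_comparison_test')
  show "summable (\<lambda>k. (cmod (a k))\<^sup>2 + ((cmod z)\<^sup>2) ^ k)"
    using z by (intro summable_add a summable_geometric) (simp add: power_less_one_iff abs_square_less_1)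
  fix k
  have "2 * cmod (a k) * cmod z ^ k \<le> (cmod (a k))\<^sup>2 + (cmod z ^ k)\<^sup>2"
    by (rule sum_squares_bound)
  moreover have "0 \<le> cmod (a k) * cmod z ^ k"
    by simp
  moreover have "(cmod z ^ k)\<^sup>2 = ((cmod z)\<^sup>2) ^ k"
    by (simp add: power2_eq_square power_mult_distrib)
  ultimately have "cmod (a k) * cmod z ^ k \<le> (cmod (a k))\<^sup>2 + ((cmod z)\<^sup>2) ^ k"
    by linarith
  then show "norm (cmod (a k * z ^ k)) \<le> (cmod (a k))\<^sup>2 + ((cmod z)\<^sup>2) ^ k"
    by (simp add: norm_mult norm_power)
qed

text \<open>At stage \<open>n\<close> the \<open>n\<close>-th partial sum is taken at the best of
  the first \<open>n + 1\<close> radii. For fixed \<open>i\<close> this eventually dominates the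
  partial sums at \<open>\<rho> i\<close>, so the lower limit dominates the supremum, and Fatou's
  lemma carries over the bound, which is uniform in \<open>n\<close>.\<close>

theorem maximal_inequality:
  fixes a :: "nat \<Rightarrow> complex" and \<rho> :: "nat \<Rightarrow> real"
  assumes a: "summable (\<lambda>k. (cmod (a k))\<^sup>2)" and \<rho>: "\<And>i. 0 \<le> \<rho> i" "\<And>i. \<rho> i < 1"
  shows "(\<integral>\<^sup>+t. (SUP i. ennreal ((cmod (\<Sum>k. a k * (of_real (\<rho> i) * cis t) ^ k))\<^sup>2)) \<partial>circle)
    \<le> ennreal (512 * pi * (\<Sum>k. (cmod (a k))\<^sup>2))"
proof -
  define p where "p n z = (\<Sum>k<n. a k * z ^ k)" for n z
  define G where "G n z = (cmod (p n z))\<^sup>2" for n z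
  have [measurable]: "G n \<in> borel_measurable borel" for n
    unfolding G_def p_def by (intro borel_measurable_continuous_onI continuous_intros)
  have "\<forall>n. \<exists>r. r \<in> borel_measurable borel \<and> (\<forall>t. r t \<in> \<rho> ` {..n} \<and>
    (\<forall>i\<le>n. G n (of_real (\<rho> i) * cis t) \<le> G n (of_real (r t) * cis t)))"
  proof
    fix n
    have "G n \<in> borel_measurable borel"
      by measurable
    from radius_selection[OF this, of \<rho> n] show "\<exists>r. r \<in> borel_measurable borel \<and> (\<forall>t. r t \<in> \<rho> ` {..n} \<and>
        (\<forall>i\<le>n. G n (of_real (\<rho> i) * cis t) \<le> G n (of_real (r t) * cis t)))"
      by blast
  qed
  from choice[OF this] obtain r where [measurable]: "\<And>n. r n \<in> borel_measurable borel"
    and r: "\<And>n t. r n t \<in> \<rho> ` {..n}"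
      "\<And>n t i. i \<le> n \<Longrightarrow> G n (of_real (\<rho> i) * cis t) \<le> G n (of_real (r n t) * cis t)"
    by blast
  have le: "ennreal ((cmod (\<Sum>k. a k * (of_real (\<rho> i) * cis t) ^ k))\<^sup>2)
      \<le> liminf (\<lambda>n. ennreal (G n (of_real (r n t) * cis t)))" for i t
  proof -
    have "cmod (of_real (\<rho> i) * cis t) < 1"
      using \<rho> by (simp add: norm_mult)
    then have "(\<lambda>k. a k * (of_real (\<rho> i) * cis t) ^ k) sums (\<Sum>k. a k * (of_real (\<rho> i) * cis t) ^ k)"
      by (rule summable_sums[OF summable_norm_cancel[OF square_summable_power_series[OF a]]])
    then have "(\<lambda>n. p n (of_real (\<rho> i) * cis t)) \<longlonglongrightarrow> (\<Sum>k. a k * (of_real (\<rho> i) * cis t) ^ k)"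
      unfolding p_def sums_def .
    then have "(\<lambda>n. ennreal (G n (of_real (\<rho> i) * cis t)))
        \<longlonglongrightarrow> ennreal ((cmod (\<Sum>k. a k * (of_real (\<rho> i) * cis t) ^ k))\<^sup>2)"
      unfolding G_def by (intro tendsto_ennrealI tendsto_power tendsto_norm)
    then have "ennreal ((cmod (\<Sum>k. a k * (of_real (\<rho> i) * cis t) ^ k))\<^sup>2)
        = liminf (\<lambda>n. ennreal (G n (of_real (\<rho> i) * cis t)))"
      by (intro lim_imp_Liminf[symmetric]) auto
    also have "\<dots> \<le> liminf (\<lambda>n. ennreal (G n (of_real (r n t) * cis t)))"
      by (intro Liminf_mono eventually_sequentiallyI[of i] ennreal_leI r)
    finally show ?thesis .
  qed
  have step: "(\<integral>\<^sup>+t. ennreal (G n (of_real (r n t) * cis t)) \<partial>circle) \<le> ennreal (512 * pi * (\<Sum>k. (cmod (a k))\<^sup>2))" for n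
  proof -
    have "(\<integral>\<^sup>+t. ennreal (G n (of_real (r n t) * cis t)) \<partial>circle) \<le> ennreal (512 * pi * (\<Sum>k<n. (cmod (a k))\<^sup>2))"
      unfolding G_def p_def
    proof (rule maximal_polynomial)
      show "0 \<le> r n t" "r n t \<le> Max (\<rho> ` {..n})" for t
        using r(1)[of n t] \<rho> by auto
      show "Max (\<rho> ` {..n}) < 1"
        using \<rho> by (subst Max_less_iff) auto
    qed measurable
    also have "\<dots> \<le> ennreal (512 * pi * (\<Sum>k. (cmod (a k))\<^sup>2))"
      by (intro ennreal_leI mult_left_mono sum_le_suminf a) auto
    finally show ?thesis .
  qed
  have "(\<integral>\<^sup>+t. (SUP i. ennreal ((cmod (\<Sum>k. a k * (of_real (\<rho> i) * cis t) ^ k))\<^sup>2)) \<partial>circle)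
      \<le> (\<integral>\<^sup>+t. liminf (\<lambda>n. ennreal (G n (of_real (r n t) * cis t))) \<partial>circle)"
    by (intro nn_integral_mono SUP_least le)
  also have "\<dots> \<le> liminf (\<lambda>n. \<integral>\<^sup>+t. ennreal (G n (of_real (r n t) * cis t)) \<partial>circle)"
    by (rule nn_integral_liminf) measurable
  also have "\<dots> \<le> ennreal (512 * pi * (\<Sum>k. (cmod (a k))\<^sup>2))"
    by (intro Liminf_le always_eventually allI step) simp
  finally show ?thesis .
qed

subsection \<open>Existence of radial limits\<close>

lemma convergent_at_left_if_Cauchy:
  fixes h :: "real \<Rightarrow> complex"
  assumes "\<And>e. e > 0 \<Longrightarrow> \<exists>d<1. \<forall>x y. d < x \<longrightarrow> x < 1 \<longrightarrow> d < y \<longrightarrow> y < 1 \<longrightarrow> dist (h x) (h y) < e"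
  shows "\<exists>w. (h \<longlongrightarrow> w) (at_left 1)"
proof -
  define x :: "nat \<Rightarrow> real" where "x n = 1 - 1 / (real n + 2)" for n
  have x1: "x n < 1" for n
    by (simp add: x_def)
  have x_lim: "x \<longlonglongrightarrow> 1"
    unfolding x_def by real_asymp
  have ev: "\<forall>\<^sub>F n in sequentially. d < x n" if "d < 1" for d
    using order_tendstoD(1)[OF x_lim that] .
  have "Cauchy (\<lambda>n. h (x n))"
    unfolding Cauchy_def
  proof (intro allI impI)
    fix e :: real assume "e > 0"
    then obtain d where d: "d < 1" "\<And>x y. d < x \<Longrightarrow> x < 1 \<Longrightarrow> d < y \<Longrightarrow> y < 1 \<Longrightarrow> dist (h x) (h y) < e"
      using assms by blast
    obtain M where "\<And>n. n \<ge> M \<Longrightarrow> d < x n"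
      using ev[OF d(1)] by (auto simp: eventually_sequentially)
    then show "\<exists>M. \<forall>m\<ge>M. \<forall>n\<ge>M. dist (h (x m)) (h (x n)) < e"
      using d(2) x1 by blast
  qed
  then obtain w where w: "(\<lambda>n. h (x n)) \<longlonglongrightarrow> w"
    by (auto simp: Cauchy_convergent_iff convergent_def)
  have "(h \<longlongrightarrow> w) (at_left 1)"
  proof (rule tendstoI)
    fix e :: real assume "e > 0"
    then obtain d where d: "d < 1" "\<And>x y. d < x \<Longrightarrow> x < 1 \<Longrightarrow> d < y \<Longrightarrow> y < 1 \<Longrightarrow> dist (h x) (h y) < e / 2"
      using assms[of "e / 2"] by auto
    have "\<forall>\<^sub>F n in sequentially. d < x n \<and> dist (h (x n)) w < e / 2"
      using ev[OF d(1)] tendstoD[OF w, of "e / 2"] \<open>e > 0\<close> by (auto intro: eventually_conj)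
    then obtain n where n: "d < x n" "dist (h (x n)) w < e / 2"
      using eventually_happens'[OF sequentially_bot] by blast
    have "dist (h y) w < e" if "d < y" "y < 1" for y
      using d(2)[OF that n(1) x1] n(2) dist_triangle[of "h y" w "h (x n)"] by linarith
    then show "\<forall>\<^sub>F y in at_left 1. dist (h y) w < e"
      using d(1) by (auto simp: eventually_at_left[of d 1])
  qed
  then show ?thesis ..
qed

lemma power_series_holomorphic_on_disc:
  assumes a: "summable (\<lambda>k. (cmod (a k))\<^sup>2)"
  shows "(\<lambda>z. \<Sum>k. a k * z ^ k) holomorphic_on ball 0 1"
proof (rule power_series_holomorphic)
  fix w :: complex assume "w \<in> ball 0 1"
  then have "cmod w < 1"
    by simp
  then show "(\<lambda>k. a k * (w - 0) ^ k) sums (\<Sum>k. a k * w ^ k)"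
    using summable_sums[OF summable_norm_cancel[OF square_summable_power_series[OF a]]] by simp
qed

text \<open>The maximal functions of the tails have integrals tending to 0, so for almost every
  angle some tail is arbitrarily small along the whole ray. What remains is a polynomial, continuous
  up to the boundary, hence the values along the ray are Cauchy.\<close>

theorem radial_limit_exists:
  fixes a :: "nat \<Rightarrow> complex"
  assumes a: "summable (\<lambda>k. (cmod (a k))\<^sup>2)"
  shows "AE t in circle. \<exists>w. ((\<lambda>r. \<Sum>k. a k * (of_real r * cis t) ^ k) \<longlongrightarrow> w) (at_left 1)"
proof -
  \<comment> \<open>The maximal inequality handles countably many radii, so they run through the
    rationals in \<open>[0, 1)\<close>; continuity of the tails later covers all other
    radii.\<close>
  define \<rho> where "\<rho> = from_nat_into ({0..<1} \<inter> \<rat> :: real set)"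
  have "0 \<in> ({0..<1} \<inter> \<rat> :: real set)"
    by simp
  then have "countable ({0..<1} \<inter> \<rat> :: real set)" "({0..<1} \<inter> \<rat> :: real set) \<noteq> {}"
    using countable_rat by (blast intro: countable_Int2)+
  then have ran: "range \<rho> = {0..<1} \<inter> \<rat>"
    unfolding \<rho>_def by (intro range_from_nat_into)
  have \<rho>: "0 \<le> \<rho> i" "\<rho> i < 1" for i
    using ran by (auto simp: set_eq_iff)
  define b where "b N k = (if k < N then 0 else a k)" for N k
  have bs: "summable (\<lambda>k. (cmod (b N k))\<^sup>2)" for N
    by (rule summable_comparison_test'[OF a]) (auto simp: b_def)
  define S where "S N t = (SUP i. ennreal ((cmod (\<Sum>k. b N k * (of_real (\<rho> i) * cis t) ^ k))\<^sup>2))" for N t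
  have [measurable]: "S N \<in> borel_measurable circle" for N
    unfolding S_def by measurable
  have tail: "(\<Sum>k. (cmod (b N k))\<^sup>2) = (\<Sum>k. (cmod (a k))\<^sup>2) - (\<Sum>k<N. (cmod (a k))\<^sup>2)" for N
  proof -
    have "(\<Sum>k. (cmod (b N k))\<^sup>2) = (\<Sum>k. (cmod (b N (k + N)))\<^sup>2) + (\<Sum>k<N. (cmod (b N k))\<^sup>2)"
      by (rule suminf_split_initial_segment[OF bs])
    then show ?thesis
      using suminf_minus_initial_segment[OF a, of N] by (simp add: b_def)
  qed
  have "(\<lambda>N. 512 * pi * (\<Sum>k. (cmod (b N k))\<^sup>2)) \<longlonglongrightarrow> 512 * pi * ((\<Sum>k. (cmod (a k))\<^sup>2) - (\<Sum>k. (cmod (a k))\<^sup>2))"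
    unfolding tail by (intro tendsto_intros summable_LIMSEQ a)
  then have "(\<lambda>N. ennreal (512 * pi * (\<Sum>k. (cmod (b N k))\<^sup>2))) \<longlonglongrightarrow> ennreal 0"
    by (intro tendsto_ennrealI) simp
  moreover have "(\<integral>\<^sup>+t. (INF N. S N t) \<partial>circle) \<le> ennreal (512 * pi * (\<Sum>k. (cmod (b N k))\<^sup>2))" for N
  proof -
    have "(\<integral>\<^sup>+t. (INF N. S N t) \<partial>circle) \<le> (\<integral>\<^sup>+t. S N t \<partial>circle)"
      by (intro nn_integral_mono INF_lower) auto
    also have "\<dots> \<le> ennreal (512 * pi * (\<Sum>k. (cmod (b N k))\<^sup>2))"
      unfolding S_def by (rule maximal_inequality[OF bs \<rho>])
    finally show ?thesis .
  qed
  ultimately have "(\<integral>\<^sup>+t. (INF N. S N t) \<partial>circle) \<le> ennreal 0"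
    by (intro LIMSEQ_le_const) auto
  then have "AE t in circle. (INF N. S N t) = 0"
    by (subst nn_integral_0_iff_AE[symmetric]) auto
  then show ?thesis
  proof eventually_elim
    case (elim t)
    define h where "h N r = (\<Sum>k. b N k * (of_real r * cis t) ^ k)" for N and r :: real
    have h_cont: "continuous_on {0..<1} (h N)" for N
    proof -
      have "continuous_on (ball 0 1) (\<lambda>z. \<Sum>k. b N k * z ^ k)"
        by (intro holomorphic_on_imp_continuous_on power_series_holomorphic_on_disc bs)
      then show ?thesis
        unfolding h_def
        by (rule continuous_on_compose2) (auto intro!: continuous_intros simp: norm_mult)
    qed
    have small: "\<exists>N. \<forall>r. 0 \<le> r \<longrightarrow> r < 1 \<longrightarrow> cmod (h N r) \<le> e" if "e > 0" for e
    proof -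
      have "(INF N. S N t) < ennreal (e\<^sup>2)"
        using that elim by simp
      then obtain N where N: "S N t < ennreal (e\<^sup>2)"
        unfolding INF_less_iff by blast
      have rat: "cmod (h N q) \<le> e" if "q \<in> {0..<1} \<inter> \<rat>" for q
      proof -
        obtain i where i: "q = \<rho> i"
          using \<open>q \<in> _\<close> ran by blast
        have "ennreal ((cmod (h N q))\<^sup>2) \<le> S N t"
          unfolding S_def h_def i by (rule SUP_upper) simp
        then have "ennreal ((cmod (h N q))\<^sup>2) < ennreal (e\<^sup>2)"
          using N by (rule le_less_trans)
        then have "(cmod (h N q))\<^sup>2 < e\<^sup>2"
          by (simp add: ennreal_less_iff)
        then show ?thesis
          using \<open>e > 0\<close> by (meson less_imp_le power2_less_imp_less)
      qed
      have "cmod (h N r) \<le> e" if r: "0 \<le> r" "r < 1" for r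
      proof -
        have "\<exists>q\<in>\<rat>. r < q \<and> q < r + (1 - r) / (real n + 1)" for n
          using r by (intro Rats_dense_in_real) simp
        then obtain q where q: "\<And>n. q n \<in> \<rat>" "\<And>n. r < q n" "\<And>n. q n < r + (1 - r) / (real n + 1)"
          by metis
        have q1: "q n < 1" for n
        proof -
          have "(1 - r) / (real n + 1) \<le> (1 - r) / 1"
            using r by (intro divide_left_mono) auto
          then show ?thesis
            using q(3)[of n] by simp
        qed
        have q0: "0 \<le> q n" for n
          using q(2)[of n] r by linarith
        have "(\<lambda>n. r + (1 - r) / (real n + 1)) \<longlonglongrightarrow> r + 0"
          by (intro tendsto_intros) real_asymp
        then have q_lim: "q \<longlonglongrightarrow> r"
          by (intro tendsto_sandwich[of "\<lambda>_. r" q _ "\<lambda>n. r + (1 - r) / (real n + 1)"])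
            (auto intro!: always_eventually less_imp_le q)
        have "(\<lambda>n. cmod (h N (q n))) \<longlonglongrightarrow> cmod (h N r)"
          using q0 q1 r by (intro tendsto_norm continuous_on_tendsto_compose[OF h_cont q_lim]) auto
        then show ?thesis
        proof (rule LIMSEQ_le_const2)
          show "\<exists>M. \<forall>n\<ge>M. cmod (h N (q n)) \<le> e"
            using q q0 q1 by (intro exI[of _ 0] allI impI rat) auto
        qed
      qed
      then show ?thesis
        by blast
    qed
    show ?case
    proof (rule convergent_at_left_if_Cauchy)
      fix e :: real assume "e > 0"
      then obtain N where N: "\<And>r. 0 \<le> r \<Longrightarrow> r < 1 \<Longrightarrow> cmod (h N r) \<le> e / 4"
        using small[of "e / 4"] by auto
      \<comment> \<open>The budget \<open>e / 4\<close> serves two values of the polynomial compared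
        with its value at radius 1, and two values of the tail.\<close>
      define p where "p r = (\<Sum>k<N. a k * (of_real r * cis t) ^ k)" for r :: real
      have split: "(\<Sum>k. a k * (of_real r * cis t) ^ k) = p r + h N r" if "0 \<le> r" "r < 1" for r
      proof -
        have z: "cmod (of_real r * cis t) < 1"
          using that by (simp add: norm_mult)
        have "(\<Sum>k. a k * (of_real r * cis t) ^ k)
            = (\<Sum>k. (if k < N then a k * (of_real r * cis t) ^ k else 0) + b N k * (of_real r * cis t) ^ k)"
          by (intro suminf_cong) (auto simp: b_def)
        also have "\<dots> = (\<Sum>k. if k < N then a k * (of_real r * cis t) ^ k else 0) + h N r"
          unfolding h_def
          by (intro suminf_add[symmetric] summable_norm_cancel[OF square_summable_power_series[OF bs z]]
              summable_finite[of "{..<N}"]) auto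
        also have "(\<Sum>k. if k < N then a k * (of_real r * cis t) ^ k else 0) = p r"
          unfolding p_def by (subst suminf_finite[of "{..<N}"]) auto
        finally show ?thesis .
      qed
      have "continuous (at 1) p"
        unfolding p_def by (intro continuous_intros)
      then obtain d where d: "d > 0" "\<And>x. dist x 1 < d \<Longrightarrow> dist (p x) (p 1) < e / 4"
        unfolding continuous_at_eps_delta using \<open>e > 0\<close> by (metis zero_less_divide_iff zero_less_numeral dist_commute)
      show "\<exists>d<1. \<forall>x y. d < x \<longrightarrow> x < 1 \<longrightarrow> d < y \<longrightarrow> y < 1 \<longrightarrow>
          dist (\<Sum>k. a k * (of_real x * cis t) ^ k) (\<Sum>k. a k * (of_real y * cis t) ^ k) < e"
      proof (intro exI[of _ "max 0 (1 - d)"] conjI allI impI)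
        show "max 0 (1 - d) < 1"
          using d(1) by simp
        fix x y assume xy: "max 0 (1 - d) < x" "x < 1" "max 0 (1 - d) < y" "y < 1"
        have "dist (p x) (p 1) < e / 4" "dist (p y) (p 1) < e / 4"
          using xy d(2)[of x] d(2)[of y] by (auto simp: dist_real_def)
        moreover have "cmod (h N x) \<le> e / 4" "cmod (h N y) \<le> e / 4"
          using xy N[of x] N[of y] by auto
        moreover have "dist (p x + h N x) (p y + h N y) \<le> dist (p x) (p 1) + dist (p y) (p 1) + cmod (h N x) + cmod (h N y)"
        proof -
          have eq: "(p x + h N x) - (p y + h N y) = (p x - p 1) - (p y - p 1) + h N x - h N y"
            by simp
          have "cmod ((p x - p 1) - (p y - p 1) + h N x - h N y)
              \<le> cmod ((p x - p 1) - (p y - p 1) + h N x) + cmod (h N y)"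
            by (rule norm_triangle_ineq4)
          moreover have "cmod ((p x - p 1) - (p y - p 1) + h N x) \<le> cmod ((p x - p 1) - (p y - p 1)) + cmod (h N x)"
            by (rule norm_triangle_ineq)
          moreover have "cmod ((p x - p 1) - (p y - p 1)) \<le> cmod (p x - p 1) + cmod (p y - p 1)"
            by (rule norm_triangle_ineq4)
          ultimately show ?thesis
            unfolding dist_norm eq by linarith
        qed
        ultimately show "dist (\<Sum>k. a k * (of_real x * cis t) ^ k) (\<Sum>k. a k * (of_real y * cis t) ^ k) < e"
          using xy by (simp add: split)
      qed
    qed
  qed
qed

section \<open>The Hardy space as a sequence space\<close>

definition h2fun :: "nat l2 \<Rightarrow> complex \<Rightarrow> complex"
  where "h2fun x z = (if z \<in> ball 0 1 then \<Sum>k. coord x k * z ^ k else 0)"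

definition h2seq :: "(complex \<Rightarrow> complex) \<Rightarrow> nat l2"
  where "h2seq f = Abs_l2 (taylor f)"

lemma summable_coord_square: "summable (\<lambda>k. (cmod (coord (x :: nat l2) k))\<^sup>2)"
  using coord_square_sums sums_summable by blast

lemma square_summable_nat_iff:
  fixes a :: "nat \<Rightarrow> complex"
  shows "(\<lambda>k. (cmod (a k))\<^sup>2) summable_on UNIV \<longleftrightarrow> summable (\<lambda>k. (cmod (a k))\<^sup>2)"
proof
  assume "(\<lambda>k. (cmod (a k))\<^sup>2) summable_on UNIV"
  then show "summable (\<lambda>k. (cmod (a k))\<^sup>2)"
    using has_sum_imp_sums has_sum_infsum sums_summable by blast
next
  assume "summable (\<lambda>k. (cmod (a k))\<^sup>2)"
  then show "(\<lambda>k. (cmod (a k))\<^sup>2) summable_on UNIV"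
    by (intro norm_summable_imp_summable_on) simp
qed

lemma coord_h2seq: "summable (\<lambda>k. (cmod (taylor f k))\<^sup>2) \<Longrightarrow> coord (h2seq f) = taylor f"
  by (simp add: h2seq_def Abs_l2_inverse square_summable_nat_iff)

lemma taylor_has_fps_expansion:
  assumes "f has_fps_expansion F"
  shows "taylor f k = fps_nth F k"
  using fps_nth_fps_expansion[OF assms] by (simp add: taylor_def)

lemma taylor_sums:
  assumes "f holomorphic_on ball 0 1" "z \<in> ball 0 1"
  shows "(\<lambda>k. taylor f k * z ^ k) sums f z"
  using holomorphic_power_series[OF assms] by (simp add: taylor_def)

lemma has_fps_expansion_taylor:
  assumes "f holomorphic_on ball 0 1"
  shows "f has_fps_expansion Abs_fps (taylor f)"
proof -
  have "f has_fps_expansion fps_expansion f 0"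
    using assms by (intro has_fps_expansion_fps_expansion[of "ball 0 1"]) auto
  then show ?thesis
    by (simp add: fps_expansion_def taylor_def[abs_def])
qed

lemma taylor_power_series:
  assumes "\<And>z. z \<in> ball 0 1 \<Longrightarrow> (\<lambda>k. a k * z ^ k) sums f z"
  shows "taylor f = a"
proof -
  have "f has_fps_expansion Abs_fps a"
    unfolding has_fps_expansion_def
  proof
    have "conv_radius a \<ge> norm (1 / 2 :: complex)"
      using assms[of "1 / 2"] by (intro conv_radius_geI) (auto simp: sums_iff)
    then show "fps_conv_radius (Abs_fps a) > 0"
      by (auto simp: fps_conv_radius_def intro: less_le_trans[of 0 "ereal (1/2)"])
    have "\<forall>\<^sub>F z in nhds 0. z \<in> ball 0 (1 :: real)"
      by (intro eventually_nhds_in_open) auto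
    then show "\<forall>\<^sub>F z in nhds 0. eval_fps (Abs_fps a) z = f z"
      by eventually_elim (use assms in \<open>auto simp: eval_fps_def sums_iff\<close>)
  qed
  then show ?thesis
    by (auto simp: taylor_has_fps_expansion)
qed

lemma taylor_mult:
  assumes "f holomorphic_on ball 0 1" "g holomorphic_on ball 0 1"
  shows "taylor (f * g) n = (\<Sum>k\<le>n. taylor f k * taylor g (n - k))"
proof -
  have "(\<lambda>z. f z * g z) has_fps_expansion Abs_fps (taylor f) * Abs_fps (taylor g)"
    by (intro has_fps_expansion_mult has_fps_expansion_taylor assms)
  then show ?thesis
    by (simp add: taylor_has_fps_expansion fps_mult_nth times_fun_def atMost_atLeast0)
qed

lemma h2fun_sums: "z \<in> ball 0 1 \<Longrightarrow> (\<lambda>k. coord x k * z ^ k) sums h2fun x z"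
  using summable_sums[OF summable_norm_cancel[OF square_summable_power_series[OF summable_coord_square]]]
  by (simp add: h2fun_def)

lemma taylor_h2fun: "taylor (h2fun x) = coord x"
  by (rule taylor_power_series) (rule h2fun_sums)

lemma h2fun_holomorphic: "h2fun x holomorphic_on ball 0 1"
  using power_series_holomorphic_on_disc[OF summable_coord_square[of x]]
  by (rule holomorphic_transform) (simp add: h2fun_def)

lemma h2fun_in_hardy2 [simp]: "h2fun x \<in> hardy2"
  by (auto simp: hardy2_def h2fun_holomorphic taylor_h2fun summable_coord_square h2fun_def)

lemma h2seq_h2fun [simp]: "h2seq (h2fun x) = x"
  by (simp add: h2seq_def taylor_h2fun coord_inverse)

lemma hardy2D:
  assumes "f \<in> hardy2"
  shows "f holomorphic_on ball 0 1" "summable (\<lambda>k. (cmod (taylor f k))\<^sup>2)" "z \<notin> ball 0 1 \<Longrightarrow> f z = 0"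
    "coord (h2seq f) = taylor f"
  using assms by (auto simp: hardy2_def coord_h2seq)

lemma h2fun_h2seq [simp]: "f \<in> hardy2 \<Longrightarrow> h2fun (h2seq f) = f"
proof
  fix z assume f: "f \<in> hardy2"
  show "h2fun (h2seq f) z = f z"
  proof (cases "z \<in> ball 0 1")
    case True
    then show ?thesis
      using sums_unique2[OF h2fun_sums[OF True, of "h2seq f"]] taylor_sums[OF hardy2D(1)[OF f] True]
      by (simp add: hardy2D(4)[OF f])
  qed (simp add: h2fun_def hardy2D(3)[OF f])
qed

lemma hardy2_eq_range: "hardy2 = range h2fun"
  by (auto, metis h2fun_h2seq rangeI)

lemma h2fun_inject: "h2fun x = h2fun y \<longleftrightarrow> x = y"
  by (metis h2seq_h2fun)

lemma hardy2_inner_h2fun: "hardy2_inner (h2fun x) (h2fun y) = cip x y"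
  unfolding hardy2_inner_def taylor_h2fun using cip_sums sums_unique by metis

lemma h2fun_diff: "h2fun (x - y) = h2fun x - h2fun y"
proof
  fix z show "h2fun (x - y) z = (h2fun x - h2fun y) z"
  proof (cases "z \<in> ball 0 1")
    case True
    have "(\<lambda>k. coord x k * z ^ k - coord y k * z ^ k) sums (h2fun x z - h2fun y z)"
      by (intro sums_diff h2fun_sums True)
    then show ?thesis
      using sums_unique2[OF h2fun_sums[OF True, of "x - y"]] by (simp add: left_diff_distrib)
  qed (simp add: h2fun_def)
qed

lemma shift_h2fun: "shift (h2fun x) = h2fun (fshift x)"
proof
  fix z
  show "shift (h2fun x) z = h2fun (fshift x) z"
  proof (cases "z \<in> ball 0 1")
    case True
    have "(\<lambda>k. coord (fshift x) (Suc k) * z ^ Suc k) sums (z * h2fun x z)"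
      using sums_mult[OF h2fun_sums[OF True, of x], of z] by (simp add: coord_fshift mult_ac)
    then have "(\<lambda>k. coord (fshift x) k * z ^ k) sums (z * h2fun x z)"
      by (subst (asm) sums_Suc_iff) (simp add: coord_fshift)
    then show ?thesis
      using sums_unique2[OF h2fun_sums[OF True, of "fshift x"]] by (simp add: shift_def)
  qed (simp add: shift_def h2fun_def)
qed

text \<open>\<open>f\<close> need not lie in \<open>hardy2\<close>: an inner function may take any
  values off the disc, where the factor \<open>h2fun y\<close> vanishes.\<close>

lemma mult_h2fun:
  assumes f: "f holomorphic_on ball 0 1" "summable (\<lambda>k. (cmod (taylor f k))\<^sup>2)" and x: "inner_seq (h2seq f)"
  shows "f * h2fun y = h2fun (Mul (h2seq f) y)"
proof
  fix z
  show "(f * h2fun y) z = h2fun (Mul (h2seq f) y) z"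
  proof (cases "z \<in> ball 0 1")
    case True
    have "taylor (f * h2fun y) = coord (Mul (h2seq f) y)"
      by (rule ext) (simp add: taylor_mult f(1) h2fun_holomorphic taylor_h2fun coord_Mul[OF x] coord_h2seq[OF f(2)])
    moreover have "(\<lambda>z. f z * h2fun y z) holomorphic_on ball 0 1"
      by (intro holomorphic_intros f h2fun_holomorphic)
    ultimately have "(\<lambda>k. coord (Mul (h2seq f) y) k * z ^ k) sums (f * h2fun y) z"
      using taylor_sums[of "f * h2fun y", OF _ True] by (simp add: times_fun_def)
    then show ?thesis
      using sums_unique2 h2fun_sums[OF True] by blast
  qed (simp add: h2fun_def)
qed

section \<open>Inner functions and inner sequences\<close>

lemma AE_lebesgue_circle: "(AE t in lebesgue_on {0..2 * pi}. P t) \<longleftrightarrow> (AE t in circle. P t)"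
proof -
  have "(AE t in lebesgue_on {0..2 * pi}. P t) \<longleftrightarrow> (AE t in lebesgue. t \<in> {0..2 * pi} \<longrightarrow> P t)"
    by (rule AE_restrict_space_iff) simp
  also have "\<dots> \<longleftrightarrow> (AE t in lborel. t \<in> {0..2 * pi} \<longrightarrow> P t)"
    by (rule AE_completion_iff)
  also have "\<dots> \<longleftrightarrow> (AE t in circle. P t)"
    unfolding circle_def by (rule AE_restrict_space_iff[symmetric]) simp
  finally show ?thesis .
qed

section \<open>Integrals over circles inside the disc\<close>

definition radius :: "nat \<Rightarrow> real"
  where "radius n = 1 - 1 / (real n + 2)"

lemma radius_bounds: "0 < radius n" "0 \<le> radius n" "radius n < 1"
  by (auto simp: radius_def)

lemma norm_radius_cis: "cmod (of_real (radius n) * cis t) < 1"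
  using radius_bounds[of n] by (simp add: norm_mult)

lemma radius_tendsto: "radius \<longlonglongrightarrow> 1"
  unfolding radius_def by real_asymp

lemma filterlim_radius: "filterlim radius (at_left 1) sequentially"
  by (rule tendsto_imp_filterlim_at_left[OF radius_tendsto]) (simp add: radius_bounds)

text \<open>Convergence at the next larger radius forces absolute convergence at the present
  one.\<close>

lemma summable_radius:
  assumes "\<And>z. z \<in> ball 0 1 \<Longrightarrow> (\<lambda>k. a k * z ^ k) sums f z"
  shows "summable (\<lambda>k. cmod (a k * of_real (radius n) ^ k))"
proof -
  have "summable (\<lambda>k. a k * of_real (radius (Suc n)) ^ k)"
    using assms[of "of_real (radius (Suc n))"] radius_bounds[of "Suc n"] by (auto simp: sums_iff)
  moreover have "radius n < radius (Suc n)"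
    by (simp add: radius_def field_simps)
  ultimately show ?thesis
    using powser_insidea[of a "of_real (radius (Suc n))" "of_real (radius n) :: complex"] radius_bounds[of n] radius_bounds[of "Suc n"] by simp
qed

lemma parseval_radius:
  assumes "\<And>z. z \<in> ball 0 1 \<Longrightarrow> (\<lambda>k. a k * z ^ k) sums f z"
  shows "(LINT t|circle. f (of_real (radius n) * cis t) * cnj (f (of_real (radius n) * cis t)) * cis (of_nat j * t))
      = 2 * of_real pi * (\<Sum>k. a k * cnj (a (k + j)) * of_real (radius n) ^ (2 * k + j))"
    and "(LINT t|circle. (cmod (f (of_real (radius n) * cis t)))\<^sup>2)
      = 2 * pi * (\<Sum>k. (cmod (a k))\<^sup>2 * radius n ^ (2 * k))"
    and "(\<lambda>t. f (of_real (radius n) * cis t)) \<in> borel_measurable circle"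
proof -
  define b where "b k = a k * of_real (radius n) ^ k" for k
  have b: "summable (\<lambda>k. cmod (b k))"
    unfolding b_def by (rule summable_radius[OF assms])
  have f: "f (of_real (radius n) * cis t) = (\<Sum>k. b k * cis (of_nat k * t))" for t
  proof -
    have "of_real (radius n) * cis t \<in> ball 0 1"
      by (simp add: norm_radius_cis)
    from assms[OF this] show ?thesis
      by (simp add: b_def sums_iff power_mult_distrib Complex.DeMoivre mult_ac)
  qed
  have "b k * cnj (b (k + j)) = a k * cnj (a (k + j)) * of_real (radius n) ^ (2 * k + j)" for k j
    by (simp add: b_def power_add mult_2)
  then show "(LINT t|circle. f (of_real (radius n) * cis t) * cnj (f (of_real (radius n) * cis t)) * cis (of_nat j * t))
      = 2 * of_real pi * (\<Sum>k. a k * cnj (a (k + j)) * of_real (radius n) ^ (2 * k + j))"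
    using parseval_shifted[OF b, of j] by (simp add: f)
  have "(cmod (b k))\<^sup>2 = (cmod (a k))\<^sup>2 * radius n ^ (2 * k)" for k
    using radius_bounds(2)[of n] by (simp add: b_def norm_mult norm_power power_mult_distrib power_mult[symmetric] mult.commute)
  then show "(LINT t|circle. (cmod (f (of_real (radius n) * cis t)))\<^sup>2)
      = 2 * pi * (\<Sum>k. (cmod (a k))\<^sup>2 * radius n ^ (2 * k))"
    using parseval[OF b] by (simp add: f)
  show "(\<lambda>t. f (of_real (radius n) * cis t)) \<in> borel_measurable circle"
    unfolding f by measurable
qed

lemma abel_limit_radius:
  fixes c :: "nat \<Rightarrow> complex"
  assumes "summable (\<lambda>k. cmod (c k))"
  shows "(\<lambda>n. \<Sum>k. c k * of_real (radius n) ^ (2 * k + j)) \<longlonglongrightarrow> (\<Sum>k. c k)"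
proof -
  have "((\<lambda>n. \<Sum>k. c k * of_real (radius n) ^ (2 * k + j)) \<longlongrightarrow> (\<Sum>k. c k)) sequentially"
  proof (rule tannerys_theorem[THEN conjunct2, THEN conjunct2])
    show "(\<lambda>n. c k * of_real (radius n) ^ (2 * k + j)) \<longlonglongrightarrow> c k" for k
    proof -
      have "(\<lambda>n. c k * of_real (radius n) ^ (2 * k + j)) \<longlonglongrightarrow> c k * of_real 1 ^ (2 * k + j)"
        by (intro tendsto_intros radius_tendsto)
      then show ?thesis
        by simp
    qed
    show "\<forall>\<^sub>F (k, n) in at_top \<times>\<^sub>F sequentially. norm (c k * of_real (radius n) ^ (2 * k + j)) \<le> cmod (c k)"
      by (intro always_eventually) (auto simp: norm_mult norm_power radius_bounds less_imp_le[OF radius_bounds(3)] intro!: mult_left_le power_le_one)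
  qed (use assms in auto)
  then show ?thesis .
qed

lemma coord_bshift_pow: "coord ((bshift ^^ j) x) k = coord x (k + j)"
  by (induction j arbitrary: k) (auto simp: coord_pull)

lemma autocorrelation_sums: "(\<lambda>k. coord x k * cnj (coord x (k + j))) sums cip ((fshift ^^ j) x) x"
  using cip_sums[of x "(bshift ^^ j) x"] by (simp add: coord_bshift_pow cip_fshift_pow)

lemma autocorrelation_summable: "summable (\<lambda>k. cmod (coord (x :: nat l2) k * cnj (coord x (k + j))))"
proof (rule summable_comparison_test')
  show "summable (\<lambda>k. (cmod (coord x k))\<^sup>2 + (cmod (coord x (k + j)))\<^sup>2)"
    by (intro summable_add summable_ignore_initial_segment[of "\<lambda>k. (cmod (coord x k))\<^sup>2"] summable_coord_square)
  fix k
  have "2 * cmod (coord x k) * cmod (coord x (k + j)) \<le> (cmod (coord x k))\<^sup>2 + (cmod (coord x (k + j)))\<^sup>2"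
    by (rule sum_squares_bound)
  moreover have "0 \<le> cmod (coord x k) * cmod (coord x (k + j))"
    by simp
  ultimately have "cmod (coord x k) * cmod (coord x (k + j)) \<le> (cmod (coord x k))\<^sup>2 + (cmod (coord x (k + j)))\<^sup>2"
    by linarith
  then show "norm (cmod (coord x k * cnj (coord x (k + j)))) \<le> (cmod (coord x k))\<^sup>2 + (cmod (coord x (k + j)))\<^sup>2"
    by (simp add: norm_mult)
qed

text \<open>Parseval inside the disc expresses the integral of
  \<open>\<bar>\<theta>\<bar>\<^sup>2 cis (j t)\<close> by Taylor coefficients. As the radius tends
  to 1, Abel summation turns this into the \<open>j\<close>-th autocorrelation, while dominated
  convergence turns it into the integral of \<open>cis (j t)\<close>.\<close>

lemma inner_functionD:
  assumes "inner_function \<theta>"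
  shows "\<theta> holomorphic_on ball 0 1" "summable (\<lambda>k. (cmod (taylor \<theta> k))\<^sup>2)" "inner_seq (h2seq \<theta>)"
proof -
  show hol: "\<theta> holomorphic_on ball 0 1"
    using assms by (simp add: inner_function_def Hinf_def)
  obtain B where "\<forall>w\<in>\<theta> ` ball 0 1. cmod w \<le> B"
    using assms unfolding inner_function_def Hinf_def bounded_iff by blast
  then have B: "cmod (\<theta> z) \<le> B" if "z \<in> ball 0 1" for z
    using that by blast
  have B0: "0 \<le> B"
    using B[of 0] norm_ge_zero[of "\<theta> 0"] by (simp del: norm_ge_zero)
  note P = parseval_radius[OF taylor_sums[OF hol]]
  have [measurable]: "(\<lambda>t. \<theta> (of_real (radius n) * cis t)) \<in> borel_measurable circle" for n
    by (rule P(3)) simp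
  have Bn: "cmod (\<theta> (of_real (radius n) * cis t)) \<le> B" for n t
    by (intro B) (simp add: norm_radius_cis)
  \<comment> \<open>On each circle Parseval bounds the weighted sum by \<open>B\<^sup>2\<close>.
    Truncating at \<open>N\<close> first makes the limit of the radii a limit of finite
    sums.\<close>
  have partial: "(\<Sum>k<N. (cmod (taylor \<theta> k))\<^sup>2) \<le> B\<^sup>2" for N
  proof -
    have "(\<Sum>k<N. (cmod (taylor \<theta> k))\<^sup>2 * radius n ^ (2 * k)) \<le> B\<^sup>2" for n
    proof -
      have s: "summable (\<lambda>k. (cmod (taylor \<theta> k))\<^sup>2 * radius n ^ (2 * k))"
      proof -
        have b: "summable (\<lambda>k. cmod (taylor \<theta> k * of_real (radius n) ^ k))"
          by (rule summable_radius) (rule taylor_sums[OF hol])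
        define c where "c = (\<Sum>k. cmod (taylor \<theta> k * of_real (radius n) ^ k))"
        show ?thesis
        proof (rule summable_comparison_test'[OF summable_mult2[OF b, of c]])
          fix k
          have "cmod (taylor \<theta> k * of_real (radius n) ^ k) \<le> c"
            using sum_le_suminf[OF b, of "{k}"] by (simp add: c_def)
          moreover have "(cmod (taylor \<theta> k))\<^sup>2 * radius n ^ (2 * k) = (cmod (taylor \<theta> k * of_real (radius n) ^ k))\<^sup>2"
            using radius_bounds(2)[of n] by (simp add: norm_mult norm_power power_mult_distrib power_mult[symmetric] mult.commute)
          ultimately show "norm ((cmod (taylor \<theta> k))\<^sup>2 * radius n ^ (2 * k)) \<le> cmod (taylor \<theta> k * of_real (radius n) ^ k) * c"
            by (simp add: power2_eq_square mult_left_mono del: norm_mult)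
        qed
      qed
      have "2 * pi * (\<Sum>k<N. (cmod (taylor \<theta> k))\<^sup>2 * radius n ^ (2 * k)) \<le> 2 * pi * (\<Sum>k. (cmod (taylor \<theta> k))\<^sup>2 * radius n ^ (2 * k))"
        using radius_bounds(2)[of n] by (intro mult_left_mono sum_le_suminf s) auto
      also have "\<dots> = (LINT t|circle. (cmod (\<theta> (of_real (radius n) * cis t)))\<^sup>2)"
        by (rule P(2)[symmetric]) simp
      also have "\<dots> \<le> (LINT t|circle. B\<^sup>2)"
      proof (rule integral_mono)
        show "integrable circle (\<lambda>t. (cmod (\<theta> (of_real (radius n) * cis t)))\<^sup>2)"
          by (rule integrable_circle[of _ "B\<^sup>2"]) (use Bn in \<open>auto intro!: power_mono\<close>)
      qed (auto intro!: power_mono Bn)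
      finally show ?thesis
        by simp
    qed
    moreover have "(\<lambda>n. \<Sum>k<N. (cmod (taylor \<theta> k))\<^sup>2 * radius n ^ (2 * k)) \<longlonglongrightarrow> (\<Sum>k<N. (cmod (taylor \<theta> k))\<^sup>2 * 1 ^ (2 * k))"
      by (intro tendsto_intros radius_tendsto)
    ultimately have "(\<Sum>k<N. (cmod (taylor \<theta> k))\<^sup>2 * 1 ^ (2 * k)) \<le> B\<^sup>2"
      by (intro LIMSEQ_le_const2) auto
    then show ?thesis
      by simp
  qed
  show s: "summable (\<lambda>k. (cmod (taylor \<theta> k))\<^sup>2)"
    by (rule summableI_nonneg_bounded[of _ "B\<^sup>2"]) (use partial in auto)
  show "inner_seq (h2seq \<theta>)"
    unfolding inner_seq_def
  proof
    fix j
    have "(\<lambda>n. \<Sum>k. taylor \<theta> k * cnj (taylor \<theta> (k + j)) * of_real (radius n) ^ (2 * k + j))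
        \<longlonglongrightarrow> (\<Sum>k. taylor \<theta> k * cnj (taylor \<theta> (k + j)))"
      using autocorrelation_summable[of "h2seq \<theta>" j] by (intro abel_limit_radius) (simp add: coord_h2seq[OF s])
    also have "(\<Sum>k. taylor \<theta> k * cnj (taylor \<theta> (k + j))) = cip ((fshift ^^ j) (h2seq \<theta>)) (h2seq \<theta>)"
      using autocorrelation_sums[of "h2seq \<theta>" j] by (simp add: coord_h2seq[OF s] sums_iff)
    finally have A: "(\<lambda>n. 2 * of_real pi * (\<Sum>k. taylor \<theta> k * cnj (taylor \<theta> (k + j)) * of_real (radius n) ^ (2 * k + j)))
        \<longlonglongrightarrow> 2 * of_real pi * cip ((fshift ^^ j) (h2seq \<theta>)) (h2seq \<theta>)"
      by (rule tendsto_mult_left)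
    have B': "(\<lambda>n. LINT t|circle. \<theta> (of_real (radius n) * cis t) * cnj (\<theta> (of_real (radius n) * cis t)) * cis (of_nat j * t))
        \<longlonglongrightarrow> (LINT t|circle. cis (of_nat j * t))"
    proof (rule Bochner_Integration.integral_dominated_convergence[where w = "\<lambda>_. B * B"])
      have "AE t in circle. \<exists>w. cmod w = 1 \<and> ((\<lambda>r. \<theta> (complex_of_real r * cis t)) \<longlongrightarrow> w) (at_left 1)"
        using assms by (simp add: inner_function_def AE_lebesgue_circle)
      then show "AE t in circle. (\<lambda>n. \<theta> (of_real (radius n) * cis t) * cnj (\<theta> (of_real (radius n) * cis t)) * cis (of_nat j * t))
          \<longlonglongrightarrow> cis (of_nat j * t)"
      proof eventually_elim
        case (elim t)
        then obtain w where w: "cmod w = 1" "((\<lambda>r. \<theta> (complex_of_real r * cis t)) \<longlongrightarrow> w) (at_left 1)"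
          by blast
        have "(\<lambda>n. \<theta> (of_real (radius n) * cis t)) \<longlonglongrightarrow> w"
          by (rule filterlim_compose[OF w(2) filterlim_radius])
        then have "(\<lambda>n. \<theta> (of_real (radius n) * cis t) * cnj (\<theta> (of_real (radius n) * cis t)) * cis (of_nat j * t))
            \<longlonglongrightarrow> w * cnj w * cis (of_nat j * t)"
          by (intro tendsto_intros)
        moreover have "w * cnj w = 1"
          using complex_norm_square[of w] w(1) by simp
        ultimately show ?case
          by (simp only: mult_1_left)
      qed
      show "AE t in circle. norm (\<theta> (of_real (radius n) * cis t) * cnj (\<theta> (of_real (radius n) * cis t)) * cis (of_nat j * t)) \<le> B * B" for n
        by (intro AE_I2) (auto simp: norm_mult intro!: mult_mono Bn B0)
    qed measurable
    have "(LINT t|circle. \<theta> (of_real (radius n) * cis t) * cnj (\<theta> (of_real (radius n) * cis t)) * cis (of_nat j * t))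
        = 2 * of_real pi * (\<Sum>k. taylor \<theta> k * cnj (taylor \<theta> (k + j)) * of_real (radius n) ^ (2 * k + j))" for n
      by (rule P(1)) simp
    from LIMSEQ_unique[OF A B'[unfolded this]]
    have "2 * of_real pi * cip ((fshift ^^ j) (h2seq \<theta>)) (h2seq \<theta>) = (LINT t|circle. cis (of_nat j * t))" .
    then show "cip ((fshift ^^ j) (h2seq \<theta>)) (h2seq \<theta>) = (if j = 0 then 1 else 0)"
      using integral_circle_cis[of "int j"] by (auto split: if_splits)
  qed
qed

section \<open>From inner sequences back to inner functions\<close>

lemma norm_h2fun_le:
  assumes "z \<in> ball 0 1"
  shows "cmod (h2fun x z) \<le> norm x / (1 - cmod z)"
proof -
  have "cmod z < 1"
    using assms by simp
  have "cmod (\<Sum>k. coord x k * z ^ k) \<le> (\<Sum>k. norm x * cmod z ^ k)"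
    by (rule norm_suminf_le)
      (auto simp: norm_mult norm_power \<open>cmod z < 1\<close> intro!: mult_right_mono norm_coord_le summable_mult summable_geometric)
  also have "\<dots> = norm x / (1 - cmod z)"
    using \<open>cmod z < 1\<close> by (simp add: suminf_mult suminf_geometric)
  finally show ?thesis
    using assms by (simp add: h2fun_def)
qed

lemma h2fun_Mul:
  assumes "inner_seq x"
  shows "h2fun (Mul x y) = h2fun x * h2fun y"
  using mult_h2fun[OF h2fun_holomorphic[of x], of y] assms by (simp add: taylor_h2fun summable_coord_square)

lemma norm_l2_unit: "norm (l2_unit a) = 1"
  by (simp add: norm_l2_def inner_l2_def coord_l2_unit)

text \<open>All powers of \<open>h2fun x\<close> lie in the unit ball of \<open>H\<^sup>2\<close>, where point evaluations are bounded.\<close>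

lemma norm_h2fun_inner_seq_le_1:
  assumes x: "inner_seq x" and z: "z \<in> ball 0 1"
  shows "cmod (h2fun x z) \<le> 1"
proof (rule ccontr)
  assume "\<not> cmod (h2fun x z) \<le> 1"
  then obtain m where m: "1 / (1 - cmod z) < cmod (h2fun x z) ^ m"
    using real_arch_pow[of "cmod (h2fun x z)"] by auto
  have "h2fun (((Mul x) ^^ m) (l2_unit 0)) z = h2fun x z ^ m" for m
  proof (induction m)
    case 0
    have "(\<lambda>k. coord (l2_unit 0) k * z ^ k) = (\<lambda>k. if k = 0 then 1 else 0)"
      by (auto simp: coord_l2_unit)
    then show ?case
      using sums_unique2[OF h2fun_sums[OF z, of "l2_unit 0"]] sums_single[of 0 "\<lambda>_. 1 :: complex"] by simp
  qed (simp add: h2fun_Mul[OF x])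
  moreover have "norm (((Mul x) ^^ m) (l2_unit 0)) = 1" for m
    by (induction m) (auto simp: norm_Mul[OF x] norm_l2_unit)
  ultimately have "cmod (h2fun x z) ^ m \<le> 1 / (1 - cmod z)"
    using norm_h2fun_le[OF z, of "((Mul x) ^^ m) (l2_unit 0)"] by (simp add: norm_power)
  then show False
    using m by simp
qed

text \<open>The boundary function has modulus at most 1, and by Parseval its mean square is 1;
  together these force modulus 1 almost everywhere.\<close>

lemma inner_function_h2fun:
  assumes x: "inner_seq x"
  shows "inner_function (h2fun x)"
proof -
  have Hinf: "h2fun x \<in> Hinf"
    using norm_h2fun_inner_seq_le_1[OF x] by (auto simp: Hinf_def h2fun_holomorphic bounded_iff intro!: exI[of _ 1])
  note P = parseval_radius[OF h2fun_sums, of x]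
  have [measurable]: "(\<lambda>t. h2fun x (of_real (radius n) * cis t)) \<in> borel_measurable circle" for n
    by (rule P(3)) simp
  have le1: "cmod (h2fun x (of_real (radius n) * cis t)) \<le> 1" for n t
    by (intro norm_h2fun_inner_seq_le_1[OF x]) (simp add: norm_radius_cis)
  \<comment> \<open>Taking the limit along a sequence makes \<open>W\<close> measurable. Angles
    without a limit form a null set, where \<open>lim\<close> may take any value.\<close>
  define W where "W t = lim (\<lambda>n. h2fun x (of_real (radius n) * cis t))" for t
  have [measurable]: "W \<in> borel_measurable circle"
    unfolding W_def by measurable
  have lim: "AE t in circle. \<exists>w. ((\<lambda>r. h2fun x (of_real r * cis t)) \<longlongrightarrow> w) (at_left 1)"
    using radial_limit_exists[OF summable_coord_square[of x]]
  proof eventually_elim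
    case (elim t)
    then obtain w where w: "((\<lambda>r. \<Sum>k. coord x k * (of_real r * cis t) ^ k) \<longlongrightarrow> w) (at_left 1)"
      by blast
    have "\<forall>\<^sub>F r in at_left 1. (\<Sum>k. coord x k * (of_real r * cis t) ^ k) = h2fun x (of_real r * cis t)"
      unfolding eventually_at_left[OF zero_less_one]
      by (intro exI[of _ 0]) (auto simp: h2fun_def norm_mult)
    from tendsto_cong[OF this, of w] show ?case
      using w by blast
  qed
  then have lim_W: "AE t in circle. (\<lambda>n. h2fun x (of_real (radius n) * cis t)) \<longlonglongrightarrow> W t"
  proof eventually_elim
    case (elim t)
    then obtain w where "((\<lambda>r. h2fun x (of_real r * cis t)) \<longlongrightarrow> w) (at_left 1)"
      by blast
    from filterlim_compose[OF this filterlim_radius] show ?case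
      by (simp add: W_def limI)
  qed
  have W1: "AE t in circle. cmod (W t) \<le> 1"
    using lim_W
  proof eventually_elim
    case (elim t)
    show ?case
      by (rule LIMSEQ_le_const2[OF tendsto_norm[OF elim]]) (use le1 in auto)
  qed
  have "(\<lambda>n. LINT t|circle. (cmod (h2fun x (of_real (radius n) * cis t)))\<^sup>2) \<longlonglongrightarrow> (LINT t|circle. (cmod (W t))\<^sup>2)"
  proof (rule Bochner_Integration.integral_dominated_convergence[where w = "\<lambda>_. 1"])
    show "AE t in circle. (\<lambda>n. (cmod (h2fun x (of_real (radius n) * cis t)))\<^sup>2) \<longlonglongrightarrow> (cmod (W t))\<^sup>2"
      using lim_W by eventually_elim (intro tendsto_intros)
  qed (auto simp: power_le_one le1)
  moreover have "(\<lambda>n. LINT t|circle. (cmod (h2fun x (of_real (radius n) * cis t)))\<^sup>2) \<longlonglongrightarrow> 2 * pi"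
  proof -
    have eq: "complex_of_real (LINT t|circle. (cmod (h2fun x (of_real (radius n) * cis t)))\<^sup>2)
        = 2 * of_real pi * (\<Sum>k. coord x k * cnj (coord x (k + 0)) * of_real (radius n) ^ (2 * k + 0))" for n
      by (subst P(1)[symmetric]) (auto simp: complex_norm_square simp del: of_real_power simp flip: integral_complex_of_real)
    have lim2: "(\<lambda>n. 2 * of_real pi * (\<Sum>k. coord x k * cnj (coord x (k + 0)) * of_real (radius n) ^ (2 * k + 0)))
        \<longlonglongrightarrow> 2 * of_real pi * (\<Sum>k. coord x k * cnj (coord x (k + 0)))"
      by (intro tendsto_mult_left abel_limit_radius autocorrelation_summable)
    have sum1: "(\<Sum>k. coord x k * cnj (coord x (k + 0))) = 1"
      using autocorrelation_sums[of x 0] cip_inner_seq_self[OF x] by (simp add: sums_iff)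
    have "(\<lambda>n. complex_of_real (LINT t|circle. (cmod (h2fun x (of_real (radius n) * cis t)))\<^sup>2)) \<longlonglongrightarrow> of_real (2 * pi)"
      using lim2 unfolding eq sum1 by (simp only: of_real_mult of_real_numeral mult_1_right)
    then show ?thesis
      by (simp only: tendsto_of_real_iff)
  qed
  ultimately have intW: "(LINT t|circle. (cmod (W t))\<^sup>2) = 2 * pi"
    by (rule LIMSEQ_unique)
  have int: "integrable circle (\<lambda>t. (cmod (W t))\<^sup>2)"
    by (rule circle.integrable_const_bound[of _ 1]) (use W1 in \<open>auto elim!: eventually_mono simp: power_le_one\<close>)
  have "(LINT t|circle. 1 - (cmod (W t))\<^sup>2) = 0"
    by (subst Bochner_Integration.integral_diff) (auto simp: int intW)
  moreover have "AE t in circle. 0 \<le> 1 - (cmod (W t))\<^sup>2"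
    using W1 by eventually_elim (simp add: power_le_one)
  ultimately have "AE t in circle. 1 - (cmod (W t))\<^sup>2 = 0"
    by (subst (asm) integral_nonneg_eq_0_iff_AE) (auto simp: int)
  with lim lim_W have "AE t in circle. \<exists>w. cmod w = 1 \<and> ((\<lambda>r. h2fun x (complex_of_real r * cis t)) \<longlongrightarrow> w) (at_left 1)"
  proof eventually_elim
    case (elim t)
    then obtain w where w: "((\<lambda>r. h2fun x (of_real r * cis t)) \<longlongrightarrow> w) (at_left 1)"
      by blast
    then have "W t = w"
      using LIMSEQ_unique[OF elim(2) filterlim_compose[OF w filterlim_radius]] by simp
    moreover have "cmod (W t) = 1"
      using elim(3) power2_eq_iff_nonneg[of "cmod (W t)" 1] by simp
    ultimately show ?case
      using w by blast
  qed
  then show ?thesis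
    using Hinf by (simp add: inner_function_def AE_lebesgue_circle)
qed

section \<open>Compressed shifts\<close>

lemma inner_function_mult_h2fun: "inner_function \<theta> \<Longrightarrow> \<theta> * h2fun y = h2fun (Mul (h2seq \<theta>) y)"
  by (rule mult_h2fun) (auto dest: inner_functionD)

lemma model_space_eq:
  assumes "inner_function \<theta>"
  shows "model_space \<theta> = h2fun ` model (h2seq \<theta>)"
  unfolding model_space_def hardy2_eq_range
  using inner_function_mult_h2fun[OF assms] by (auto simp: hardy2_inner_h2fun model_iff)

lemma h2seq_image_model_space: "inner_function \<theta> \<Longrightarrow> h2seq ` model_space \<theta> = model (h2seq \<theta>)"
  by (simp add: model_space_eq image_image)

lemma compressed_shift_h2fun:
  assumes \<theta>: "inner_function \<theta>" and x: "x \<in> model (h2seq \<theta>)"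
  shows "compressed_shift \<theta> (h2fun x) = h2fun (cshift (h2seq \<theta>) x)"
  unfolding compressed_shift_def orth_proj_def
proof (rule the_equality)
  note inner = inner_functionD(3)[OF \<theta>]
  have ortho: "fshift x - cshift (h2seq \<theta>) x \<in> ortho (model (h2seq \<theta>))"
    using proj_props(2)[of "model (h2seq \<theta>)" "fshift x"] by (simp add: cshift_eq_proj[OF inner x])
  then show "h2fun (cshift (h2seq \<theta>) x) \<in> model_space \<theta> \<and>
      (\<forall>h\<in>model_space \<theta>. hardy2_inner (shift (h2fun x) - h2fun (cshift (h2seq \<theta>) x)) h = 0)"
    unfolding model_space_eq[OF \<theta>]
    using cshift_model[OF inner x] by (auto simp: shift_h2fun hardy2_inner_h2fun orthoD simp flip: h2fun_diff)
  fix g assume g: "g \<in> model_space \<theta> \<and> (\<forall>h\<in>model_space \<theta>. hardy2_inner (shift (h2fun x) - g) h = 0)"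
  then obtain y where y: "g = h2fun y" "y \<in> model (h2seq \<theta>)"
    by (auto simp: model_space_eq[OF \<theta>])
  have "fshift x - y \<in> ortho (model (h2seq \<theta>))"
    using g unfolding y(1) model_space_eq[OF \<theta>] by (auto simp: shift_h2fun hardy2_inner_h2fun ortho_def simp flip: h2fun_diff)
  then have "y = cshift (h2seq \<theta>) x"
    using projection_unique[OF closed_csubspace_model y(2)] cshift_model[OF inner x] ortho by blast
  then show "g = h2fun (cshift (h2seq \<theta>) x)"
    by (simp add: y)
qed

section \<open>Tensor products of sequence spaces\<close>

definition tens :: "('n::finite \<Rightarrow> nat l2) \<Rightarrow> ('n \<Rightarrow> nat) l2"
  where "tens x = Abs_l2 (etensor (\<lambda>j. h2fun (x j)))"

definition tensor_sub :: "('n::finite \<Rightarrow> nat l2 set) \<Rightarrow> ('n \<Rightarrow> nat) l2 set"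
  where "tensor_sub N = closure (cl2.span {tens x | x. \<forall>j. x j \<in> N j})"

lemma coord_range: "range coord = {c. (\<lambda>x. (cmod (c x))\<^sup>2) summable_on UNIV}"
  using type_definition.Rep_range[OF type_definition_l2] .

lemma ell2_eq_range: "ell2 = range coord"
  by (simp add: ell2_def coord_range)

lemma coord_tens_etensor: "coord (tens x) = etensor (\<lambda>j. h2fun (x j))"
proof -
  have "etensor (\<lambda>j. h2fun (x j)) \<in> range coord"
    using etensor_in_ell2[of "\<lambda>j. h2fun (x j)"] by (simp add: ell2_eq_range)
  then show ?thesis
    by (auto simp: tens_def coord_inverse)
qed

lemma coord_tens: "coord (tens x) \<alpha> = (\<Prod>j\<in>UNIV. coord (x j) (\<alpha> j))"
  by (simp add: coord_tens_etensor etensor_def taylor_h2fun)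

lemma cip_tens: "cip (tens x) (tens y) = (\<Prod>j\<in>UNIV. cip (x j) (y j))"
proof -
  have "cip (tens x) (tens y) = ell2_inner (coord (tens x)) (coord (tens y))"
    by (simp add: cip.rep_eq ell2_inner_def)
  then show ?thesis
    using ell2_inner_etensor[of "\<lambda>j. h2fun (x j)" "\<lambda>j. h2fun (y j)"]
    by (simp add: coord_tens_etensor hardy2_inner_h2fun)
qed

lemma prod_fun_upd:
  fixes F :: "'n::finite \<Rightarrow> 'b \<Rightarrow> 'c::comm_monoid_mult"
  shows "(\<Prod>i\<in>UNIV. F i ((x(j := a)) i)) = F j a * (\<Prod>i\<in>UNIV - {j}. F i (x i))"
  by (subst prod.remove[of UNIV j]) (auto intro!: prod.cong)

lemma coord_tens_upd: "coord (tens (x(j := a))) \<alpha> = coord a (\<alpha> j) * (\<Prod>i\<in>UNIV - {j}. coord (x i) (\<alpha> i))"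
  unfolding coord_tens by (rule prod_fun_upd)

lemma cip_tens_upd: "cip (tens (x(j := a))) (tens (y(j := b))) = cip a b * (\<Prod>i\<in>UNIV - {j}. cip (x i) (y i))"
  unfolding cip_tens by (subst prod.remove[of UNIV j]) (auto intro!: prod.cong)

lemma cip_tens_upd_left: "cip (tens (x(j := a))) (tens y) = cip a (y j) * (\<Prod>i\<in>UNIV - {j}. cip (x i) (y i))"
  using cip_tens_upd[of x j a y "y j"] by simp

lemma tens_add: "tens (x(j := a + b)) = tens (x(j := a)) + tens (x(j := b))"
  by (rule l2_eqI) (simp only: coord_tens_upd coord_simps distrib_right)

lemma tens_diff: "tens (x(j := a - b)) = tens (x(j := a)) - tens (x(j := b))"
  by (rule l2_eqI) (simp only: coord_tens_upd coord_simps left_diff_distrib)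

lemma tens_scaleC: "tens (x(j := c *\<^sub>C a)) = c *\<^sub>C tens (x(j := a))"
  by (rule l2_eqI) (simp only: coord_tens_upd coord_simps mult.assoc)

lemma tens_eq_0_iff: "tens x = 0 \<longleftrightarrow> (\<exists>j. x j = 0)"
proof -
  have "tens x = 0 \<longleftrightarrow> cip (tens x) (tens x) = 0"
    by simp
  also have "\<dots> \<longleftrightarrow> (\<exists>j. x j = 0)"
    unfolding cip_tens by simp
  finally show ?thesis .
qed

lemma norm_tens: "norm (tens x) = (\<Prod>j\<in>UNIV. norm (x j))"
proof -
  have "complex_of_real ((norm (tens x))\<^sup>2) = of_real ((\<Prod>j\<in>UNIV. norm (x j))\<^sup>2)"
    by (simp only: cip_self_norm[symmetric] cip_tens) (simp add: cip_self_norm prod_power_distrib)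
  then have "(norm (tens x))\<^sup>2 = (\<Prod>j\<in>UNIV. norm (x j))\<^sup>2"
    using of_real_eq_iff by blast
  then show ?thesis
    by (simp add: power2_eq_iff_nonneg prod_nonneg)
qed

text \<open>Contraction of \<open>c\<close> against fixed vectors in all slots but \<open>j\<close>,
  obtained as a Riesz vector in \<open>S\<close>.\<close>

lemma tens_slice:
  fixes x :: "'n::finite \<Rightarrow> nat l2"
  assumes "closed_csubspace S"
  obtains v where "v \<in> S" "\<And>a. a \<in> S \<Longrightarrow> cip (tens (x(j := a))) c = cip a v"
proof (rule riesz_representation[OF assms, of "\<lambda>a. cip (tens (x(j := a))) c"])
  fix a
  have "cmod (cip (tens (x(j := a))) c) \<le> norm (tens (x(j := a))) * norm c"
    by (rule norm_cip_le)
  also have "norm (tens (x(j := a))) = norm a * (\<Prod>i\<in>UNIV - {j}. norm (x i))"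
    using prod_fun_upd[of "\<lambda>_. norm" x j a] by (simp only: norm_tens)
  finally show "cmod (cip (tens (x(j := a))) c) \<le> ((\<Prod>i\<in>UNIV - {j}. norm (x i)) * norm c) * norm a"
    by (simp only: mult_ac)
qed (use that in \<open>auto simp: tens_add tens_scaleC cip_add_left\<close>)

lemma closed_csubspace_tensor_sub [simp]: "closed_csubspace (tensor_sub N)"
  unfolding tensor_sub_def by (rule closed_csubspace_closure_span)

lemma tens_in_tensor_sub: "(\<And>j. x j \<in> N j) \<Longrightarrow> tens x \<in> tensor_sub N"
  unfolding tensor_sub_def by (intro subsetD[OF closure_subset] cl2.span_base) auto

lemma ortho_tensor_sub: "c \<in> ortho (tensor_sub N) \<longleftrightarrow> (\<forall>x. (\<forall>j. x j \<in> N j) \<longrightarrow> cip c (tens x) = 0)"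
proof
  assume "c \<in> ortho (tensor_sub N)"
  then show "\<forall>x. (\<forall>j. x j \<in> N j) \<longrightarrow> cip c (tens x) = 0"
    using tens_in_tensor_sub by (blast intro: orthoD)
next
  assume "\<forall>x. (\<forall>j. x j \<in> N j) \<longrightarrow> cip c (tens x) = 0"
  then have c: "c \<in> ortho {tens x | x. \<forall>j. x j \<in> N j}"
    by (auto simp: ortho_def)
  show "c \<in> ortho (tensor_sub N)"
    unfolding tensor_sub_def closure_span_eq using c by (auto simp: ortho_def[of "ortho (ortho _)"] intro: ortho_sym)
qed

text \<open>Linearity, density and continuity in one step: an identity between continuous
  functionals of \<open>c\<close> is written as orthogonality to a fixed \<open>v\<close> and then
  needs checking on elementary tensors only.\<close>

lemma tensor_sub_extend:
  assumes "c \<in> tensor_sub N" "\<And>x. (\<And>j. x j \<in> N j) \<Longrightarrow> cip (tens x) v = 0"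
  shows "cip c v = 0"
proof -
  have "v \<in> ortho (tensor_sub N)"
    unfolding ortho_tensor_sub using assms(2) by (subst cip_commute) auto
  then show ?thesis
    using assms(1) by (rule ortho_sym)
qed

lemma tensor_sub_least:
  assumes "closed_csubspace S" "\<And>x. (\<And>j. x j \<in> N j) \<Longrightarrow> tens x \<in> S"
  shows "tensor_sub N \<subseteq> S"
proof -
  have "ortho S \<subseteq> ortho (tensor_sub N)"
    unfolding subset_iff ortho_tensor_sub using assms(2) orthoD by blast
  then show ?thesis
    using ortho_mono[of "ortho S" "ortho (tensor_sub N)"] assms(1) by (simp add: ortho_ortho)
qed

lemma tensor_sub_mono: "(\<And>j. N j \<subseteq> N' j) \<Longrightarrow> tensor_sub N \<subseteq> tensor_sub N'"
  by (rule tensor_sub_least) (auto intro!: tens_in_tensor_sub)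

text \<open>The closed span is taken in one slot at a time. With the other slots fixed, pairing with
  \<open>c\<close> is pairing with a slice \<open>v\<close>, and \<open>v\<close> orthogonal to
  \<open>A j\<close> is orthogonal to its double complement.\<close>

lemma ortho_tens_slotwise:
  fixes c :: "('n::finite \<Rightarrow> nat) l2"
  assumes A: "\<And>x. (\<And>j. x j \<in> A j) \<Longrightarrow> cip (tens x) c = 0"
    and x: "\<And>j. x j \<in> ortho (ortho (A j))"
  shows "cip (tens x) c = 0"
proof -
  have "cip (tens x) c = 0" if "finite J" "\<And>j. j \<in> J \<Longrightarrow> x j \<in> ortho (ortho (A j))" "\<And>j. j \<notin> J \<Longrightarrow> x j \<in> A j" for J x
    using that
  proof (induction J arbitrary: x rule: finite_induct)
    case empty
    then show ?case
      using A by simp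
  next
    case (insert j J)
    obtain v where v: "\<And>a. cip (tens (x(j := a))) c = cip a v"
    proof (rule tens_slice[OF closed_csubspace_UNIV, of x j c])
      fix v assume "\<And>a. a \<in> UNIV \<Longrightarrow> cip (tens (x(j := a))) c = cip a v"
      then show ?thesis
        by (intro that) simp
    qed
    have "cip a v = 0" if "a \<in> A j" for a
    proof -
      have "cip (tens (x(j := a))) c = 0"
      proof (rule insert.IH)
        show "(x(j := a)) i \<in> ortho (ortho (A i))" if "i \<in> J" for i
          using that insert.prems(1)[of i] insert.hyps by auto
        show "(x(j := a)) i \<in> A i" if "i \<notin> J" for i
          using that \<open>a \<in> A j\<close> insert.prems(2)[of i] by auto
      qed
      then show ?thesis
        using v by simp
    qed
    then have "v \<in> ortho (A j)"
      by (rule orthoI)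
    then have "cip (x j) v = 0"
      using insert.prems(1)[of j] by (intro orthoD[of "x j"]) simp_all
    then show ?case
      using v[of "x j"] by simp
  qed
  from this[of UNIV x] x show ?thesis
    by simp
qed

lemma tensor_sub_ortho_ortho: "tensor_sub (\<lambda>j. ortho (ortho (A j))) = tensor_sub A"
proof
  have sub: "A j \<subseteq> ortho (ortho (A j))" for j
    by (auto simp: ortho_def[of "ortho _"] intro: ortho_sym)
  then show "tensor_sub A \<subseteq> tensor_sub (\<lambda>j. ortho (ortho (A j)))"
    by (rule tensor_sub_mono)
  show "tensor_sub (\<lambda>j. ortho (ortho (A j))) \<subseteq> tensor_sub A"
  proof (rule tensor_sub_least)
    fix x assume x: "\<And>j. x j \<in> ortho (ortho (A j))"
    have "cip (tens x) c = 0" if "c \<in> ortho (tensor_sub A)" for c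
      using that by (intro ortho_tens_slotwise[OF _ x] ortho_sym[OF that] tens_in_tensor_sub)
    then have "tens x \<in> ortho (ortho (tensor_sub A))"
      by (simp add: ortho_def[of "ortho _"])
    then show "tens x \<in> tensor_sub A"
      by (simp add: ortho_ortho)
  qed simp
qed

subsection \<open>The coordinate shifts\<close>

definition raise :: "'n \<Rightarrow> ('n \<Rightarrow> nat) \<Rightarrow> 'n \<Rightarrow> nat"
  where "raise j \<alpha> = \<alpha>(j := Suc (\<alpha> j))"

lemma inj_raise: "inj (raise j)"
proof (rule injI, rule ext)
  fix \<alpha> \<beta> i assume eq: "raise j \<alpha> = raise j \<beta>"
  show "\<alpha> i = \<beta> i"
    using fun_cong[OF eq, of i] by (auto simp: raise_def split: if_splits)
qed

lemma push_raise_tens: "push (raise j) (tens x) = tens (x(j := fshift (x j)))"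
proof (rule l2_eqI)
  fix \<alpha>
  show "coord (push (raise j) (tens x)) \<alpha> = coord (tens (x(j := fshift (x j)))) \<alpha>"
  proof (cases "\<alpha> j")
    case 0
    then have "\<alpha> \<notin> range (raise j)"
      by (auto simp: raise_def)
    then show ?thesis
      using 0 by (simp add: coord_push inj_raise coord_tens_upd coord_fshift)
  next
    case (Suc m)
    then have \<alpha>: "\<alpha> = raise j (\<alpha>(j := m))"
      by (auto simp: raise_def)
    have "coord (push (raise j) (tens x)) \<alpha> = coord (tens x) (\<alpha>(j := m))"
      by (subst \<alpha>) (metis coord_pull inj_raise pull_push)
    also have "\<dots> = coord (tens (x(j := x j))) (\<alpha>(j := m))"
      by simp
    also have "\<dots> = coord (tens (x(j := fshift (x j)))) \<alpha>"
      unfolding coord_tens_upd using Suc by (auto simp: coord_fshift intro!: prod.cong)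
    finally show ?thesis .
  qed
qed

definition tensor_model :: "('n::finite \<Rightarrow> nat l2) \<Rightarrow> ('n \<Rightarrow> nat) l2 set"
  where "tensor_model \<theta> = tensor_sub (\<lambda>j. model (\<theta> j))"

text \<open>A compression is defined on the whole space and bounded at once;
  \<open>tshift_tens\<close> and \<open>tensor_shift_coord\<close> identify it on the tensor model
  with the tensor product operator.\<close>

definition tshift :: "('n::finite \<Rightarrow> nat l2) \<Rightarrow> 'n \<Rightarrow> ('n \<Rightarrow> nat) l2 \<Rightarrow> ('n \<Rightarrow> nat) l2"
  where "tshift \<theta> j c = proj (tensor_model \<theta>) (push (raise j) c)"

lemma closed_csubspace_tensor_model [simp]: "closed_csubspace (tensor_model \<theta>)"
  by (simp add: tensor_model_def)

lemma bounded_clinear_tshift: "bounded_clinear (tshift \<theta> j)"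
proof -
  have 1: "bounded_clinear (proj (tensor_model \<theta>))" "bounded_clinear (push (raise j))"
    by (auto intro: bounded_clinear_proj bounded_clinear_push inj_raise)
  then have "bounded_linear (\<lambda>c. proj (tensor_model \<theta>) (push (raise j) c))"
    by (intro bounded_linear_compose[of "proj (tensor_model \<theta>)" "push (raise j)"] bounded_clinearD)
  then show ?thesis
    unfolding bounded_clinear_def tshift_def by (simp add: bounded_clinearD[OF 1(1)] bounded_clinearD[OF 1(2)])
qed

lemma tshift_in_tensor_model: "tshift \<theta> j c \<in> tensor_model \<theta>"
  by (simp add: tshift_def proj_props)

text \<open>The difference of the two tensors carries a multiple of \<open>\<theta> j\<close> in
  slot \<open>j\<close>, hence is orthogonal to the tensor model.\<close>

lemma tshift_tens:
  assumes \<theta>: "\<And>j. inner_seq (\<theta> j)" and x: "\<And>i. x i \<in> model (\<theta> i)"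
  shows "tshift \<theta> j (tens x) = tens (x(j := cshift (\<theta> j) (x j)))"
  unfolding tshift_def push_raise_tens
proof (rule proj_eqI)
  show "tens (x(j := cshift (\<theta> j) (x j))) \<in> tensor_model \<theta>"
    unfolding tensor_model_def using x by (intro tens_in_tensor_sub) (auto intro: cshift_model \<theta>)
  show "tens (x(j := fshift (x j))) - tens (x(j := cshift (\<theta> j) (x j))) \<in> ortho (tensor_model \<theta>)"
    unfolding tensor_model_def ortho_tensor_sub tens_diff[symmetric]
    by (auto simp: cip_tens_upd_left cshift_def orthoD[OF inner_seq_in_ortho_model[OF \<theta>]])
qed simp

lemma cip_adj_UNIV: "bounded_clinear T \<Longrightarrow> cip f (adj UNIV T g) = cip (T f) g"
  by (rule adj_props) auto

lemma cip_adj_left: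
  assumes "closed_csubspace S" "bounded_clinear T" "f \<in> S"
  shows "cip (adj S T g) f = cip g (T f)"
  using adj_props(2)[OF assms(1,2,3), of g] cip_commute by metis

section \<open>Doubly commuting submodules are tensor products\<close>

lemma extend_from_tens:
  fixes T :: "('n::finite \<Rightarrow> nat) l2 \<Rightarrow> ('n \<Rightarrow> nat) l2"
  assumes "bounded_clinear T" "c \<in> tensor_sub N" "\<And>x. (\<And>j. x j \<in> N j) \<Longrightarrow> cip (T (tens x)) d = cip (tens x) d'"
  shows "cip (T c) d = cip c d'"
proof -
  have "cip c (adj UNIV T d - d') = 0"
    using assms(2) by (rule tensor_sub_extend) (simp add: cip_diff_right cip_adj_UNIV assms)
  then show ?thesis
    by (simp add: cip_diff_right cip_adj_UNIV assms(1))
qed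

text \<open>The commutation relations are symmetric in the two indices here, whereas
  \<open>doubly_commuting_on\<close> gives them for \<open>i < j\<close>;
  \<open>adj_commute_sym\<close> supplies the other order.\<close>

locale dc_submodule =
  fixes \<theta> :: "'n::finite \<Rightarrow> nat l2" and M :: "('n \<Rightarrow> nat) l2 set"
  assumes inner: "\<And>j. inner_seq (\<theta> j)"
    and M: "closed_csubspace M" "M \<subseteq> tensor_model \<theta>"
    and inv: "\<And>j f. f \<in> M \<Longrightarrow> tshift \<theta> j f \<in> M"
    and T_commute: "\<And>i j f. i \<noteq> j \<Longrightarrow> f \<in> M \<Longrightarrow> tshift \<theta> i (tshift \<theta> j f) = tshift \<theta> j (tshift \<theta> i f)"
    and Rs_T_commute: "\<And>i j f. i \<noteq> j \<Longrightarrow> f \<in> M \<Longrightarrow>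
      adj M (tshift \<theta> i) (tshift \<theta> j f) = tshift \<theta> j (adj M (tshift \<theta> i) f)"
begin

abbreviation T where "T \<equiv> tshift \<theta>"
abbreviation Rs where "Rs j \<equiv> adj M (T j)"
abbreviation g where "g j \<equiv> bshift (\<theta> j)"

lemmas MD = closed_csubspaceD[OF M(1)]
lemmas T_lin = bounded_clinearD[OF bounded_clinear_tshift[of \<theta>]]

lemma Rs_M [simp]: "Rs j f \<in> M"
  by (rule adj_props[OF M(1) bounded_clinear_tshift])

lemma cip_Rs: "f \<in> M \<Longrightarrow> cip f (Rs j h) = cip (T j f) h"
  by (rule adj_props[OF M(1) bounded_clinear_tshift])

lemma cip_Rs_left: "f \<in> M \<Longrightarrow> cip (Rs j h) f = cip h (T j f)"
  by (rule cip_adj_left[OF M(1) bounded_clinear_tshift])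

lemma M_eqI: "f \<in> M \<Longrightarrow> h \<in> M \<Longrightarrow> (\<And>d. d \<in> M \<Longrightarrow> cip d f = cip d h) \<Longrightarrow> f = h"
  by (rule l2_eq_on_closed_csubspaceI[OF M(1)])

lemma Rs_scale: "Rs j (c *\<^sub>C f) = c *\<^sub>C Rs j f"
  by (rule M_eqI) (auto simp: cip_Rs MD)

lemma Rs_diff: "Rs j (f - h) = Rs j f - Rs j h"
  by (rule M_eqI) (auto simp: cip_Rs MD cip_diff_right)

lemma Rs_Rs_commute: "i \<noteq> j \<Longrightarrow> f \<in> M \<Longrightarrow> Rs i (Rs j f) = Rs j (Rs i f)"
  by (rule M_eqI) (auto simp: cip_Rs inv T_commute)

subsection \<open>The defect operators\<close>

text \<open>The product of defects occurs twice: as a form on the tensor model, computable on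
  elementary tensors, and as the operator \<open>defect_prod\<close>, where \<open>Rs\<close> is the
  adjoint in \<open>M\<close>. The form has no adjoint in it, so both agree on
  \<open>M\<close>.\<close>

fun defect_form :: "'n list \<Rightarrow> ('n \<Rightarrow> nat) l2 \<Rightarrow> ('n \<Rightarrow> nat) l2 \<Rightarrow> complex" where
  "defect_form [] c d = cip c d"
| "defect_form (i # xs) c d = defect_form xs c d - defect_form xs (T i c) (T i d)"

fun defect_prod :: "'n list \<Rightarrow> ('n \<Rightarrow> nat) l2 \<Rightarrow> ('n \<Rightarrow> nat) l2" where
  "defect_prod [] f = f"
| "defect_prod (i # xs) f = defect_prod xs f - Rs i (T i (defect_prod xs f))"

text \<open>\<open>defect_vec xs d\<close> represents the functional \<open>\<lambda>c. defect_form xs c d\<close>, so that identities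
  for it extend from elementary tensors by continuity.\<close>

fun defect_vec :: "'n list \<Rightarrow> ('n \<Rightarrow> nat) l2 \<Rightarrow> ('n \<Rightarrow> nat) l2" where
  "defect_vec [] d = d"
| "defect_vec (i # xs) d = defect_vec xs d - adj UNIV (T i) (defect_vec xs (T i d))"

lemma defect_prod_M: "f \<in> M \<Longrightarrow> defect_prod xs f \<in> M"
  by (induction xs) (auto intro: MD)

lemma defect_prod_scale: "f \<in> M \<Longrightarrow> defect_prod xs (c *\<^sub>C f) = c *\<^sub>C defect_prod xs f"
  by (induction xs) (auto simp: T_lin Rs_scale cl2.scale_right_diff_distrib)

lemma defect_prod_commute_T: "k \<notin> set xs \<Longrightarrow> f \<in> M \<Longrightarrow> defect_prod xs (T k f) = T k (defect_prod xs f)"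
proof (induction xs)
  case (Cons i xs)
  then have "defect_prod xs f \<in> M" "i \<noteq> k"
    by (auto intro: defect_prod_M)
  then show ?case
    using Cons by (simp add: T_lin T_commute[of i k] Rs_T_commute[of i k] inv)
qed simp

lemma defect_prod_commute_Rs: "k \<notin> set xs \<Longrightarrow> f \<in> M \<Longrightarrow> defect_prod xs (Rs k f) = Rs k (defect_prod xs f)"
proof (induction xs)
  case (Cons i xs)
  then have "defect_prod xs f \<in> M" "i \<noteq> k"
    by (auto intro: defect_prod_M)
  then show ?case
    using Cons by (simp add: Rs_diff Rs_T_commute[of k i, symmetric] Rs_Rs_commute[of k i] inv)
qed simp

text \<open>Within \<open>M\<close>, \<open>Rs i\<close> moves to the right as \<open>T i\<close>,
  and \<open>T i\<close> passes through the product over the remaining indices; this is where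
  distinctness enters.\<close>

lemma cip_defect_prod: "distinct xs \<Longrightarrow> c \<in> M \<Longrightarrow> d \<in> M \<Longrightarrow> cip (defect_prod xs c) d = defect_form xs c d"
proof (induction xs arbitrary: c d)
  case (Cons i xs)
  then have "cip (defect_prod (i # xs) c) d = cip (defect_prod xs c) d - cip (defect_prod xs (T i c)) (T i d)"
    by (simp add: cip_diff_left cip_Rs_left defect_prod_commute_T)
  then show ?case
    using Cons inv by simp
qed simp

lemma cip_defect_vec: "cip c (defect_vec xs d) = defect_form xs c d"
  by (induction xs arbitrary: c d) (auto simp: cip_diff_right cip_adj_UNIV bounded_clinear_tshift)

lemma defect_form_commute: "defect_form xs c d = cnj (defect_form xs d c)"
proof (induction xs arbitrary: c d)
  case Nil
  show ?case
    using cip_commute by simp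
next
  case (Cons i xs)
  show ?case
    using Cons[of c d] Cons[of "T i c" "T i d"] by simp
qed

text \<open>\<open>T i\<close> acts in slot \<open>i\<close> alone, so each listed index replaces
  one factor by the rank one form of \<open>cip_cshift_cshift\<close>.\<close>

lemma defect_form_tens:
  assumes "distinct xs" "\<And>j. x j \<in> model (\<theta> j)" "\<And>j. y j \<in> model (\<theta> j)"
  shows "defect_form xs (tens x) (tens y) =
    (\<Prod>j\<in>UNIV. if j \<in> set xs then cip (x j) (g j) * cnj (cip (y j) (g j)) else cip (x j) (y j))"
  using assms
proof (induction xs arbitrary: x y)
  case Nil
  then show ?case
    by (simp add: cip_tens)
next
  case (Cons i xs)
  define F where "F x y j = (if j \<in> set xs then cip (x j) (g j) * cnj (cip (y j) (g j)) else cip (x j) (y j))" for x y j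
  define P where "P = (\<Prod>j\<in>UNIV - {i}. F x y j)"
  let ?x = "x(i := cshift (\<theta> i) (x i))" and ?y = "y(i := cshift (\<theta> i) (y i))"
  have Tx: "T i (tens x) = tens ?x" "T i (tens y) = tens ?y"
    using Cons.prems by (auto simp: tshift_tens inner)
  have model: "?x j \<in> model (\<theta> j)" "?y j \<in> model (\<theta> j)" for j
    using Cons.prems by (auto intro: cshift_model inner)
  have 1: "defect_form xs (tens x) (tens y) = cip (x i) (y i) * P"
    using Cons by (subst Cons.IH) (auto simp: P_def F_def prod.remove[of UNIV i])
  have P': "(\<Prod>j\<in>UNIV - {i}. F ?x ?y j) = P"
    unfolding P_def by (intro prod.cong) (auto simp: F_def)
  have "defect_form xs (tens ?x) (tens ?y) = (\<Prod>j\<in>UNIV. F ?x ?y j)"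
    unfolding F_def using Cons.prems(1) by (intro Cons.IH model) auto
  also have "\<dots> = F ?x ?y i * P"
    unfolding P'[symmetric] by (rule prod.remove) auto
  finally have 2: "defect_form xs (tens ?x) (tens ?y) = (cip (x i) (y i) - cip (x i) (g i) * cnj (cip (y i) (g i))) * P"
    using Cons.prems(1) by (simp add: F_def cip_cshift_cshift inner)
  have "(\<Prod>j\<in>UNIV - {i}. if j \<in> set (i # xs) then cip (x j) (g j) * cnj (cip (y j) (g j)) else cip (x j) (y j)) = P"
    unfolding P_def by (intro prod.cong) (auto simp: F_def)
  then have "(\<Prod>j\<in>UNIV. if j \<in> set (i # xs) then cip (x j) (g j) * cnj (cip (y j) (g j)) else cip (x j) (y j))
      = cip (x i) (g i) * cnj (cip (y i) (g i)) * P"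
    by (subst prod.remove[of UNIV i]) simp_all
  then show ?case
    by (simp add: Tx 1 2 algebra_simps)
qed

text \<open>Extended from elementary tensors one variable at a time: \<open>defect_vec\<close>
  represents the form in its first argument, and Hermitian symmetry exchanges the roles of the
  arguments.\<close>

lemma defect_form_full:
  assumes xs: "distinct xs" "set xs = UNIV" and c: "c \<in> tensor_model \<theta>" and d: "d \<in> tensor_model \<theta>"
  shows "defect_form xs c d = cip c (tens g) * cip (tens g) d"
proof -
  have on_tens: "defect_form xs (tens x) (tens y) = cip (tens x) (tens g) * cip (tens g) (tens y)"
    if "\<And>j. x j \<in> model (\<theta> j)" "\<And>j. y j \<in> model (\<theta> j)" for x y
  proof -
    have "cip (tens g) (tens y) = (\<Prod>j\<in>UNIV. cnj (cip (y j) (g j)))"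
      unfolding cip_tens by (intro prod.cong refl cip_commute)
    then show ?thesis
      using defect_form_tens[OF xs(1) that] by (simp add: xs cip_tens prod.distrib)
  qed
  have 1: "defect_form xs c (tens y) = cip c (tens g) * cip (tens g) (tens y)"
    if c: "c \<in> tensor_model \<theta>" and y: "\<And>j. y j \<in> model (\<theta> j)" for c y
  proof -
    have "cip c (defect_vec xs (tens y) - cip (tens y) (tens g) *\<^sub>C tens g) = 0"
      using c unfolding tensor_model_def
      by (rule tensor_sub_extend)
        (simp add: cip_diff_right cip_defect_vec on_tens y mult.commute cip_commute[of "tens y" "tens g"])
    then show ?thesis
      by (simp add: cip_diff_right cip_defect_vec mult.commute cip_commute[of "tens y" "tens g"])
  qed
  have 2: "defect_form xs (tens y) c = cip (tens y) (tens g) * cip (tens g) c" if "\<And>j. y j \<in> model (\<theta> j)" for y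
    using 1[OF c that] defect_form_commute[of xs "tens y" c] cip_commute[of "tens y" "tens g"] cip_commute[of "tens g" c]
    by simp
  have "cip d (defect_vec xs c - cip c (tens g) *\<^sub>C tens g) = 0"
    using d unfolding tensor_model_def
    by (rule tensor_sub_extend)
      (simp add: cip_diff_right cip_defect_vec 2 mult.commute cip_commute[of c "tens g"])
  then have "defect_form xs d c = cip d (tens g) * cip (tens g) c"
    by (simp add: cip_diff_right cip_defect_vec mult.commute cip_commute[of c "tens g"])
  then show ?thesis
    using defect_form_commute[of xs c d] cip_commute[of c "tens g"] cip_commute[of "tens g" d] by simp
qed

definition u where "u = proj M (tens g)"

lemma u_M: "u \<in> M"
  by (simp add: u_def proj_props M)

lemma cip_u: "f \<in> M \<Longrightarrow> cip f u = cip f (tens g)"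
  by (simp add: u_def cip_proj_right M)

lemma defect_prod_full:
  assumes "distinct xs" "set xs = UNIV" "c \<in> M"
  shows "defect_prod xs c = cip c u *\<^sub>C u"
proof (rule M_eqI)
  fix d assume d: "d \<in> M"
  have "cip (defect_prod xs c) d = cip c u * cip u d"
    using cip_defect_prod[OF assms(1,3) d] defect_form_full[OF assms(1,2) subsetD[OF M(2) assms(3)] subsetD[OF M(2) d]]
      cip_u[OF assms(3)] cip_u[OF d] cip_commute[of u d] cip_commute[of "tens g" d] by simp
  then show "cip d (defect_prod xs c) = cip d (cip c u *\<^sub>C u)"
    using cip_commute[of d "defect_prod xs c"] cip_commute[of d u] by simp
qed (auto simp: assms defect_prod_M MD u_M)

subsection \<open>Factorisation of the Gram matrix\<close>

text \<open>\<open>tens g\<close> moved by the adjoint coordinate operators of the full tensor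
  model, which are backward shifts in single slots. These vectors are total there
  (\<open>tvec_dense\<close>).\<close>

definition tvec where "tvec \<alpha> = tens (\<lambda>j. (bshift ^^ \<alpha> j) (g j))"
definition w where "w \<alpha> = proj M (tvec \<alpha>)"
definition gram where "gram \<alpha> \<beta> = cip (w \<alpha>) (w \<beta>)"
definition gram1 where "gram1 j k l = gram ((\<lambda>_. 0)(j := k)) ((\<lambda>_. 0)(j := l))"

lemma w_M: "w \<alpha> \<in> M"
  by (simp add: w_def proj_props M)

lemma cip_w: "f \<in> M \<Longrightarrow> cip f (w \<alpha>) = cip f (tvec \<alpha>)"
  by (simp add: w_def cip_proj_right M)

lemma bshift_pow_model: "f \<in> model (\<theta> j) \<Longrightarrow> (bshift ^^ k) f \<in> model (\<theta> j)"
  by (induction k) (auto intro: bshift_model inner)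

lemma tvec_factor_model: "(bshift ^^ k) (g j) \<in> model (\<theta> j)"
  by (intro bshift_pow_model bshift_inner_seq_in_model inner)

lemma w_0: "w (\<lambda>_. 0) = u"
  by (simp add: w_def u_def tvec_def)

lemma cip_T_tvec:
  assumes "c \<in> tensor_model \<theta>"
  shows "cip (T i c) (tvec \<alpha>) = cip c (tvec (raise i \<alpha>))"
proof (rule extend_from_tens[OF bounded_clinear_tshift])
  show "c \<in> tensor_sub (\<lambda>j. model (\<theta> j))"
    using assms by (simp add: tensor_model_def)
  fix x assume x: "\<And>j. x j \<in> model (\<theta> j)"
  have *: "(\<lambda>j. (bshift ^^ raise i \<alpha> j) (g j)) = (\<lambda>j. (bshift ^^ \<alpha> j) (g j))(i := bshift ((bshift ^^ \<alpha> i) (g i)))"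
    by (auto simp: raise_def)
  show "cip (T i (tens x)) (tvec \<alpha>) = cip (tens x) (tvec (raise i \<alpha>))"
    unfolding tvec_def * using cip_tens_upd[of x i "x i"]
    by (simp add: tshift_tens inner x cip_tens_upd_left cip_cshift tvec_factor_model)
qed

text \<open>Because \<open>M\<close> is invariant, projecting to \<open>M\<close> turns the adjoint
  in the tensor model into the adjoint in \<open>M\<close>. So \<open>w \<alpha>\<close> is both the
  projection of an elementary tensor and a product of adjoints applied to \<open>u\<close>.\<close>

lemma Rs_w: "Rs i (w \<alpha>) = w (raise i \<alpha>)"
proof (rule M_eqI)
  fix d assume "d \<in> M"
  then show "cip d (Rs i (w \<alpha>)) = cip d (w (raise i \<alpha>))"
    using M(2) by (auto simp: cip_Rs cip_w inv cip_T_tvec)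
qed (auto simp: w_M)

lemma Rs_pow_w: "(Rs j ^^ k) (w \<alpha>) = w (\<alpha>(j := \<alpha> j + k))"
proof (induction k)
  case (Suc k)
  have "raise j (\<alpha>(j := \<alpha> j + k)) = \<alpha>(j := \<alpha> j + Suc k)"
    by (simp add: raise_def)
  then show ?case
    using Suc by (simp only: funpow.simps comp_apply Rs_w)
qed simp

text \<open>Multi-indices that vanish at \<open>j\<close> are reached from \<open>u\<close> by
  adjoints of the other coordinates; whatever commutes with those adjoints therefore propagates from
  \<open>u\<close>.\<close>

lemma w_induct:
  assumes "u \<in> S" "\<And>i v. i \<noteq> j \<Longrightarrow> v \<in> S \<Longrightarrow> Rs i v \<in> S" "\<alpha> j = 0"
  shows "w \<alpha> \<in> S"
  using assms(3)
proof (induction "\<Sum>i\<in>UNIV. \<alpha> i" arbitrary: \<alpha>)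
  case 0
  then have "\<alpha> = (\<lambda>_. 0)"
    by auto
  then show ?case
    using assms(1) by (simp add: w_0)
next
  case (Suc n)
  then obtain i where i: "\<alpha> i > 0"
    by (metis gr0I sum.neutral Zero_not_Suc)
  then have "i \<noteq> j"
    using Suc.prems by auto
  define \<beta> where "\<beta> = \<alpha>(i := \<alpha> i - 1)"
  have \<alpha>: "\<alpha> = raise i \<beta>"
    using i by (auto simp: \<beta>_def raise_def)
  have "(\<Sum>k\<in>UNIV. \<alpha> k) = Suc (\<Sum>k\<in>UNIV. \<beta> k)"
    unfolding \<alpha> raise_def by (simp add: sum.remove[of UNIV i])
  then have "n = (\<Sum>k\<in>UNIV. \<beta> k)"
    using Suc.hyps by simp
  moreover have "\<beta> j = 0"
    using Suc.prems \<open>i \<noteq> j\<close> by (simp add: \<beta>_def)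
  ultimately have "w \<beta> \<in> S"
    using Suc.hyps(1) by blast
  then show ?case
    using assms(2) \<open>i \<noteq> j\<close> by (simp add: \<alpha> Rs_w[symmetric])
qed

section \<open>The defect of a single coordinate\<close>

definition defect where "defect j f = f - Rs j (T j f)"

lemma cip_defect: "f \<in> M \<Longrightarrow> h \<in> M \<Longrightarrow> cip (defect j f) h = cip f (defect j h)"
  by (simp add: defect_def cip_diff_left cip_diff_right cip_Rs cip_Rs_left)

lemma Rs_defect: "i \<noteq> j \<Longrightarrow> f \<in> M \<Longrightarrow> defect j (Rs i f) = Rs i (defect j f)"
  by (simp add: defect_def Rs_diff Rs_T_commute[symmetric] Rs_Rs_commute[of i j] inv)

lemma defect_scale: "defect j (c *\<^sub>C f) = c *\<^sub>C defect j f"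
  by (simp add: defect_def T_lin Rs_scale cl2.scale_right_diff_distrib)

text \<open>With all other entries fixed, the entries of the Gram matrix in coordinate
  \<open>j\<close> are matrix coefficients of these words (\<open>gram_word\<close>).\<close>

definition word where "word j k l f = (T j ^^ l) ((Rs j ^^ k) f)"

lemma T_pow_M: "f \<in> M \<Longrightarrow> (T j ^^ l) f \<in> M"
  by (induction l) (auto intro: inv)

lemma Rs_pow_M: "f \<in> M \<Longrightarrow> (Rs j ^^ l) f \<in> M"
  by (induction l) auto

lemma word_M: "f \<in> M \<Longrightarrow> word j k l f \<in> M"
  by (simp add: word_def T_pow_M Rs_pow_M)

lemma word_Rs:
  assumes "i \<noteq> j" "f \<in> M"
  shows "word j k l (Rs i f) = Rs i (word j k l f)"
proof -
  have 1: "(Rs j ^^ k) (Rs i f) = Rs i ((Rs j ^^ k) f)"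
    using assms by (induction k) (auto simp: Rs_Rs_commute[of i j] Rs_pow_M)
  have 2: "(T j ^^ l) (Rs i h) = Rs i ((T j ^^ l) h)" if "h \<in> M" for h
    using assms that by (induction l) (auto simp: Rs_T_commute T_pow_M)
  show ?thesis
    using assms by (simp add: word_def 1 2 Rs_pow_M)
qed

lemma defect_prod_word:
  assumes "j \<notin> set xs" "f \<in> M"
  shows "defect_prod xs (word j k l f) = word j k l (defect_prod xs f)"
proof -
  have 1: "defect_prod xs ((Rs j ^^ k) f) = (Rs j ^^ k) (defect_prod xs f)"
    using assms by (induction k) (auto simp: defect_prod_commute_Rs Rs_pow_M)
  have 2: "defect_prod xs ((T j ^^ l) h) = (T j ^^ l) (defect_prod xs h)" if "h \<in> M" for h
    using assms that by (induction l) (auto simp: defect_prod_commute_T T_pow_M)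
  show ?thesis
    using assms by (simp add: word_def 1 2 Rs_pow_M)
qed

lemma word_scale: "word j k l (c *\<^sub>C f) = c *\<^sub>C word j k l f"
proof -
  have 1: "(Rs j ^^ k) (c *\<^sub>C f) = c *\<^sub>C (Rs j ^^ k) f"
    by (induction k) (auto simp: Rs_scale)
  have 2: "(T j ^^ l) (c *\<^sub>C h) = c *\<^sub>C (T j ^^ l) h" for h
    by (induction l) (auto simp: T_lin)
  show ?thesis
    by (simp add: word_def 1 2)
qed

text \<open>The product of all defect operators is the rank one operator \<open>\<langle>\<cdot>, u\<rangle> u\<close>. Compressing by the
  defect operator of the single index \<open>j\<close> therefore already maps \<open>word u\<close> to a multiple of \<open>u\<close> for
  each \<open>word\<close> built from the \<open>j\<close>-th operator and its adjoint.\<close>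

lemma defect_word_u:
  assumes "u \<noteq> 0"
  obtains c where "defect j (word j k l u) = c *\<^sub>C u" "word j k l u = u \<Longrightarrow> c \<noteq> 0"
proof -
  have "finite (UNIV - {j})"
    by simp
  then obtain xs where xs: "distinct xs" "set xs = UNIV - {j}"
    using finite_distinct_list by metis
  have full: "defect j (defect_prod xs f) = cip f u *\<^sub>C u" if "f \<in> M" for f
    using defect_prod_full[of "j # xs" f] xs that by (simp add: defect_def)
  have j: "j \<notin> set xs"
    using xs by auto
  have nz: "cip u u \<noteq> 0"
    using assms by simp
  define e where "e = cip (defect_prod xs u) u / cip u u"
  have commute: "defect_prod xs (defect j f) = defect j (defect_prod xs f)" if "f \<in> M" for f
  proof -
    have diff: "defect_prod ys (f - h) = defect_prod ys f - defect_prod ys h" for ys f h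
      by (induction ys) (auto simp: T_lin Rs_diff)
    show ?thesis
      using that j by (simp add: defect_def diff defect_prod_commute_T defect_prod_commute_Rs inv)
  qed
  \<comment> \<open>Write \<open>D\<close> for \<open>defect j\<close> and \<open>E\<close> for
    \<open>defect_prod xs\<close>. They commute, and \<open>D E\<close> is
    \<open>\<langle>\<cdot>, u\<rangle> u\<close>; evaluating \<open>E D E u\<close> in two ways
    makes \<open>E u\<close> a multiple of \<open>u\<close>.\<close>
  have "cip u u *\<^sub>C defect_prod xs u = defect_prod xs (defect j (defect_prod xs u))"
    by (simp only: full[OF u_M] defect_prod_scale[OF u_M])
  also have "\<dots> = cip (defect_prod xs u) u *\<^sub>C u"
    by (simp only: commute[OF defect_prod_M[OF u_M]] full[OF defect_prod_M[OF u_M]])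
  finally have "defect_prod xs u = e *\<^sub>C u"
    using nz by (metis e_def cl2.scale_scale divide_inverse mult.commute cl2.scale_one left_inverse)
  note Eu = this
  have e0: "e \<noteq> 0"
  proof
    assume "e = 0"
    then have "defect j (defect_prod xs u) = 0"
      using defect_scale[of j 0 0] by (simp add: Eu)
    then show False
      using full[OF u_M] nz assms by simp
  qed
  \<comment> \<open>With \<open>X\<close> for the word, \<open>E X u = X E u = e X u\<close>, hence
    \<open>e D X u = D E X u\<close>, a multiple of \<open>u\<close>.\<close>
  have "e *\<^sub>C defect j (word j k l u) = cip (word j k l u) u *\<^sub>C u"
    using full[OF word_M[OF u_M], of j k l] by (simp add: defect_prod_word[OF j u_M] Eu word_scale defect_scale)
  then have "defect j (word j k l u) = (cip (word j k l u) u / e) *\<^sub>C u"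
    using e0 by (metis cl2.scale_scale divide_inverse mult.commute cl2.scale_one left_inverse)
  then show ?thesis
    using that e0 nz by auto
qed

text \<open>Defect and words of coordinate \<open>j\<close> commute with the adjoints of the other
  coordinates, so the relation spreads from \<open>u\<close> with the same constant
  \<open>c\<close>.\<close>

lemma defect_word_w:
  assumes "defect j (word j k l u) = c *\<^sub>C u" "\<alpha> j = 0"
  shows "defect j (word j k l (w \<alpha>)) = c *\<^sub>C w \<alpha>"
proof -
  have "w \<alpha> \<in> {v \<in> M. defect j (word j k l v) = c *\<^sub>C v}"
    by (rule w_induct[where j = j and \<alpha> = \<alpha>]) (use assms u_M in \<open>auto simp: word_Rs Rs_defect word_M Rs_scale\<close>)
  then show ?thesis
    by simp
qed

lemma gram_word: "\<alpha> j = 0 \<Longrightarrow> \<beta> j = 0 \<Longrightarrow> gram (\<alpha>(j := k)) (\<beta>(j := l)) = cip (word j k l (w \<alpha>)) (w \<beta>)"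
proof -
  assume 0: "\<alpha> j = 0" "\<beta> j = 0"
  have *: "cip f ((Rs j ^^ l) h) = cip ((T j ^^ l) f) h" if "f \<in> M" for f h
    using that by (induction l arbitrary: f h) (auto simp: cip_Rs inv T_pow_M funpow_swap1)
  show ?thesis
    using Rs_pow_w[of k j \<alpha>] Rs_pow_w[of l j \<beta>] 0 by (simp add: gram_def word_def *[symmetric] Rs_pow_M w_M)
qed

text \<open>The defect is self-adjoint on \<open>M\<close> and, by the empty word, multiplies
  \<open>w \<beta>\<close> by a nonzero constant. Moving it across the inner product shows that a
  word in coordinate \<open>j\<close> scales \<open>gram \<alpha> \<beta>\<close> by a factor
  independent of \<alpha> and \<beta>; zero multi-indices identify that factor.\<close>

lemma gram_split:
  assumes "u \<noteq> 0" "\<alpha> j = 0" "\<beta> j = 0"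
  shows "gram (\<alpha>(j := k)) (\<beta>(j := l)) * cip u u
    = gram1 j k l * gram \<alpha> \<beta>"
proof -
  obtain c where c: "defect j (word j k l u) = c *\<^sub>C u"
    using defect_word_u[OF assms(1)] by blast
  have X0: "word j 0 0 f = f" for f
    by (simp add: word_def)
  obtain e where e: "defect j (word j 0 0 u) = e *\<^sub>C u" "e \<noteq> 0"
    using defect_word_u[OF assms(1), of j 0 0] X0 by metis
  have A: "cnj e * cip (word j k l (w \<alpha>)) (w \<beta>) = c * cip (w \<alpha>) (w \<beta>)" if "\<alpha> j = 0" "\<beta> j = 0" for \<alpha> \<beta>
  proof -
    have "cip (defect j (word j k l (w \<alpha>))) (w \<beta>) = cip (word j k l (w \<alpha>)) (defect j (word j 0 0 (w \<beta>)))"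
      by (simp add: X0 cip_defect word_M w_M)
    then show ?thesis
      by (simp add: defect_word_w[where \<alpha> = \<alpha>, OF c that(1)] defect_word_w[where \<alpha> = \<beta>, OF e(1) that(2)])
  qed
  have "cnj e * (gram (\<alpha>(j := k)) (\<beta>(j := l)) * cip u u)
      = cnj e * (gram1 j k l * gram \<alpha> \<beta>)"
    using A[of \<alpha> \<beta>, OF assms(2,3)] A[of "\<lambda>_. 0" "\<lambda>_. 0", OF refl refl]
    unfolding gram1_def gram_word[of \<alpha> j \<beta>, OF assms(2,3)] gram_word[of "\<lambda>_. 0" j "\<lambda>_. 0", OF refl refl] w_0
    by (simp add: gram_def mult.assoc[symmetric])
  then show ?thesis
    using e(2) by simp
qed

lemma gram_product:
  assumes "u \<noteq> 0"
  shows "gram \<alpha> \<beta> * cip u u ^ CARD('n) = cip u u * (\<Prod>j\<in>UNIV. gram1 j (\<alpha> j) (\<beta> j))"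
proof -
  \<comment> \<open>Entries outside \<open>J\<close> are set to 0. Coordinates are switched on one
    at a time, each at the cost of one factor \<open>cip u u\<close>.\<close>
  define R where "R J \<alpha> = (\<lambda>i. if i \<in> J then \<alpha> i else (0::nat))" for J :: "'n set" and \<alpha>
  have "gram (R J \<alpha>) (R J \<beta>) * cip u u ^ card J = cip u u * (\<Prod>j\<in>J. gram1 j (\<alpha> j) (\<beta> j))"
    if "finite J" for J
    using that
  proof (induction J rule: finite_induct)
    case empty
    then show ?case
      by (simp add: R_def gram_def w_0)
  next
    case (insert j J)
    have R: "R (insert j J) \<alpha> = (R J \<alpha>)(j := \<alpha> j)" "R J \<alpha> j = 0" for \<alpha>
      using insert.hyps by (auto simp: R_def)
    show ?case
    proof -
      have "gram (R (insert j J) \<alpha>) (R (insert j J) \<beta>) * cip u u ^ card (insert j J)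
          = (gram ((R J \<alpha>)(j := \<alpha> j)) ((R J \<beta>)(j := \<beta> j)) * cip u u) * cip u u ^ card J"
        using insert.hyps by (simp add: R(1))
      also have "\<dots> = gram1 j (\<alpha> j) (\<beta> j) * (gram (R J \<alpha>) (R J \<beta>) * cip u u ^ card J)"
        using gram_split[where \<alpha> = "R J \<alpha>" and \<beta> = "R J \<beta>" and j = j and k = "\<alpha> j" and l = "\<beta> j", OF assms R(2) R(2)]
        by simp
      also have "\<dots> = cip u u * (\<Prod>j\<in>insert j J. gram1 j (\<alpha> j) (\<beta> j))"
        using insert by (simp add: mult_ac)
      finally show ?thesis .
    qed
  qed
  from this[of UNIV] show ?thesis
    by (simp add: R_def)
qed

subsection \<open>The tensor factors\<close>

lemma model_eq_ortho_ortho: "model (\<theta> j) = ortho (ortho (range (\<lambda>k. (bshift ^^ k) (g j))))"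
proof (rule closed_csubspace_eqI)
  have "range (\<lambda>k. (bshift ^^ k) (g j)) \<subseteq> model (\<theta> j)"
    using tvec_factor_model by auto
  then show "ortho (ortho (range (\<lambda>k. (bshift ^^ k) (g j)))) \<subseteq> model (\<theta> j)"
    using ortho_mono[OF ortho_mono, of "range (\<lambda>k. (bshift ^^ k) (g j))" "model (\<theta> j)"] by (simp add: ortho_ortho)
  fix f assume f: "f \<in> model (\<theta> j)" "f \<in> ortho (ortho (ortho (range (\<lambda>k. (bshift ^^ k) (g j)))))"
  have "(bshift ^^ k) (g j) \<in> ortho (ortho (range (\<lambda>k. (bshift ^^ k) (g j))))" for k
    by (auto simp: ortho_def[of "ortho _"] intro: ortho_sym)
  then have "cip f ((bshift ^^ k) (g j)) = 0" for k
    using f(2) by (rule orthoD[rotated])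
  then show "f = 0"
    using model_dense[OF inner f(1)] by blast
qed auto

lemma tvec_dense:
  assumes "c \<in> tensor_model \<theta>" "\<And>\<alpha>. cip c (tvec \<alpha>) = 0"
  shows "c = 0"
proof -
  have "cip (tens x) c = 0" if x: "\<And>j. x j \<in> range (\<lambda>k. (bshift ^^ k) (g j))" for x
  proof -
    have "\<forall>j. \<exists>k. x j = (bshift ^^ k) (g j)"
      using x by auto
    then obtain \<alpha> where "\<And>j. x j = (bshift ^^ \<alpha> j) (g j)"
      by metis
    then have "x = (\<lambda>j. (bshift ^^ \<alpha> j) (g j))"
      by auto
    then show ?thesis
      using assms(2)[of \<alpha>] by (subst cip_commute) (simp add: tvec_def)
  qed
  then have "cip (tens x) c = 0" if "\<And>j. x j \<in> model (\<theta> j)" for x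
  proof (rule ortho_tens_slotwise)
    show "x j \<in> ortho (ortho (range (\<lambda>k. (bshift ^^ k) (g j))))" for j
      unfolding model_eq_ortho_ortho[symmetric] by (rule that)
  qed blast
  then have "cip c c = 0"
    by (rule tensor_sub_extend[OF assms(1)[unfolded tensor_model_def]])
  then show ?thesis
    by simp
qed

theorem tensor_decomposition:
  obtains N where "\<And>j. closed_csubspace (N j)" "\<And>j. N j \<subseteq> model (\<theta> j)"
    "\<And>j f. f \<in> N j \<Longrightarrow> cshift (\<theta> j) f \<in> N j" "M = tensor_sub N"
proof (cases "u = 0")
  case True
  have w0: "w \<alpha> = 0" for \<alpha>
  proof -
    have z: "Rs i 0 = 0" for i
      using Rs_scale[of i 0 0] by simp
    \<comment> \<open>\<open>w_induct\<close> needs one slot with exponent 0;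
      \<open>undefined\<close> serves as an arbitrary slot, and its exponent is restored by a power
      of \<open>Rs\<close>.\<close>
    have "w (\<alpha>(undefined := 0)) \<in> {0}"
      by (rule w_induct[where j = undefined and \<alpha> = "\<alpha>(undefined := 0)"]) (auto simp: True z)
    moreover have "(Rs i ^^ k) 0 = 0" for i k
      by (induction k) (auto simp: z)
    ultimately show ?thesis
      using Rs_pow_w[of "\<alpha> undefined" undefined "\<alpha>(undefined := 0)"] by simp
  qed
  have M0: "c = 0" if "c \<in> M" for c
    using tvec_dense[of c] cip_w[OF that] w0 that M(2) by auto
  have c0: "closed_csubspace ({0} :: nat l2 set)" "closed_csubspace ({0} :: ('n \<Rightarrow> nat) l2 set)"
    by (auto simp: closed_csubspace_def cl2.subspace_def)
  have "tensor_sub (\<lambda>_ :: 'n. {0}) \<subseteq> {0}"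
    using tens_eq_0_iff by (intro tensor_sub_least c0) auto
  then have "M = tensor_sub (\<lambda>_. {0})"
    using M0 MD(2) closed_csubspaceD(2)[OF closed_csubspace_tensor_sub] by blast
  moreover have "cshift (\<theta> j) 0 = 0" for j
    by (rule bounded_clinearD[OF bounded_clinear_cshift[OF inner]])
  ultimately show ?thesis
    using that[of "\<lambda>_. {0}"] c0 closed_csubspaceD(2)[OF closed_csubspace_model] by simp
next
  case False
  define p where "p = cip u u"
  have p: "p \<noteq> 0"
    using False by (simp add: p_def)
  \<comment> \<open>\<open>b j k\<close> is the slice, against \<open>g\<close> in the other slots,
    of the \<open>k\<close>-th power of \<open>Rs j\<close> at \<open>u\<close>. Its products with
    the backward shifts of \<open>g j\<close> are the entries \<open>gram1 j k l\<close>.\<close>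
  have "\<exists>b\<in>model (\<theta> j). \<forall>a\<in>model (\<theta> j). cip (tens (g(j := a))) (w ((\<lambda>_. 0)(j := k))) = cip a b" for j k
    by (rule tens_slice[OF closed_csubspace_model[of "\<theta> j"], where x = g and j = j and c = "w ((\<lambda>_. 0)(j := k))"]) blast
  then obtain b where b: "\<And>j k. b j k \<in> model (\<theta> j)"
    "\<And>j k a. a \<in> model (\<theta> j) \<Longrightarrow> cip (tens (g(j := a))) (w ((\<lambda>_. 0)(j := k))) = cip a (b j k)"
    by metis
  have b_tvec: "cip (b j k) ((bshift ^^ l) (g j)) = gram1 j k l" for j k l
  proof -
    have "(\<lambda>i. (bshift ^^ ((\<lambda>_. 0)(j := l)) i) (g i)) = g(j := (bshift ^^ l) (g j))"
      by auto
    then have "cip ((bshift ^^ l) (g j)) (b j k) = cip (tvec ((\<lambda>_. 0)(j := l))) (w ((\<lambda>_. 0)(j := k)))"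
      by (simp add: b(2)[OF tvec_factor_model, symmetric] tvec_def)
    then show ?thesis
      using cip_w[OF w_M, of "(\<lambda>_. 0)(j := k)" "(\<lambda>_. 0)(j := l)"] cip_commute
      by (metis gram1_def gram_def)
  qed
  define tb where "tb \<alpha> = tens (\<lambda>j. b j (\<alpha> j))" for \<alpha>
  \<comment> \<open>By \<open>gram_product\<close> both sides have equal products with every
    \<open>tvec\<close>, and both lie in the tensor model. As \<open>p\<close> is nonzero,
    \<open>w \<alpha>\<close> is an elementary tensor.\<close>
  have tb: "p *\<^sub>C tb \<alpha> = (p ^ CARD('n)) *\<^sub>C w \<alpha>" for \<alpha>
  proof -
    have "p *\<^sub>C tb \<alpha> - (p ^ CARD('n)) *\<^sub>C w \<alpha> = 0"
    proof (rule tvec_dense)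
      have "tb \<alpha> \<in> tensor_model \<theta>" "w \<alpha> \<in> tensor_model \<theta>"
        unfolding tb_def tensor_model_def using b w_M M(2) by (auto intro!: tens_in_tensor_sub simp: tensor_model_def)
      then show "p *\<^sub>C tb \<alpha> - (p ^ CARD('n)) *\<^sub>C w \<alpha> \<in> tensor_model \<theta>"
        by (intro closed_csubspaceD[OF closed_csubspace_tensor_model])
      fix \<beta>
      have "cip (w \<alpha>) (tvec \<beta>) = gram \<alpha> \<beta>"
        using cip_w[OF w_M] by (simp add: gram_def)
      moreover have "cip (tb \<alpha>) (tvec \<beta>) = (\<Prod>j\<in>UNIV. gram1 j (\<alpha> j) (\<beta> j))"
        by (simp add: tb_def tvec_def cip_tens b_tvec)
      ultimately show "cip (p *\<^sub>C tb \<alpha> - (p ^ CARD('n)) *\<^sub>C w \<alpha>) (tvec \<beta>) = 0"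
        using gram_product[OF False, of \<alpha> \<beta>] by (simp add: cip_diff_left p_def mult.commute)
    qed
    then show ?thesis
      by simp
  qed
  define N where "N j = ortho (ortho (range (b j)))" for j
  have tN: "tensor_sub N = tensor_sub (\<lambda>j. range (b j))"
    unfolding N_def by (rule tensor_sub_ortho_ortho)
  have NQ: "N j \<subseteq> model (\<theta> j)" for j
  proof -
    have "range (b j) \<subseteq> model (\<theta> j)"
      using b by auto
    then show ?thesis
      unfolding N_def using ortho_mono[OF ortho_mono, of "range (b j)" "model (\<theta> j)"] by (simp add: ortho_ortho)
  qed
  have bN: "b j k \<in> N j" for j k
    by (auto simp: N_def ortho_def[of "ortho _"] intro: ortho_sym)
  have MN: "M = tensor_sub N"
  proof (rule closed_csubspace_eqI[OF M(1)])
    show "tensor_sub N \<subseteq> M"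
      unfolding tN
    proof (rule tensor_sub_least[OF M(1)])
      fix x assume "\<And>j. x j \<in> range (b j)"
      then have "\<forall>j. \<exists>k. x j = b j k"
        by auto
      then obtain \<alpha> where "\<And>j. x j = b j (\<alpha> j)"
        by metis
      then have "x = (\<lambda>j. b j (\<alpha> j))"
        by auto
      then have "p *\<^sub>C tens x \<in> M"
        using tb[of \<alpha>] MD(5)[OF w_M] by (simp add: tb_def)
      then have "(1 / p) *\<^sub>C (p *\<^sub>C tens x) \<in> M"
        by (rule MD)
      then show "tens x \<in> M"
        using p by simp
    qed
    fix c assume c: "c \<in> M" "c \<in> ortho (tensor_sub N)"
    have "cip c (tvec \<alpha>) = 0" for \<alpha>
    proof -
      have "cip c (p *\<^sub>C tb \<alpha>) = 0"
        using orthoD[OF c(2), of "tb \<alpha>"] bN by (simp add: tb_def tens_in_tensor_sub)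
      then show ?thesis
        using p cip_w[OF c(1), of \<alpha>] by (simp add: tb)
    qed
    then show "c = 0"
      using tvec_dense c(1) M(2) by blast
  qed simp
  have b0: "b j 0 \<noteq> 0" for j
  proof -
    have "tb (\<lambda>_. 0) \<noteq> 0"
      using tb[of "\<lambda>_. 0"] p False by (auto simp: w_0)
    then show ?thesis
      by (auto simp: tb_def tens_eq_0_iff)
  qed
  have "cshift (\<theta> j) f \<in> N j" if f: "f \<in> N j" for j f
  proof -
    \<comment> \<open>Slot \<open>j\<close> is isolated by filling the others with
      \<open>b i 0\<close>, nonzero because their tensor is a nonzero multiple of \<open>u\<close>.
      Pairing with \<open>v\<close> in slot \<open>j\<close> then leaves the wanted product times
      nonzero norms.\<close>
    define h where "h i = b i 0" for i
    have x: "(h(j := f)) i \<in> N i" for i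
      using f bN by (auto simp: h_def)
    then have xQ: "(h(j := f)) i \<in> model (\<theta> i)" for i
      using NQ by blast
    have "T j (tens (h(j := f))) \<in> M"
      using x by (intro inv) (simp add: MN tens_in_tensor_sub)
    then have in_M: "tens (h(j := cshift (\<theta> j) f)) \<in> tensor_sub N"
      using tshift_tens[where \<theta> = \<theta> and x = "h(j := f)" and j = j, OF inner xQ] MN by simp
    have "cip (cshift (\<theta> j) f) v = 0" if v: "v \<in> ortho (N j)" for v
    proof -
      have "tens (h(j := v)) \<in> ortho (tensor_sub N)"
        unfolding ortho_tensor_sub using v by (auto simp: cip_tens_upd_left orthoD)
      then have "cip (tens (h(j := cshift (\<theta> j) f))) (tens (h(j := v))) = 0"
        using in_M by (rule ortho_sym)
      then show ?thesis
        using b0 by (simp add: cip_tens_upd h_def)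
    qed
    then have "cshift (\<theta> j) f \<in> ortho (ortho (N j))"
      by (simp add: ortho_def[of "ortho _"])
    then show ?thesis
      by (simp add: ortho_ortho N_def)
  qed
  then show ?thesis
    using that[of N] NQ MN by (auto simp: N_def)
qed

end

section \<open>Tensor products of invariant subspaces are doubly commuting\<close>

text \<open>\<open>Mul (\<eta> j)\<close> maps \<open>model (\<phi> j)\<close> isometrically into
  \<open>model (\<theta> j)\<close> and intertwines the compressed shifts, since \<theta> is \<eta>
  times \<phi>. On elementary tensors each operator and its adjoint in \<open>M\<close> then touch a
  single slot, so different slots commute.\<close>

lemma tensor_sub_doubly_commuting:
  fixes \<eta> \<phi> \<theta> :: "'n::finite \<Rightarrow> nat l2"
  assumes inner: "\<And>j. inner_seq (\<theta> j)" "\<And>j. inner_seq (\<eta> j)" "\<And>j. inner_seq (\<phi> j)"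
    and factor: "\<And>j. Mul (\<eta> j) (\<phi> j) = \<theta> j"
    and M: "M = tensor_sub (\<lambda>j. Mul (\<eta> j) ` model (\<phi> j))"
    and inv: "\<And>j f. f \<in> M \<Longrightarrow> tshift \<theta> j f \<in> M"
    and ij: "i \<noteq> j" and f: "f \<in> M"
  shows "tshift \<theta> i (tshift \<theta> j f) = tshift \<theta> j (tshift \<theta> i f)"
    and "adj M (tshift \<theta> i) (tshift \<theta> j f) = tshift \<theta> j (adj M (tshift \<theta> i) f)"
proof -
  let ?T = "tshift \<theta>"
  have Mc: "closed_csubspace M"
    by (simp add: M)
  define m where "m h = tens (\<lambda>j. Mul (\<eta> j) (h j))" for h
  have m_iff: "(\<forall>j. x j \<in> Mul (\<eta> j) ` model (\<phi> j)) \<longleftrightarrow> (\<exists>h. (\<forall>j. h j \<in> model (\<phi> j)) \<and> x = (\<lambda>j. Mul (\<eta> j) (h j)))" for x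
  proof
    assume "\<forall>j. x j \<in> Mul (\<eta> j) ` model (\<phi> j)"
    then have "\<forall>j. \<exists>a. a \<in> model (\<phi> j) \<and> x j = Mul (\<eta> j) a"
      by blast
    from choice[OF this] obtain h where "\<forall>j. h j \<in> model (\<phi> j) \<and> x j = Mul (\<eta> j) (h j)" ..
    then show "\<exists>h. (\<forall>j. h j \<in> model (\<phi> j)) \<and> x = (\<lambda>j. Mul (\<eta> j) (h j))"
      by (intro exI[of _ h]) auto
  qed auto
  have MQ: "Mul (\<eta> j) h \<in> model (\<theta> j)" if "h \<in> model (\<phi> j)" for j h
    using that unfolding model_iff factor[symmetric] Mul_assoc[OF inner(2) inner(3), symmetric] cip_Mul[OF inner(2)] .
  have m_M: "m h \<in> M" if "\<And>j. h j \<in> model (\<phi> j)" for h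
    unfolding M m_def using that by (intro tens_in_tensor_sub) auto
  have extend: "cip c v = 0" if "c \<in> M" "\<And>h. (\<And>j. h j \<in> model (\<phi> j)) \<Longrightarrow> cip (m h) v = 0" for c v
  proof (rule tensor_sub_extend)
    show "c \<in> tensor_sub (\<lambda>j. Mul (\<eta> j) ` model (\<phi> j))"
      using that(1) by (simp add: M)
    fix x assume "\<And>j. x j \<in> Mul (\<eta> j) ` model (\<phi> j)"
    then obtain h where "\<forall>j. h j \<in> model (\<phi> j)" "x = (\<lambda>j. Mul (\<eta> j) (h j))"
      using m_iff by blast
    then show "cip (tens x) v = 0"
      using that(2)[of h] by (simp add: m_def)
  qed
  have cshift_Mul: "cshift (\<theta> j) (Mul (\<eta> j) h) = Mul (\<eta> j) (cshift (\<phi> j) h)" for j h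
  proof -
    note L = bounded_clinearD[OF bounded_clinear_Mul[OF inner(2)]]
    have "cip (fshift (Mul (\<eta> j) h)) (\<theta> j) = cip (fshift h) (\<phi> j)"
      unfolding fshift_Mul[OF inner(2)] factor[symmetric] cip_Mul[OF inner(2)] ..
    then show ?thesis
      by (simp add: cshift_def L fshift_Mul[OF inner(2)] factor)
  qed
  have T_m: "?T k (m h) = m (h(k := cshift (\<phi> k) (h k)))" if "\<And>j. h j \<in> model (\<phi> j)" for h k
  proof -
    have "(\<lambda>j. Mul (\<eta> j) (h j))(k := Mul (\<eta> k) (cshift (\<phi> k) (h k))) = (\<lambda>j. Mul (\<eta> j) ((h(k := cshift (\<phi> k) (h k))) j))"
      by auto
    then show ?thesis
      unfolding m_def by (subst tshift_tens) (auto simp: inner MQ that cshift_Mul)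
  qed
  have cshift_in: "(h(k := cshift (\<phi> k) (h k))) j \<in> model (\<phi> j)" if "\<And>j. h j \<in> model (\<phi> j)" for h k j
    using that by (auto intro: cshift_model inner)
  have bshift_in: "(h(k := bshift (h k))) j \<in> model (\<phi> j)" if "\<And>j. h j \<in> model (\<phi> j)" for h k j
    using that by (auto intro: bshift_model inner)
  have cip_m: "cip (m h) (m h') = (\<Prod>j\<in>UNIV. cip (h j) (h' j))" for h h'
    by (simp add: m_def cip_tens cip_Mul inner)
  have cip_m_upd: "cip (m (h(k := a))) (m (h'(k := a'))) = cip a a' * (\<Prod>j\<in>UNIV - {k}. cip (h j) (h' j))" for h h' k a a'
    unfolding cip_m by (subst prod.remove[of UNIV k]) (auto intro!: prod.cong)
  \<comment> \<open>Backward shifting the factor from \<open>model (\<phi> k)\<close> keeps the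
    tensor in \<open>M\<close>, so this is the adjoint in \<open>M\<close>; in general it differs
    from the adjoint in the tensor model, which shifts the product with
    \<open>\<eta> k\<close>.\<close>
  have adj_m: "adj M (?T k) (m h) = m (h(k := bshift (h k)))" if h: "\<And>j. h j \<in> model (\<phi> j)" for h k
  proof (rule adj_eqI[OF Mc bounded_clinear_tshift])
    show "m (h(k := bshift (h k))) \<in> M"
      by (intro m_M bshift_in h)
    fix c assume c: "c \<in> M"
    have "cip c (adj UNIV (?T k) (m h) - m (h(k := bshift (h k)))) = 0"
    proof (rule extend[OF c])
      fix h' assume h': "\<And>j. h' j \<in> model (\<phi> j)"
      have "cip (?T k (m h')) (m h) = cip (m (h'(k := h' k))) (m (h(k := bshift (h k))))"
        using cip_m_upd[of h' k "cshift (\<phi> k) (h' k)" h "h k"] cip_m_upd[of h' k "h' k" h "bshift (h k)"]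
        by (simp add: T_m h' cip_cshift inner h)
      then show "cip (m h') (adj UNIV (?T k) (m h) - m (h(k := bshift (h k)))) = 0"
        by (simp add: cip_diff_right cip_adj_UNIV bounded_clinear_tshift)
    qed
    then show "cip (?T k c) (m h) = cip c (m (h(k := bshift (h k))))"
      by (simp add: cip_diff_right cip_adj_UNIV bounded_clinear_tshift)
  qed
  let ?U = "\<lambda>k. adj UNIV (?T k)"
  show "?T i (?T j f) = ?T j (?T i f)"
  proof (rule l2_eq_on_closed_csubspaceI[OF Mc])
    fix d assume d: "d \<in> M"
    have "cip f (?U j (?U i d) - ?U i (?U j d)) = 0"
    proof (rule extend[OF f])
      fix h assume h: "\<And>j. h j \<in> model (\<phi> j)"
      have "?T i (?T j (m h)) = ?T j (?T i (m h))"
        by (simp only: T_m[OF h] T_m[OF cshift_in[OF h]] fun_upd_other[OF ij] fun_upd_other[OF ij[symmetric]]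
            fun_upd_twist[OF ij])
      then show "cip (m h) (?U j (?U i d) - ?U i (?U j d)) = 0"
        by (simp add: cip_diff_right cip_adj_UNIV bounded_clinear_tshift)
    qed
    then have "cip (?T i (?T j f)) d = cip (?T j (?T i f)) d"
      by (simp add: cip_diff_right cip_adj_UNIV bounded_clinear_tshift)
    then show "cip d (?T i (?T j f)) = cip d (?T j (?T i f))"
      using cip_commute by metis
  qed (intro inv f)+
  note adjM = adj_props[OF Mc bounded_clinear_tshift[of \<theta>]]
  show "adj M (?T i) (?T j f) = ?T j (adj M (?T i) f)"
  proof (rule l2_eq_on_closed_csubspaceI[OF Mc])
    fix d assume d: "d \<in> M"
    \<comment> \<open>Both sides of the relation are rewritten with \<open>c\<close> alone in the
      first argument. Their difference is then orthogonality of \<open>f\<close> to one fixed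
      vector, to be checked on the tensors \<open>m h\<close>.\<close>
    have left: "cip (adj M (?T i) (?T j c)) d = cip c (?U j (?T i d))" for c
      by (simp add: cip_adj_left[OF Mc bounded_clinear_tshift d] cip_adj_UNIV bounded_clinear_tshift)
    have right: "cip (?T j (adj M (?T i) c)) d = cip c (?T i (adj M (?T j) d))" for c
      by (simp add: adjM(2)[OF adjM(1), symmetric] cip_adj_left[OF Mc bounded_clinear_tshift adjM(1)])
    have "cip f (?U j (?T i d) - ?T i (adj M (?T j) d)) = 0"
    proof (rule extend[OF f])
      fix h assume h: "\<And>j. h j \<in> model (\<phi> j)"
      have "adj M (?T i) (?T j (m h)) = ?T j (adj M (?T i) (m h))"
        by (simp only: T_m[OF h] T_m[OF bshift_in[OF h]] adj_m[OF h] adj_m[OF cshift_in[OF h]]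
            fun_upd_other[OF ij] fun_upd_other[OF ij[symmetric]] fun_upd_twist[OF ij])
      then show "cip (m h) (?U j (?T i d) - ?T i (adj M (?T j) d)) = 0"
        unfolding cip_diff_right left[symmetric] right[symmetric] by simp
    qed
    then have "cip (adj M (?T i) (?T j f)) d = cip (?T j (adj M (?T i) f)) d"
      unfolding left right by (simp add: cip_diff_right)
    then show "cip d (adj M (?T i) (?T j f)) = cip d (?T j (adj M (?T i) f))"
      using cip_commute by metis
  qed (intro inv adjM)+
qed

section \<open>Transfer to spaces of functions\<close>

lemma coord_fun:
  "coord (f + g) = coord f + coord g" "coord (f - g) = coord f - coord g"
  "coord (c *\<^sub>C f) = cscale c (coord f)" "coord 0 = 0"
  by (auto simp: cscale_def)

lemma ell2_inner_coord: "ell2_inner (coord f) (coord g) = cip f g"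
  by (simp add: ell2_inner_def cip.rep_eq)

lemma hnorm_coord: "hnorm ell2_inner (coord f) = norm f"
  by (simp add: hnorm_def ell2_inner_coord norm_l2_def inner_l2_def)

lemma hconverges_coord: "hconverges ell2_inner (\<lambda>k. coord (X k)) (coord f) \<longleftrightarrow> X \<longlonglongrightarrow> f"
  unfolding hconverges_def coord_fun(2)[symmetric] hnorm_coord
  by (simp add: tendsto_norm_zero_iff LIM_zero_iff)

lemma cfun_span_coord: "cfun.span (coord ` A) = coord ` cl2.span A"
proof
  show "cfun.span (coord ` A) \<subseteq> coord ` cl2.span A"
  proof (rule cfun.span_minimal)
    show "cfun.subspace (coord ` cl2.span A)"
      unfolding cfun.subspace_def
      by (auto simp flip: coord_fun intro!: imageI cl2.span_zero cl2.span_add cl2.span_scale)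
  qed (auto intro: cl2.span_base)
  have "cl2.span A \<subseteq> coord -` cfun.span (coord ` A)"
  proof (rule cl2.span_minimal)
    show "cl2.subspace (coord -` cfun.span (coord ` A))"
      unfolding cl2.subspace_def
      by (auto simp only: vimage_eq coord_fun intro!: cfun.span_zero cfun.span_add cfun.span_scale)
  qed (auto intro: cfun.span_base)
  then show "coord ` cl2.span A \<subseteq> cfun.span (coord ` A)"
    by auto
qed

lemma closed_span_coord: "closed_span ell2_inner ell2 (coord ` A) = coord ` closure (cl2.span A)"
proof (intro equalityI subsetI)
  fix f assume "f \<in> closed_span ell2_inner ell2 (coord ` A)"
  then obtain X where X: "f \<in> ell2" "\<And>k. X k \<in> coord ` cl2.span A" "hconverges ell2_inner X f"
    by (auto simp: closed_span_def cfun_span_coord)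
  obtain c where c: "f = coord c"
    using X(1) by (auto simp: ell2_eq_range)
  have "\<forall>k. \<exists>y. y \<in> cl2.span A \<and> X k = coord y"
    using X(2) by blast
  from choice[OF this] obtain Y where Y: "\<forall>k. Y k \<in> cl2.span A \<and> X k = coord (Y k)" ..
  then have "X = (\<lambda>k. coord (Y k))"
    by auto
  then have "Y \<longlonglongrightarrow> c"
    using X(3) by (simp add: c hconverges_coord)
  then have "c \<in> closure (cl2.span A)"
    unfolding closure_sequential using Y by blast
  then show "f \<in> coord ` closure (cl2.span A)"
    by (simp add: c)
next
  fix f assume "f \<in> coord ` closure (cl2.span A)"
  then obtain c where c: "f = coord c" "c \<in> closure (cl2.span A)"
    by blast
  then obtain Y where "\<forall>k. Y k \<in> cl2.span A" "Y \<longlonglongrightarrow> c"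
    unfolding closure_sequential by blast
  with c(1) show "f \<in> closed_span ell2_inner ell2 (coord ` A)"
    unfolding closed_span_def cfun_span_coord
    by (auto simp: ell2_eq_range hconverges_coord intro!: exI[of _ "\<lambda>k. coord (Y k)"])
qed

lemma etensor_eq_coord_tens:
  assumes "\<And>j. f j \<in> hardy2"
  shows "etensor f = coord (tens (\<lambda>j. h2seq (f j)))"
  using assms by (simp add: coord_tens_etensor)

lemma tensor_space_eq:
  assumes "\<And>j. E j \<subseteq> hardy2"
  shows "tensor_space E = coord ` tensor_sub (\<lambda>j. h2seq ` E j)"
proof -
  have "{etensor f | f. \<forall>j. f j \<in> E j} = coord ` {tens x | x. \<forall>j. x j \<in> h2seq ` E j}"
  proof (intro equalityI subsetI)
    fix c assume "c \<in> {etensor f | f. \<forall>j. f j \<in> E j}"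
    then obtain f where f: "c = etensor f" "\<And>j. f j \<in> E j"
      by blast
    then have "c = coord (tens (\<lambda>j. h2seq (f j)))"
      using assms by (subst etensor_eq_coord_tens[symmetric]) auto
    then show "c \<in> coord ` {tens x | x. \<forall>j. x j \<in> h2seq ` E j}"
      using f(2) by blast
  next
    fix c assume "c \<in> coord ` {tens x | x. \<forall>j. x j \<in> h2seq ` E j}"
    then obtain x where x: "c = coord (tens x)" "\<And>j. x j \<in> h2seq ` E j"
      by blast
    have "h2fun (x j) \<in> E j" for j
    proof -
      obtain f where "f \<in> E j" "x j = h2seq f"
        using x(2)[of j] by blast
      moreover have "f \<in> hardy2"
        using \<open>f \<in> E j\<close> assms by blast
      ultimately show ?thesis
        by simp
    qed
    then show "c \<in> {etensor f | f. \<forall>j. f j \<in> E j}"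
      unfolding x(1) coord_tens_etensor by blast
  qed
  then show ?thesis
    by (simp add: tensor_space_def closed_span_coord tensor_sub_def)
qed

section \<open>Transfer of submodules, coordinate operators and adjoints\<close>

lemma closed_subspace_coord:
  assumes H: "closed_csubspace H" and M: "closed_subspace ell2_inner (coord ` H) M"
  shows "closed_csubspace (coord -` M)" "coord -` M \<subseteq> H" "M = coord ` (coord -` M)"
proof -
  have sub: "M \<subseteq> coord ` H" "cfun.subspace M"
    using M by (auto simp: closed_subspace_def)
  show MH: "coord -` M \<subseteq> H"
    using sub(1) by (auto simp: coord_inject)
  show "M = coord ` (coord -` M)"
    using sub(1) by auto
  have "closed (coord -` M)"
    unfolding closed_sequential_limits
  proof (intro allI impI, elim conjE)
    fix X c assume X: "\<forall>n. X n \<in> coord -` M" "X \<longlonglongrightarrow> c"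
    \<comment> \<open>\<open>closed_subspace\<close> tests only limits inside the carrier, so the
      limit is first placed in \<open>H\<close>, which is closed.\<close>
    have "c \<in> H"
      using closed_sequentially[OF closed_csubspaceD(1)[OF H], of X c] X MH by auto
    moreover have "hconverges ell2_inner (\<lambda>n. coord (X n)) (coord c)"
      using X(2) by (simp add: hconverges_coord)
    ultimately have "coord c \<in> M"
      using M X(1) unfolding closed_subspace_def by (metis imageI vimageD)
    then show "c \<in> coord -` M"
      by simp
  qed
  moreover have "cl2.subspace (coord -` M)"
    unfolding cl2.subspace_def
    by (auto simp only: vimage_eq coord_fun intro!: cfun.subspace_0[OF sub(2)] cfun.subspace_add[OF sub(2)] cfun.subspace_scale[OF sub(2)])
  ultimately show "closed_csubspace (coord -` M)"
    by (simp add: closed_csubspace_def)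
qed

lemma model_space_subset: "model_space \<theta> \<subseteq> hardy2"
  by (auto simp: model_space_def)

lemma tensor_model_space_eq:
  assumes "\<And>j. inner_function (\<theta> j)"
  shows "tensor_model_space \<theta> = coord ` tensor_model (\<lambda>j. h2seq (\<theta> j))"
  unfolding tensor_model_space_def tensor_model_def
  by (subst tensor_space_eq[OF model_space_subset]) (simp add: h2seq_image_model_space assms)

text \<open>\<open>tensor_operator\<close> is a definite description. The compressed coordinate
  shift shows existence; uniqueness holds because a bounded operator is determined on the closed
  span by its values on elementary tensors.\<close>

lemma tensor_shift_coord:
  fixes \<theta> :: "'n::finite \<Rightarrow> complex \<Rightarrow> complex"
  assumes \<theta>: "\<And>j. inner_function (\<theta> j)" and c: "c \<in> tensor_model (\<lambda>j. h2seq (\<theta> j))"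
  shows "tensor_shift \<theta> j (coord c) = coord (tshift (\<lambda>j. h2seq (\<theta> j)) j c)"
proof -
  define \<theta>' where "\<theta>' j = h2seq (\<theta> j)" for j
  let ?T = "tshift \<theta>' j"
  let ?H = "tensor_space (\<lambda>i. model_space (\<theta> i))"
  let ?A = "\<lambda>i. if i = j then compressed_shift (\<theta> i) else id"
  let ?P = "\<lambda>T. T \<in> extensional ?H \<and> bounded_operator_on ell2_inner ?H T \<and>
    (\<forall>f. (\<forall>j. f j \<in> model_space (\<theta> j)) \<longrightarrow> T (etensor f) = etensor (\<lambda>j. ?A j (f j)))"
  have inner: "inner_seq (\<theta>' j)" for j
    using inner_functionD(3)[OF \<theta>] by (simp add: \<theta>'_def)
  have H: "?H = coord ` tensor_model \<theta>'"
    using tensor_model_space_eq[where \<theta> = \<theta>, OF \<theta>] by (simp add: tensor_model_space_def \<theta>'_def[abs_def])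
  note Lin = bounded_clinearD[OF bounded_clinear_tshift[of \<theta>' j]]
  note QD = closed_csubspaceD[OF closed_csubspace_tensor_model[of \<theta>']]
  have on_tens: "etensor f = coord (tens (\<lambda>i. h2seq (f i))) \<and> (\<forall>i. h2seq (f i) \<in> model (\<theta>' i)) \<and>
      etensor (\<lambda>i. ?A i (f i)) = coord (?T (tens (\<lambda>i. h2seq (f i))))"
    if f: "\<And>i. f i \<in> model_space (\<theta> i)" for f
  proof -
    have fh: "f i = h2fun (h2seq (f i))" and fQ: "h2seq (f i) \<in> model (\<theta>' i)" for i
      using subsetD[OF model_space_subset f[of i]] f[of i] h2seq_image_model_space[OF \<theta>, of i]
      by (auto simp: \<theta>'_def)
    have "?A i (f i) = h2fun (((\<lambda>i. h2seq (f i))(j := cshift (\<theta>' j) (h2seq (f j)))) i)" for i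
      using compressed_shift_h2fun[OF \<theta>, of "h2seq (f i)" i] fQ[of i] fh[of i] by (auto simp: \<theta>'_def)
    then have "etensor (\<lambda>i. ?A i (f i)) = coord (?T (tens (\<lambda>i. h2seq (f i))))"
      unfolding tshift_tens[where \<theta> = \<theta>' and x = "\<lambda>i. h2seq (f i)" and j = j, OF inner fQ] coord_tens_etensor by simp
    then show ?thesis
      using etensor_eq_coord_tens[of f] f model_space_subset fQ by blast
  qed
  have image_tshift: "tens x \<in> tensor_model \<theta>'" if "\<And>i. x i \<in> model (\<theta>' i)" for x
    using that unfolding tensor_model_def by (rule tens_in_tensor_sub)
  \<comment> \<open>Restriction assigns \<open>undefined\<close> off the carrier, as
    \<open>extensional\<close> demands.\<close>
  define T0 where "T0 = restrict (\<lambda>f. coord (?T (inv coord f))) ?H"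
  have inv_coord: "inv coord (coord x) = x" for x :: "('n \<Rightarrow> nat) l2"
    by (rule inv_f_f) (simp add: inj_def coord_inject)
  have T0: "T0 (coord x) = coord (?T x)" if "x \<in> tensor_model \<theta>'" for x
    using that by (simp add: T0_def H inv_coord)
  obtain C where C: "\<And>x. norm (?T x) \<le> norm x * C"
    using bounded_linear.bounded[OF Lin(1)] by blast
  have "?P T0"
  proof (intro conjI allI impI)
    show "T0 \<in> extensional ?H"
      by (simp add: T0_def)
    show "bounded_operator_on ell2_inner ?H T0"
      unfolding bounded_operator_on_def H
    proof (intro conjI ballI allI exI[of _ C])
      fix f assume "f \<in> coord ` tensor_model \<theta>'"
      then obtain x where x: "f = coord x" "x \<in> tensor_model \<theta>'"
        by blast
      show "T0 f \<in> coord ` tensor_model \<theta>'"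
        using x by (simp add: T0 tshift_in_tensor_model)
      show "hnorm ell2_inner (T0 f) \<le> C * hnorm ell2_inner f"
        using x C[of x] by (simp add: T0 hnorm_coord mult.commute)
      show "T0 (cscale c f) = cscale c (T0 f)" for c
        using x T0[OF QD(5)[OF x(2), of c]] by (simp add: coord_fun(3)[symmetric] T0 Lin)
      fix h assume "h \<in> coord ` tensor_model \<theta>'"
      then obtain y where y: "h = coord y" "y \<in> tensor_model \<theta>'"
        by blast
      show "T0 (f + h) = T0 f + T0 h"
        using x y T0[OF QD(3)[OF x(2) y(2)]] by (simp only: coord_fun(1)[symmetric] T0 Lin)
    qed
    fix f assume f: "\<forall>j. f j \<in> model_space (\<theta> j)"
    then show "T0 (etensor f) = etensor (\<lambda>j. ?A j (f j))"
      using on_tens[of f] T0 image_tshift by auto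
  qed
  moreover have "T = T0" if T: "?P T" for T
  proof
    fix f
    have TH: "T f \<in> ?H" if "f \<in> ?H" for f
      using T that by (simp add: bounded_operator_on_def)
    have T_add: "T (f + h) = T f + T h" if "f \<in> ?H" "h \<in> ?H" for f h
      using T that by (simp add: bounded_operator_on_def)
    have T_scale: "T (cscale c f) = cscale c (T f)" if "f \<in> ?H" for f c
      using T that by (simp add: bounded_operator_on_def)
    obtain K where K: "\<And>f. f \<in> ?H \<Longrightarrow> hnorm ell2_inner (T f) \<le> K * hnorm ell2_inner f"
      using T unfolding bounded_operator_on_def by blast
    have mem: "coord x \<in> ?H \<longleftrightarrow> x \<in> tensor_model \<theta>'" for x
      by (auto simp: H coord_inject)
    define D where "D = {x \<in> tensor_model \<theta>'. T (coord x) = coord (?T x)}"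
    have "cl2.subspace D"
    proof -
      have "T (coord 0) = coord (?T 0)"
      proof -
        have zero: "cscale 0 f = coord 0" for f :: "('n \<Rightarrow> nat) \<Rightarrow> complex"
          by (simp add: cscale_def fun_eq_iff)
        show ?thesis
          using T_scale[of "coord 0" 0] QD(2) by (simp only: zero mem Lin)
      qed
      then show ?thesis
        unfolding cl2.subspace_def D_def
        by (auto simp: QD coord_fun(1,3) T_add T_scale mem Lin simp del: coord_simps)
    qed
    moreover have "{tens x | x. \<forall>i. x i \<in> model (\<theta>' i)} \<subseteq> D"
    proof clarify
      fix x assume x: "\<forall>i. x i \<in> model (\<theta>' i)"
      define h where "h i = h2fun (x i)" for i
      have h: "h i \<in> model_space (\<theta> i)" for i
        using x model_space_eq[OF \<theta>, of i] by (auto simp: h_def \<theta>'_def)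
      have "T (etensor h) = etensor (\<lambda>i. ?A i (h i))"
        using T h by blast
      then show "tens x \<in> D"
        using on_tens[OF h] x image_tshift by (simp add: D_def h_def)
    qed
    ultimately have span_D: "cl2.span {tens x | x. \<forall>i. x i \<in> model (\<theta>' i)} \<subseteq> D"
      by (intro cl2.span_minimal)
    have "T (coord x) = coord (?T x)" if x: "x \<in> tensor_model \<theta>'" for x
    proof -
      obtain Y where Y: "\<And>k. Y k \<in> cl2.span {tens x | x. \<forall>i. x i \<in> model (\<theta>' i)}" "Y \<longlonglongrightarrow> x"
        using x unfolding tensor_model_def tensor_sub_def closure_sequential by blast
      then have YD: "Y k \<in> D" for k
        using span_D by blast
      obtain y where y: "T (coord x) = coord y"
        using TH[of "coord x"] x by (auto simp: H)
      have YQ: "Y k \<in> tensor_model \<theta>'" "T (coord (Y k)) = coord (?T (Y k))" for k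
        using YD[of k] by (auto simp: D_def)
      \<comment> \<open>The bound for \<open>T\<close> is available on the carrier only, so it is
        applied to the difference \<open>Y k - x\<close>, which lies there.\<close>
      have bound: "norm (?T (Y k) - y) \<le> K * norm (Y k - x)" for k
      proof -
        have "T (coord (Y k)) = T (coord (Y k - x) + coord x)"
          by (simp add: coord_fun)
        also have "\<dots> = T (coord (Y k - x)) + T (coord x)"
          using YQ x QD(4) by (intro T_add) (auto simp: mem)
        finally have "T (coord (Y k - x)) = coord (?T (Y k) - y)"
          by (simp add: YQ y coord_fun)
        then show ?thesis
          using K[of "coord (Y k - x)"] YQ(1)[of k] x QD(4) by (simp add: mem hnorm_coord)
      qed
      have "(\<lambda>k. K * norm (Y k - x)) \<longlonglongrightarrow> 0"
        by (intro tendsto_mult_right_zero tendsto_norm_zero LIM_zero Y(2))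
      then have "(\<lambda>k. ?T (Y k) - y) \<longlonglongrightarrow> 0"
        by (rule Lim_null_comparison[OF always_eventually[OF allI[OF bound]]])
      then have "(\<lambda>k. ?T (Y k)) \<longlonglongrightarrow> y"
        by (simp add: LIM_zero_iff)
      from LIMSEQ_unique[OF this bounded_linear.tendsto[OF Lin(1) Y(2)]] show ?thesis
        by (simp only: y)
    qed
    then show "T f = T0 f"
    proof (cases "f \<in> ?H")
      case True
      then show ?thesis
        using \<open>\<And>x. x \<in> tensor_model \<theta>' \<Longrightarrow> T (coord x) = coord (?T x)\<close> T0 by (auto simp: H)
    next
      case False
      then show ?thesis
        using T by (auto simp: T0_def extensional_def)
    qed
  qed
  ultimately have "(THE T. ?P T) = T0"
    by (rule the_equality)
  then have "tensor_shift \<theta> j = T0"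
    by (simp add: tensor_shift_def tensor_operator_def)
  then show ?thesis
    using T0 c by (simp add: \<theta>'_def[abs_def])
qed

lemma adjoint_on_coord:
  assumes M: "closed_csubspace M" and T: "bounded_clinear T" and R: "\<And>f. f \<in> M \<Longrightarrow> R (coord f) = coord (T f)"
  shows "adjoint_on ell2_inner (coord ` M) R (coord g) = coord (adj M T g)"
  unfolding adjoint_on_def
proof (rule the_equality)
  note A = adj_props[OF M T]
  show "coord (adj M T g) \<in> coord ` M \<and>
      (\<forall>f\<in>coord ` M. ell2_inner (R f) (coord g) = ell2_inner f (coord (adj M T g)))"
    using A by (auto simp: R ell2_inner_coord)
  fix h assume h: "h \<in> coord ` M \<and> (\<forall>f\<in>coord ` M. ell2_inner (R f) (coord g) = ell2_inner f h)"
  then obtain y where y: "h = coord y" "y \<in> M"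
    by blast
  have "adj M T g = y"
    by (rule adj_eqI[OF M T y(2)]) (use h in \<open>auto simp: y R ell2_inner_coord\<close>)
  then show "h = coord (adj M T g)"
    by (simp add: y)
qed

lemma doubly_commuting_on_coord:
  fixes \<theta> :: "'n::{finite,linorder} \<Rightarrow> complex \<Rightarrow> complex"
  defines "T \<equiv> tshift (\<lambda>j. h2seq (\<theta> j))"
  assumes \<theta>: "\<And>j. inner_function (\<theta> j)"
    and M: "closed_csubspace M" "M \<subseteq> tensor_model (\<lambda>j. h2seq (\<theta> j))" and inv: "\<And>j f. f \<in> M \<Longrightarrow> T j f \<in> M"
  shows "doubly_commuting_on ell2_inner (coord ` M) (tensor_shift \<theta>) \<longleftrightarrow>
    (\<forall>i j. i < j \<longrightarrow> (\<forall>f\<in>M. T i (T j f) = T j (T i f) \<and> adj M (T i) (T j f) = T j (adj M (T i) f)))"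
proof -
  have R: "tensor_shift \<theta> j (coord f) = coord (T j f)" if "f \<in> M" for j f
    using tensor_shift_coord[where \<theta> = \<theta> and c = f and j = j, OF \<theta>] that M(2) by (auto simp: T_def)
  have T: "bounded_clinear (T j)" for j
    unfolding T_def by (rule bounded_clinear_tshift)
  have A: "adjoint_on ell2_inner (coord ` M) (tensor_shift \<theta> j) (coord f) = coord (adj M (T j) f)" for j f
    by (rule adjoint_on_coord[OF M(1) T R])
  show ?thesis
    unfolding doubly_commuting_on_def
    by (simp add: R A inv adj_props(1)[OF M(1) T] coord_inject)
qed

text \<open>Taking adjoints in the relation for the pair \<open>S\<close>, \<open>T\<close> gives
  the relation for the pair \<open>T\<close>, \<open>S\<close>.\<close>

lemma adj_commute_sym:
  assumes M: "closed_csubspace M" and T: "bounded_clinear S" "bounded_clinear T"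
    and inv: "\<And>f. f \<in> M \<Longrightarrow> S f \<in> M" "\<And>f. f \<in> M \<Longrightarrow> T f \<in> M"
    and ST: "\<And>f. f \<in> M \<Longrightarrow> adj M S (T f) = T (adj M S f)" and f: "f \<in> M"
  shows "adj M T (S f) = S (adj M T f)"
proof (rule l2_eq_on_closed_csubspaceI[OF M])
  note A = adj_props[OF M T(1)] and B = adj_props[OF M T(2)]
  show "adj M T (S f) \<in> M" "S (adj M T f) \<in> M"
    by (auto intro: B inv)
  fix d assume d: "d \<in> M"
  have "cip (S (adj M T f)) d = cip (adj M T f) (adj M S d)"
    using A(2)[OF B(1)] by simp
  also have "\<dots> = cip f (T (adj M S d))"
    by (rule cip_adj_left[OF M T(2) A(1)])
  also have "\<dots> = cip f (adj M S (T d))"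
    by (simp add: ST d)
  also have "\<dots> = cip (S f) (T d)"
    by (rule A(2)[OF f])
  also have "\<dots> = cip (adj M T (S f)) d"
    by (rule cip_adj_left[OF M T(2) d, symmetric])
  finally show "cip d (adj M T (S f)) = cip d (S (adj M T f))"
    using cip_commute by metis
qed

section \<open>Factorisations of inner functions and the final equivalence\<close>

lemma h2fun_h2seq_inner_function:
  assumes "inner_function \<theta>" "z \<in> ball 0 1"
  shows "h2fun (h2seq \<theta>) z = \<theta> z"
  using sums_unique2[OF h2fun_sums[OF assms(2), of "h2seq \<theta>"]] taylor_sums[OF inner_functionD(1)[OF assms(1)] assms(2)]
  by (simp add: coord_h2seq inner_functionD(2)[OF assms(1)])

text \<open>Sequences see an inner function through its values on the disc alone, hence the
  factorisation is tested on \<open>ball 0 1\<close>.\<close>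

lemma Mul_h2seq_eq_iff:
  assumes \<eta>: "inner_function \<eta>" and \<phi>: "inner_function \<phi>" and \<theta>: "inner_function \<theta>"
  shows "Mul (h2seq \<eta>) (h2seq \<phi>) = h2seq \<theta> \<longleftrightarrow> (\<forall>z\<in>ball 0 1. \<eta> z * \<phi> z = \<theta> z)"
proof -
  have z0: "h2fun x z = 0" if "z \<notin> ball 0 1" for x z
    using that by (simp add: h2fun_def)
  have "Mul (h2seq \<eta>) (h2seq \<phi>) = h2seq \<theta> \<longleftrightarrow> h2fun (Mul (h2seq \<eta>) (h2seq \<phi>)) = h2fun (h2seq \<theta>)"
    by (simp add: h2fun_inject)
  also have "\<dots> \<longleftrightarrow> (\<forall>z\<in>ball 0 1. h2fun (Mul (h2seq \<eta>) (h2seq \<phi>)) z = h2fun (h2seq \<theta>) z)"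
    unfolding fun_eq_iff using z0 by metis
  also have "\<dots> \<longleftrightarrow> (\<forall>z\<in>ball 0 1. \<eta> z * \<phi> z = \<theta> z)"
    by (intro ball_cong refl)
      (simp only: h2fun_Mul[OF inner_functionD(3)[OF \<eta>]] times_fun_def h2fun_h2seq_inner_function \<eta> \<phi> \<theta>)
  finally show ?thesis .
qed

lemma tensor_space_eq_tensor_sub:
  assumes \<eta>: "\<And>j. inner_function (\<eta> j)" and \<phi>: "\<And>j. inner_function (\<phi> j)"
  shows "tensor_space (\<lambda>j. (\<lambda>f. \<eta> j * f) ` model_space (\<phi> j))
    = coord ` tensor_sub (\<lambda>j. Mul (h2seq (\<eta> j)) ` model (h2seq (\<phi> j)))"
proof -
  have E: "(\<lambda>f. \<eta> j * f) ` model_space (\<phi> j) = h2fun ` Mul (h2seq (\<eta> j)) ` model (h2seq (\<phi> j))" for j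
    unfolding model_space_eq[OF \<phi>] image_image inner_function_mult_h2fun[OF \<eta>] ..
  show ?thesis
    unfolding E by (subst tensor_space_eq) (auto simp: image_image)
qed

theorem theorem1p2:
  fixes \<theta> :: "'n::{finite,linorder} \<Rightarrow> complex \<Rightarrow> complex"
    and M :: "(('n \<Rightarrow> nat) \<Rightarrow> complex) set"
  assumes "CARD('n) > 1"
    and "\<And>j. inner_function (\<theta> j)"
    and "\<And>j. \<not> \<theta> j constant_on ball 0 1"
    and "is_submodule \<theta> M"
  shows "doubly_commuting_submodule \<theta> M \<longleftrightarrow>
    (\<exists>\<eta> \<phi>. (\<forall>j. inner_function (\<eta> j) \<and> inner_function (\<phi> j) \<and>
              (\<forall>z\<in>ball 0 1. \<eta> j z * \<phi> j z = \<theta> j z)) \<and>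
           M = tensor_space (\<lambda>j. (\<lambda>f. \<eta> j * f) ` model_space (\<phi> j)))"
proof -
  note \<theta> = assms(2)
  define \<theta>' where "\<theta>' j = h2seq (\<theta> j)" for j
  define M' where "M' = coord -` M"
  have inner: "inner_seq (\<theta>' j)" for j
    using inner_functionD(3)[OF \<theta>] by (simp add: \<theta>'_def)
  have "closed_subspace ell2_inner (coord ` tensor_model \<theta>') M"
    using assms(4) tensor_model_space_eq[where \<theta> = \<theta>, OF \<theta>] by (simp add: is_submodule_def \<theta>'_def[abs_def])
  note M' = closed_subspace_coord[OF closed_csubspace_tensor_model this, folded M'_def]
  have inv: "tshift \<theta>' j f \<in> M'" if "f \<in> M'" for j f
  proof -
    have "tensor_shift \<theta> j (coord f) \<in> M"
      using assms(4) that by (auto simp: is_submodule_def M'_def)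
    then show ?thesis
      using tensor_shift_coord[where \<theta> = \<theta> and c = f and j = j, OF \<theta>] that M'(2) by (auto simp: M'_def \<theta>'_def[abs_def])
  qed
  have dc: "doubly_commuting_submodule \<theta> M \<longleftrightarrow>
    (\<forall>i j. i < j \<longrightarrow> (\<forall>f\<in>M'. tshift \<theta>' i (tshift \<theta>' j f) = tshift \<theta>' j (tshift \<theta>' i f) \<and>
      adj M' (tshift \<theta>' i) (tshift \<theta>' j f) = tshift \<theta>' j (adj M' (tshift \<theta>' i) f)))"
    using doubly_commuting_on_coord[where \<theta> = \<theta>, OF \<theta> M'(1)] M' inv assms(4)
    by (simp add: doubly_commuting_submodule_def \<theta>'_def[abs_def])
  show ?thesis
  proof
    assume "doubly_commuting_submodule \<theta> M"
    then have comm: "tshift \<theta>' i (tshift \<theta>' j f) = tshift \<theta>' j (tshift \<theta>' i f)"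
      "adj M' (tshift \<theta>' i) (tshift \<theta>' j f) = tshift \<theta>' j (adj M' (tshift \<theta>' i) f)" if "i < j" "f \<in> M'" for i j f
      using that by (auto simp: dc)
    interpret dc_submodule \<theta>' M'
    proof
      fix i j :: 'n and f
      assume ij: "i \<noteq> j" and f: "f \<in> M'"
      show "tshift \<theta>' i (tshift \<theta>' j f) = tshift \<theta>' j (tshift \<theta>' i f)"
        using comm(1)[of i j f] comm(1)[of j i f] ij f by (cases i j rule: linorder_cases) auto
      show "adj M' (tshift \<theta>' i) (tshift \<theta>' j f) = tshift \<theta>' j (adj M' (tshift \<theta>' i) f)"
      proof (cases "i < j")
        case False
        then have "j < i"
          using ij by simp
        then show ?thesis
          using adj_commute_sym[OF M'(1) bounded_clinear_tshift bounded_clinear_tshift inv inv comm(2)] f by blast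
      qed (use comm f in blast)
    qed (use inner M' inv in auto)
    obtain N where N: "\<And>j. closed_csubspace (N j)" "\<And>j. N j \<subseteq> model (\<theta>' j)"
      "\<And>j f. f \<in> N j \<Longrightarrow> cshift (\<theta>' j) f \<in> N j" "M' = tensor_sub N"
      using tensor_decomposition by metis
    \<comment> \<open>The two factors are tied together by their product, so they are chosen as one
      pair for each \<open>j\<close>.\<close>
    have "\<forall>j. \<exists>p. inner_seq (fst p) \<and> inner_seq (snd p) \<and> Mul (fst p) (snd p) = \<theta>' j \<and> N j = Mul (fst p) ` model (snd p)"
    proof
      fix j
      obtain \<eta> \<phi> where "inner_seq \<eta>" "inner_seq \<phi>" "Mul \<eta> \<phi> = \<theta>' j" "N j = Mul \<eta> ` model \<phi>"
        by (rule cshift_invariant_subspace[OF inner N(1,2,3)])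
      then show "\<exists>p. inner_seq (fst p) \<and> inner_seq (snd p) \<and> Mul (fst p) (snd p) = \<theta>' j \<and> N j = Mul (fst p) ` model (snd p)"
        by (intro exI[of _ "(\<eta>, \<phi>)"]) simp
    qed
    from choice[OF this] obtain p where p: "\<And>j. inner_seq (fst (p j))" "\<And>j. inner_seq (snd (p j))"
      "\<And>j. Mul (fst (p j)) (snd (p j)) = \<theta>' j" "\<And>j. N j = Mul (fst (p j)) ` model (snd (p j))"
      by blast
    define \<eta> \<phi> where "\<eta> j = h2fun (fst (p j))" and "\<phi> j = h2fun (snd (p j))" for j
    have in_fun: "inner_function (\<eta> j)" "inner_function (\<phi> j)" for j
      by (simp_all add: \<eta>_def \<phi>_def inner_function_h2fun p)
    have "\<forall>z\<in>ball 0 1. \<eta> j z * \<phi> j z = \<theta> j z" for j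
      using Mul_h2seq_eq_iff[OF in_fun(1)[of j] in_fun(2)[of j] \<theta>[of j]] p(3)[of j] by (simp add: \<eta>_def \<phi>_def \<theta>'_def)
    moreover have "N = (\<lambda>j. Mul (h2seq (\<eta> j)) ` model (h2seq (\<phi> j)))"
      by (auto simp: \<eta>_def \<phi>_def p(4))
    then have "M = tensor_space (\<lambda>j. (\<lambda>f. \<eta> j * f) ` model_space (\<phi> j))"
      using M'(3) N(4) tensor_space_eq_tensor_sub[where \<eta> = \<eta> and \<phi> = \<phi>, OF in_fun] by simp
    ultimately show "\<exists>\<eta> \<phi>. (\<forall>j. inner_function (\<eta> j) \<and> inner_function (\<phi> j) \<and>
        (\<forall>z\<in>ball 0 1. \<eta> j z * \<phi> j z = \<theta> j z)) \<and> M = tensor_space (\<lambda>j. (\<lambda>f. \<eta> j * f) ` model_space (\<phi> j))"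
      using in_fun by blast
  next
    assume "\<exists>\<eta> \<phi>. (\<forall>j. inner_function (\<eta> j) \<and> inner_function (\<phi> j) \<and>
        (\<forall>z\<in>ball 0 1. \<eta> j z * \<phi> j z = \<theta> j z)) \<and> M = tensor_space (\<lambda>j. (\<lambda>f. \<eta> j * f) ` model_space (\<phi> j))"
    then obtain \<eta> \<phi> where in_fun: "\<And>j. inner_function (\<eta> j)" "\<And>j. inner_function (\<phi> j)"
      and mult: "\<And>j. \<forall>z\<in>ball 0 1. \<eta> j z * \<phi> j z = \<theta> j z"
      and M_eq: "M = tensor_space (\<lambda>j. (\<lambda>f. \<eta> j * f) ` model_space (\<phi> j))"
      by blast
    have factor: "Mul (h2seq (\<eta> j)) (h2seq (\<phi> j)) = \<theta>' j" for j
      using Mul_h2seq_eq_iff[OF in_fun(1)[of j] in_fun(2)[of j] \<theta>[of j]] mult by (simp add: \<theta>'_def)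
    have "M' = tensor_sub (\<lambda>j. Mul (h2seq (\<eta> j)) ` model (h2seq (\<phi> j)))"
      unfolding M'_def M_eq tensor_space_eq_tensor_sub[where \<eta> = \<eta> and \<phi> = \<phi>, OF in_fun] by (auto simp: coord_inject)
    note dcM = tensor_sub_doubly_commuting[OF inner inner_functionD(3)[OF in_fun(1)] inner_functionD(3)[OF in_fun(2)]
        factor this inv]
    show "doubly_commuting_submodule \<theta> M"
      unfolding dc using dcM by (metis less_irrefl)
  qed
qed

end
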